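(* Let $m\ge3$ be an integer, $\Gamma_1,\dots,\Gamma_m$ non-trivial finite groups, and $\Gamma=\Gamma_1*\cdots*\Gamma_m$ their free product. Let $S_1,\dots,S_m$ be symmetric sets of generators of $\Gamma_1,\dots,\Gamma_m$ and $S=S_1\cup\dots\cup S_m$. Let $p\in\mathbb C[\Gamma]$ have support $S$ and satisfy $p=p^*$. Then there exists a compact interval $I_0\subset\mathbb R$ with non-empty interior such that conditions (AC) and (R4) hold for $P=\lambda(p)$ on $I_0$. The same conclusion holds for $m=2$ in the case of complete graphs, i.e. when $\Gamma=\Gamma_1*\Gamma_2$ with $\Gamma_1,\Gamma_2$ finite groups, $S_i=\Gamma_i\setminus\{e\}$ for $i=1,2$, $|\Gamma_1|\ge3$, $|\Gamma_2|\ge2$, and $p=p_1\mathbf 1_{S_1}+p_2\mathbf 1_{S_2}$ with $p_1,p_2>0$.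
   Context: $e$ is the unit of $\Gamma$; $|g|$ is the word length of $g\in\Gamma$ for a fixed finite generating set. $\mathbb C[\Gamma]$ is the group algebra of finite sums $p=\sum_g p_g g$, with $p^*=\sum_g\bar p_g g^{-1}$; the support of $p$ is $\{g:p_g\ne0\}$; $\mathbf 1_A=\sum_{g\in A}g$. A set is symmetric if it is stable under inverses. $\lambda$ is the left regular representation on $\ell^2(\Gamma)$, $\lambda(g)\delta_v=\delta_{gv}$, and $\lambda(p)=\sum_g p_g\lambda(g)$. $R^z=(P-z\,\mathrm{Id})^{-1}$, $\Im R^z=(R^z-(R^z)^* )/(2i)$ and $Q(g,h)=\langle\delta_g,Q\delta_h\rangle$. (AC) on $I_0$: there is $C_0\ge1$ with $C_0^{-1}\le(\Im R^z)(e,e)\le C_0$ for all $z=E+i\eta$, $E\in I_0$, $0<\eta\le1$. (R4) on $I_0$: for some $C_1'>2C_1+1$, $\displaystyle\lim_{\eta\to0}\sup_{\lambda_0\in I_0}\sum_{g\in\Gamma}\eta^2|(\Im R^{\lambda_0+i\eta})(e,g)|^4|g|^{C_1'}=0$. Here $C_1$ is a rapid decay exponent of $\Gamma$: a constant $C_1>0$ for which there are $C>0$ and a finite generating set $S'$ such that $\|\lambda(q)\|_{\rm op}\le C(\mathrm{diam}_{S'}(q))^{C_1}(\sum_g|q_g|^2)^{1/2}$ for all $q\in\mathbb C[\Gamma]$, where $\mathrm{diam}_{S'}(q)$ is the maximum of $1$ and the diameter of the support of $q$ in $\mathrm{Cay}(\Gamma,S')$ (edges from $g$ to $sg$, $s\in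 S'$). Such a constant exists for these free products (known fact). *)

theory Defs
  imports "HOL-Analysis.Analysis" "HOL-Algebra.Generated_Groups"
begin

section \<open>Free products of groups\<close>

text \<open>
  The free product is realised on reduced words: lists of letters \<open>(i, a)\<close> with \<open>a\<close> a
  non-trivial element of the \<open>i\<close>-th factor, adjacent letters coming from different factors.
\<close>

definition reduced_words :: "'i set \<Rightarrow> ('i \<Rightarrow> ('a, 'b) monoid_scheme) \<Rightarrow> ('i \<times> 'a) list set" where
  "reduced_words I G =
     {w. (\<forall>(i, a) \<in> set w. i \<in> I \<and> a \<in> carrier (G i) \<and> a \<noteq> \<one>\<^bsub>G i\<^esub>)
         \<and> successively (\<lambda>x y. fst x \<noteq> fst y) w}"

text \<open>Left multiplication of a reduced word by one (possibly trivial) element of a factor.\<close>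

fun letter_mult :: "('i \<Rightarrow> ('a, 'b) monoid_scheme) \<Rightarrow> 'i \<times> 'a \<Rightarrow> ('i \<times> 'a) list \<Rightarrow> ('i \<times> 'a) list" where
  "letter_mult G (i, a) [] = (if a = \<one>\<^bsub>G i\<^esub> then [] else [(i, a)])"
| "letter_mult G (i, a) ((j, b) # w) =
     (if a = \<one>\<^bsub>G i\<^esub> then (j, b) # w
      else if i \<noteq> j then (i, a) # (j, b) # w
      else if a \<otimes>\<^bsub>G i\<^esub> b = \<one>\<^bsub>G i\<^esub> then w
      else (i, a \<otimes>\<^bsub>G i\<^esub> b) # w)"

definition free_product :: "'i set \<Rightarrow> ('i \<Rightarrow> ('a, 'b) monoid_scheme) \<Rightarrow> ('i \<times> 'a) list monoid" where
  "free_product I G =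
     \<lparr> carrier = reduced_words I G, mult = (\<lambda>u v. foldr (letter_mult G) u v), one = [] \<rparr>"

text \<open>The canonical embedding of the \<open>i\<close>-th factor.\<close>

definition fp_embed :: "('i \<Rightarrow> ('a, 'b) monoid_scheme) \<Rightarrow> 'i \<Rightarrow> 'a \<Rightarrow> ('i \<times> 'a) list" where
  "fp_embed G i a = (if a = \<one>\<^bsub>G i\<^esub> then [] else [(i, a)])"

lemma reduced_words_Nil [simp]: "[] \<in> reduced_words I G"
  by (simp add: reduced_words_def)

lemma reduced_words_Cons:
  "(i, a) # w \<in> reduced_words I G \<longleftrightarrow>
     i \<in> I \<and> a \<in> carrier (G i) \<and> a \<noteq> \<one>\<^bsub>G i\<^esub> \<and> w \<in> reduced_words I G \<and>
     (w = [] \<or> fst (hd w) \<noteq> i)"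
  by (cases w) (auto simp: reduced_words_def successively_Cons)

lemma letter_mult_closed:
  assumes "\<And>i. i \<in> I \<Longrightarrow> group (G i)"
    and "i \<in> I" "a \<in> carrier (G i)" "w \<in> reduced_words I G"
  shows "letter_mult G (i, a) w \<in> reduced_words I G"
proof -
  interpret group "G i" using assms by auto
  show ?thesis
    using assms(2-4)
    by (cases w) (auto simp: reduced_words_Cons)
qed

lemma letter_mult_one: "letter_mult G (i, \<one>\<^bsub>G i\<^esub>) w = w"
  by (cases w) auto

lemma letter_mult_reduced:
  "(i, a) # w \<in> reduced_words I G \<Longrightarrow> letter_mult G (i, a) w = (i, a) # w"
  by (cases w) (auto simp: reduced_words_Cons)

lemma letter_mult_letter_mult:
  assumes "\<And>i. i \<in> I \<Longrightarrow> group (G i)"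
    and "i \<in> I" "a \<in> carrier (G i)" "b \<in> carrier (G i)" "w \<in> reduced_words I G"
  shows "letter_mult G (i, a) (letter_mult G (i, b) w) = letter_mult G (i, a \<otimes>\<^bsub>G i\<^esub> b) w"
proof -
  interpret group "G i" using assms by auto
  show ?thesis
  proof (cases w)
    case Nil
    then show ?thesis using assms(3,4) by auto
  next
    case (Cons x w')
    obtain j c where x: "x = (j, c)" by (cases x)
    have j: "j \<in> I" "c \<in> carrier (G j)" "c \<noteq> \<one>\<^bsub>G j\<^esub>" "w' = [] \<or> fst (hd w') \<noteq> j"
      using assms(5) by (auto simp: Cons x reduced_words_Cons)
    show ?thesis
    proof (cases "j = i")
      case False
      then show ?thesis using assms(3,4) by (auto simp: Cons x)
    next
      case True
      with j have c: "c \<in> carrier (G i)" "c \<noteq> \<one>\<^bsub>G i\<^esub>" by auto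
      show ?thesis
      proof (cases "b \<otimes>\<^bsub>G i\<^esub> c = \<one>\<^bsub>G i\<^esub>")
        case bc: True
        have abc: "a \<otimes>\<^bsub>G i\<^esub> b \<otimes>\<^bsub>G i\<^esub> c = a"
          using assms(3,4) c bc by (simp add: m_assoc)
        have b: "b \<noteq> \<one>\<^bsub>G i\<^esub>" using bc c by auto
        have ab: "a \<otimes>\<^bsub>G i\<^esub> b = \<one>\<^bsub>G i\<^esub> \<Longrightarrow> a = c"
          using abc c by auto
        have w': "letter_mult G (i, a) w' = (if a = \<one>\<^bsub>G i\<^esub> then w' else (i, a) # w')"
          using j(4) True by (cases w') auto
        show ?thesis
          using b bc abc ab w' True c assms(3,4) by (auto simp: Cons x)
      next
        case False
        have "a \<otimes>\<^bsub>G i\<^esub> (b \<otimes>\<^bsub>G i\<^esub> c) = a \<otimes>\<^bsub>G i\<^esub> b \<otimes>\<^bsub>G i\<^esub> c"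
          using assms(3,4) c by (simp add: m_assoc)
        then show ?thesis
          using False True assms(3,4) c by (auto simp: Cons x)
      qed
    qed
  qed
qed

lemma foldr_letter_mult_closed:
  assumes "\<And>i. i \<in> I \<Longrightarrow> group (G i)"
    and "\<forall>(i, a) \<in> set u. i \<in> I \<and> a \<in> carrier (G i)" "v \<in> reduced_words I G"
  shows "foldr (letter_mult G) u v \<in> reduced_words I G"
  using assms(2) by (induction u) (auto intro!: letter_mult_closed assms)

lemma foldr_letter_mult_letter_mult:
  assumes grp: "\<And>i. i \<in> I \<Longrightarrow> group (G i)"
    and "i \<in> I" "a \<in> carrier (G i)" "v \<in> reduced_words I G" "w \<in> reduced_words I G"
  shows "foldr (letter_mult G) (letter_mult G (i, a) v) w =
         letter_mult G (i, a) (foldr (letter_mult G) v w)"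
proof -
  interpret group "G i" using assms by auto
  show ?thesis
  proof (cases v)
    case Nil
    then show ?thesis by (auto simp: letter_mult_one)
  next
    case (Cons x v')
    obtain j c where x: "x = (j, c)" by (cases x)
    have j: "j \<in> I" "c \<in> carrier (G j)" "v' \<in> reduced_words I G"
      using assms(4) by (auto simp: Cons x reduced_words_Cons)
    have "foldr (letter_mult G) v' w \<in> reduced_words I G"
      using j(3) assms(5) by (intro foldr_letter_mult_closed grp) (auto simp: reduced_words_def)
    then have eq: "letter_mult G (i, a) (letter_mult G (i, c) (foldr (letter_mult G) v' w)) =
        letter_mult G (i, a \<otimes>\<^bsub>G i\<^esub> c) (foldr (letter_mult G) v' w)" if "j = i"
      using j that assms(2,3) by (intro letter_mult_letter_mult[OF grp]) auto
    show ?thesis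
    proof (cases "a = \<one>\<^bsub>G i\<^esub>")
      case True
      then show ?thesis by (simp add: letter_mult_one)
    next
      case a: False
      show ?thesis
      proof (cases "j = i \<and> a \<otimes>\<^bsub>G i\<^esub> c = \<one>\<^bsub>G i\<^esub>")
        case True
        then show ?thesis using a eq by (simp add: Cons x letter_mult_one)
      next
        case False
        then show ?thesis using a eq by (cases "j = i") (auto simp: Cons x)
      qed
    qed
  qed
qed

lemma foldr_letter_mult_assoc:
  assumes grp: "\<And>i. i \<in> I \<Longrightarrow> group (G i)"
    and "\<forall>(i, a) \<in> set u. i \<in> I \<and> a \<in> carrier (G i)"
    and v: "v \<in> reduced_words I G" and w: "w \<in> reduced_words I G"
  shows "foldr (letter_mult G) (foldr (letter_mult G) u v) w =
         foldr (letter_mult G) u (foldr (letter_mult G) v w)"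
  using assms(2)
proof (induction u)
  case (Cons x u)
  obtain i a where x: "x = (i, a)" by (cases x)
  have i: "i \<in> I" "a \<in> carrier (G i)" using Cons.prems by (auto simp: x)
  have "foldr (letter_mult G) u v \<in> reduced_words I G"
    using Cons.prems v by (intro foldr_letter_mult_closed grp) auto
  from foldr_letter_mult_letter_mult[OF grp i this w]
  show ?case
    using Cons by (simp add: x)
qed simp

lemma foldr_letter_mult_inv:
  assumes grp: "\<And>i. i \<in> I \<Longrightarrow> group (G i)"
    and "\<forall>(i, a) \<in> set u. i \<in> I \<and> a \<in> carrier (G i)" and w: "w \<in> reduced_words I G"
  shows "foldr (letter_mult G) (rev (map (\<lambda>(i, a). (i, inv\<^bsub>G i\<^esub> a)) u))
           (foldr (letter_mult G) u w) = w"
  using assms(2)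
proof (induction u)
  case (Cons x u)
  obtain i a where x: "x = (i, a)" by (cases x)
  have i: "i \<in> I" "a \<in> carrier (G i)" using Cons.prems by (auto simp: x)
  interpret group "G i" using grp i by auto
  have u: "foldr (letter_mult G) u w \<in> reduced_words I G"
    using Cons.prems w by (intro foldr_letter_mult_closed grp) auto
  have "letter_mult G (i, inv\<^bsub>G i\<^esub> a) (letter_mult G (i, a) (foldr (letter_mult G) u w)) =
      foldr (letter_mult G) u w"
    using letter_mult_letter_mult[OF grp i(1) inv_closed[OF i(2)] i(2) u] i(2)
    by (simp add: letter_mult_one)
  then show ?case using Cons by (simp add: x)
qed simp

lemma foldr_letter_mult_Nil:
  "u \<in> reduced_words I G \<Longrightarrow> foldr (letter_mult G) u [] = u"
proof (induction u)
  case (Cons x u)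
  obtain i a where x: "x = (i, a)" by (cases x)
  have "u \<in> reduced_words I G"
    using Cons.prems by (simp add: x reduced_words_Cons)
  with Cons show ?case
    by (simp add: x letter_mult_reduced)
qed simp

theorem group_free_product:
  assumes grp: "\<And>i. i \<in> I \<Longrightarrow> group (G i)"
  shows "group (free_product I G)"
proof (rule groupI)
  have letters: "\<forall>(i, a) \<in> set u. i \<in> I \<and> a \<in> carrier (G i)" if "u \<in> reduced_words I G" for u
    using that by (auto simp: reduced_words_def)
  show "x \<otimes>\<^bsub>free_product I G\<^esub> y \<in> carrier (free_product I G)"
    if "x \<in> carrier (free_product I G)" "y \<in> carrier (free_product I G)" for x y
    using foldr_letter_mult_closed[OF grp letters, of x y] that by (simp add: free_product_def)
  show "x \<otimes>\<^bsub>free_product I G\<^esub> y \<otimes>\<^bsub>free_product I G\<^esub> z =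
        x \<otimes>\<^bsub>free_product I G\<^esub> (y \<otimes>\<^bsub>free_product I G\<^esub> z)"
    if "x \<in> carrier (free_product I G)" "y \<in> carrier (free_product I G)"
       "z \<in> carrier (free_product I G)" for x y z
    using foldr_letter_mult_assoc[OF grp letters, of x y z] that by (simp add: free_product_def)
  show "\<exists>y\<in>carrier (free_product I G). y \<otimes>\<^bsub>free_product I G\<^esub> x = \<one>\<^bsub>free_product I G\<^esub>"
    if "x \<in> carrier (free_product I G)" for x
  proof -
    let ?r = "rev (map (\<lambda>(i, a). (i, inv\<^bsub>G i\<^esub> a)) x)"
    let ?y = "foldr (letter_mult G) ?r []"
    have x: "x \<in> reduced_words I G" using that by (simp add: free_product_def)
    have r: "\<forall>(i, a) \<in> set ?r. i \<in> I \<and> a \<in> carrier (G i)"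
      using letters[OF x] grp by (auto intro!: group.inv_closed)
    have "foldr (letter_mult G) ?y x = foldr (letter_mult G) ?r (foldr (letter_mult G) x [])"
      using foldr_letter_mult_assoc[OF grp r, of "[]" x] foldr_letter_mult_Nil[OF x] x by simp
    also have "\<dots> = []"
      using foldr_letter_mult_inv[OF grp letters[OF x], of "[]"] by simp
    finally have "foldr (letter_mult G) ?y x = []" .
    moreover have "?y \<in> reduced_words I G"
      using foldr_letter_mult_closed[OF grp r, of "[]"] by simp
    ultimately show ?thesis by (intro bexI[of _ ?y]) (simp_all add: free_product_def)
  qed
qed (simp_all add: free_product_def)

lemma fp_embed_hom:
  assumes "i \<in> I" "group (G i)"
  shows "fp_embed G i \<in> hom (G i) (free_product I G)"
proof -
  interpret group "G i" by fact
  show ?thesis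
    using assms(1)
    by (auto simp: hom_def fp_embed_def free_product_def reduced_words_Cons)
qed


section \<open>Word length and Cayley graphs\<close>

definition finite_generating_set :: "('g, 'm) monoid_scheme \<Rightarrow> 'g set \<Rightarrow> bool" where
  "finite_generating_set G T \<longleftrightarrow> finite T \<and> T \<subseteq> carrier G \<and> generate G T = carrier G"

definition symmetric_generators :: "('g, 'm) monoid_scheme \<Rightarrow> 'g set \<Rightarrow> bool" where
  "symmetric_generators G T \<longleftrightarrow>
     T \<subseteq> carrier G \<and> (\<forall>s\<in>T. inv\<^bsub>G\<^esub> s \<in> T) \<and> generate G T = carrier G"

definition word_length :: "('g, 'm) monoid_scheme \<Rightarrow> 'g set \<Rightarrow> 'g \<Rightarrow> nat" where
  "word_length G T g =
     (LEAST n. \<exists>ws. length ws = n \<and> set ws \<subseteq> T \<union> m_inv G ` T \<and> g = foldr (mult G) ws \<one>\<^bsub>G\<^esub>)"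

definition cayley_edges :: "('g, 'm) monoid_scheme \<Rightarrow> 'g set \<Rightarrow> ('g \<times> 'g) set" where
  "cayley_edges G T = {(g, s \<otimes>\<^bsub>G\<^esub> g) | g s. g \<in> carrier G \<and> s \<in> T}"

text \<open>Graph distance in the Cayley graph, whose edges may be traversed in both directions.\<close>

definition cayley_dist :: "('g, 'm) monoid_scheme \<Rightarrow> 'g set \<Rightarrow> 'g \<Rightarrow> 'g \<Rightarrow> nat" where
  "cayley_dist G T g h = (LEAST n. (g, h) \<in> (cayley_edges G T \<union> (cayley_edges G T)\<inverse>) ^^ n)"


section \<open>The group algebra\<close>

definition supp :: "('g \<Rightarrow> complex) \<Rightarrow> 'g set" where
  "supp p = {g. p g \<noteq> 0}"

definition group_algebra :: "('g, 'm) monoid_scheme \<Rightarrow> ('g \<Rightarrow> complex) set" where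
  "group_algebra G = {p. finite (supp p) \<and> supp p \<subseteq> carrier G}"

definition galg_star :: "('g, 'm) monoid_scheme \<Rightarrow> ('g \<Rightarrow> complex) \<Rightarrow> 'g \<Rightarrow> complex" where
  "galg_star G p = (\<lambda>g. if g \<in> carrier G then cnj (p (inv\<^bsub>G\<^esub> g)) else 0)"

definition supp_diam :: "('g, 'm) monoid_scheme \<Rightarrow> 'g set \<Rightarrow> ('g \<Rightarrow> complex) \<Rightarrow> nat" where
  "supp_diam G T q = Max (insert 1 {cayley_dist G T g h | g h. g \<in> supp q \<and> h \<in> supp q})"


section \<open>Operators on square-summable functions\<close>

text \<open>Elements of \<open>\<ell>\<^sup>2(A)\<close> are functions on the whole type that vanish outside \<open>A\<close>.\<close>

definition l2 :: "'g set \<Rightarrow> ('g \<Rightarrow> complex) set" where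
  "l2 A = {f. (\<forall>x. x \<notin> A \<longrightarrow> f x = 0) \<and> (\<lambda>x. (cmod (f x))\<^sup>2) summable_on A}"

definition l2_inner :: "'g set \<Rightarrow> ('g \<Rightarrow> complex) \<Rightarrow> ('g \<Rightarrow> complex) \<Rightarrow> complex" where
  "l2_inner A f h = (\<Sum>\<^sub>\<infinity>x\<in>A. cnj (f x) * h x)"

definition l2_norm :: "'g set \<Rightarrow> ('g \<Rightarrow> complex) \<Rightarrow> real" where
  "l2_norm A f = sqrt (\<Sum>\<^sub>\<infinity>x\<in>A. (cmod (f x))\<^sup>2)"

definition delta :: "'g \<Rightarrow> 'g \<Rightarrow> complex" where
  "delta g = indicator {g}"

text \<open>
  An operator on \<open>\<ell>\<^sup>2(A)\<close> is given by a function on all of \<open>'g \<Rightarrow> complex\<close>; only its values on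
  \<^term>\<open>l2 A\<close> matter.
\<close>

type_synonym 'g l2op = "('g \<Rightarrow> complex) \<Rightarrow> ('g \<Rightarrow> complex)"

definition op_norm :: "'g set \<Rightarrow> 'g l2op \<Rightarrow> real" where
  "op_norm A Q = (SUP f\<in>{f \<in> l2 A. l2_norm A f \<le> 1}. l2_norm A (Q f))"

definition op_adjoint :: "'g set \<Rightarrow> 'g l2op \<Rightarrow> 'g l2op" where
  "op_adjoint A Q =
     (\<lambda>h. THE k. k \<in> l2 A \<and> (\<forall>f\<in>l2 A. l2_inner A (Q f) h = l2_inner A f k))"

definition op_resolvent :: "'g set \<Rightarrow> 'g l2op \<Rightarrow> complex \<Rightarrow> 'g l2op" where
  "op_resolvent A P z = inv_into (l2 A) (\<lambda>f x. P f x - z * f x)"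

definition op_Im :: "'g set \<Rightarrow> 'g l2op \<Rightarrow> 'g l2op" where
  "op_Im A Q = (\<lambda>f x. (Q f x - op_adjoint A Q f x) / (2 * \<i>))"

definition op_entry :: "'g set \<Rightarrow> 'g l2op \<Rightarrow> 'g \<Rightarrow> 'g \<Rightarrow> complex" where
  "op_entry A Q g h = l2_inner A (delta g) (Q (delta h))"

definition left_translation :: "('g, 'm) monoid_scheme \<Rightarrow> 'g \<Rightarrow> 'g l2op" where
  "left_translation G g f = (\<lambda>x. if x \<in> carrier G then f (inv\<^bsub>G\<^esub> g \<otimes>\<^bsub>G\<^esub> x) else 0)"

lemma left_translation_delta:
  assumes "group G" "g \<in> carrier G" "v \<in> carrier G"
  shows "left_translation G g (delta v) = delta (g \<otimes>\<^bsub>G\<^esub> v)"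
proof
  fix x
  interpret group G by fact
  have "inv\<^bsub>G\<^esub> g \<otimes>\<^bsub>G\<^esub> x = v \<longleftrightarrow> x = g \<otimes>\<^bsub>G\<^esub> v" if "x \<in> carrier G"
    using that assms inv_solve_left'[of v g x] by simp
  moreover have "g \<otimes>\<^bsub>G\<^esub> v \<in> carrier G"
    using assms by simp
  ultimately show "left_translation G g (delta v) x = delta (g \<otimes>\<^bsub>G\<^esub> v) x"
    by (auto simp: left_translation_def delta_def indicator_def)
qed

definition left_regular :: "('g, 'm) monoid_scheme \<Rightarrow> ('g \<Rightarrow> complex) \<Rightarrow> 'g l2op" where
  "left_regular G p f = (\<lambda>x. \<Sum>g\<in>supp p. p g * left_translation G g f x)"


section \<open>Rapid decay and the conditions (AC) and (R4)\<close>

definition rapid_decay_exponent :: "('g, 'm) monoid_scheme \<Rightarrow> real \<Rightarrow> bool" where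
  "rapid_decay_exponent G C1 \<longleftrightarrow>
     C1 > 0 \<and>
     (\<exists>C>0. \<exists>T. finite_generating_set G T \<and>
        (\<forall>q\<in>group_algebra G.
           op_norm (carrier G) (left_regular G q)
             \<le> C * real (supp_diam G T q) powr C1 * sqrt (\<Sum>g\<in>supp q. (cmod (q g))\<^sup>2)))"

text \<open>
  The diagonal entry of the self-adjoint operator \<open>\<Im> R\<close> is real; this is stated explicitly
  because \<^const>\<open>op_entry\<close> is complex-valued.
\<close>

definition condition_AC :: "('g, 'm) monoid_scheme \<Rightarrow> 'g l2op \<Rightarrow> real set \<Rightarrow> bool" where
  "condition_AC G P I0 \<longleftrightarrow>
     (\<exists>C0\<ge>1. \<forall>E\<in>I0. \<forall>\<eta>. 0 < \<eta> \<and> \<eta> \<le> 1 \<longrightarrow>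
        (let r = op_entry (carrier G)
                   (op_Im (carrier G) (op_resolvent (carrier G) P (Complex E \<eta>)))
                   \<one>\<^bsub>G\<^esub> \<one>\<^bsub>G\<^esub>
         in r \<in> \<real> \<and> inverse C0 \<le> Re r \<and> Re r \<le> C0))"

text \<open>
  Here \<open>T\<close> is the generating set defining the word length and \<open>C1\<close> the rapid decay exponent.
  Sum and supremum are taken in \<open>[0, \<infinity>]\<close>, so their finiteness for small \<open>\<eta>\<close> is part of the
  condition.
\<close>

definition condition_R4 ::
    "('g, 'm) monoid_scheme \<Rightarrow> 'g set \<Rightarrow> real \<Rightarrow> 'g l2op \<Rightarrow> real set \<Rightarrow> bool" where
  "condition_R4 G T C1 P I0 \<longleftrightarrow>
     (\<exists>C1' > 2 * C1 + 1.
        ((\<lambda>\<eta>. SUP E\<in>I0. \<Sum>\<^sub>\<infinity>g\<in>carrier G.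
            ennreal (\<eta>\<^sup>2
              * cmod (op_entry (carrier G)
                  (op_Im (carrier G) (op_resolvent (carrier G) P (Complex E \<eta>))) \<one>\<^bsub>G\<^esub> g) ^ 4
              * real (word_length G T g) powr C1'))
          \<longlongrightarrow> 0) (at_right 0))"

end

(* Write P_i for the restriction of P to the factor Gamma_i and r_i(z) = <delta_e, (P_i - z)^{-1} delta_e>,
   a finite sum of terms w / (kappa - z) over the spectrum of P_i.  If r and zeta_1, ..., zeta_m in the
   upper half plane satisfy r = r_i(zeta_i) for all i and sum zeta_i = z - (m - 1) / r, then the function
   psi(x_1 ... x_n) = r F(x_1) ... F(x_n), with F(x) = ((P_i - zeta_i)^{-1} delta_e)(x) / r on Gamma_i, solves
   (P - z) psi = delta_e.  With A_i = sum over x <> e of |F(x)|^2, the Ward identity on the finite factors gives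
   sum A_i / (1 + A_i) = 1 - Im z |r|^2 / Im r, which makes psi square summable, so that psi is the Green
   function.

   The system says that z = Z(s) for s = -r and Z(s) = sum K_i(s) - (m - 1) / s with K_i the inverse function
   of x |-> sum w / (x - kappa) above the spectrum of P_i.  When the weights of the top eigenvalues add up to
   less than m - 1, Z has a non-degenerate critical point on the positive half line (the upper edge of the
   spectrum).  Close to it Z takes a real value E at some s with Im s < 0 and Z'(s) <> 0, and inverting Z there
   extends r and the zeta_i analytically across E, with Im r > 0; this is (AC).  At E the quantities
   B_i = sum over x <> e of |F(x)|^4 satisfy sum B_i / (1 + B_i) < 1 although sum A_i / (1 + A_i) = 1, so the
   sum of |psi|^4 over words of n syllables decays exponentially in n, uniformly near E; this gives (R4) for
   every exponent. *)
theory Submission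
  imports Defs "HOL-Complex_Analysis.Complex_Analysis"
    "HOL-Computational_Algebra.Fundamental_Theorem_Algebra"
begin

section \<open>Self-adjoint kernels on finite sets\<close>

text \<open>No global subordination theorem is required: for non-real \<open>z\<close> the operator
  \<open>P - z\<close> is injective on square-summable functions, so any square-summable solution is
  the Green function, and solving the system near one real point covers an interval. The point is
  sought near a spectral edge because the equations there involve monotone real functions: an
  intermediate value argument gives a critical point, and strict Cauchy-Schwarz makes it
  non-degenerate. If the top weights are too heavy, the bottom end is used; with three factors both
  ends cannot be too heavy. Strictness for fourth powers is where number and size of the factors
  enter. For two factors of order two one has B_i = A_i^2, and A_1 A_2 = 1 at a real energy, so the
  sum of the B_i / (1 + B_i) is exactly 1. A third factor, or a factor whose resolvent takes equal
  values at two points off the unit, breaks the tie. Strictness at E persists nearby by continuity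
  and leaves room for an additional factor above 1 per syllable, which dominates every power of the
  word length.\<close>

lemma exists_linear_relation:
  fixes c :: "'k \<Rightarrow> 'x \<Rightarrow> complex"
  assumes "finite X" "finite K" "card X < card K"
  shows "\<exists>\<alpha>. (\<exists>k\<in>K. \<alpha> k \<noteq> 0) \<and> (\<forall>x\<in>X. (\<Sum>k\<in>K. \<alpha> k * c k x) = 0)"
  using assms
proof (induction X arbitrary: K c rule: finite_induct)
  case empty
  then obtain k where "k \<in> K" by fastforce
  then show ?case by (intro exI[of _ "\<lambda>_. 1"]) auto
next
  case (insert x0 X)
  show ?case
  proof (cases "\<forall>k\<in>K. c k x0 = 0")
    case True
    from insert.IH[of K c] insert.prems insert.hyps
    obtain \<alpha> where "\<exists>k\<in>K. \<alpha> k \<noteq> 0" "\<forall>x\<in>X. (\<Sum>k\<in>K. \<alpha> k * c k x) = 0" by auto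
    then show ?thesis using True by (intro exI[of _ \<alpha>]) auto
  next
    case False
    then obtain k0 where k0: "k0 \<in> K" "c k0 x0 \<noteq> 0" by auto
    \<comment> \<open>Gaussian elimination with pivot \<open>c k0 x0\<close>: all
      \<open>c' k\<close> vanish at \<open>x0\<close>, so the induction hypothesis is needed for one
      point and one vector less. The coefficient of \<open>k0\<close> is restored in
      \<open>\<beta>\<close> so that the relation also holds for the original vectors.\<close>
    define c' where "c' k x = c k x - c k x0 / c k0 x0 * c k0 x" for k x
    have "card X < card (K - {k0})" using insert.prems insert.hyps k0 by simp
    from insert.IH[of "K - {k0}" c'] this insert.prems obtain \<alpha> where
      \<alpha>: "\<exists>k\<in>K - {k0}. \<alpha> k \<noteq> 0" "\<forall>x\<in>X. (\<Sum>k\<in>K - {k0}. \<alpha> k * c' k x) = 0" by auto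
    define \<beta> where "\<beta> k = (if k = k0 then - (\<Sum>k\<in>K - {k0}. \<alpha> k * c k x0) / c k0 x0 else \<alpha> k)" for k
    have eq: "(\<Sum>k\<in>K. \<beta> k * c k x) = (\<Sum>k\<in>K - {k0}. \<alpha> k * c' k x)" for x
    proof -
      have "(\<Sum>k\<in>K. \<beta> k * c k x) = \<beta> k0 * c k0 x + (\<Sum>k\<in>K - {k0}. \<beta> k * c k x)"
        using insert.prems(1) k0(1) by (rule sum.remove)
      also have "(\<Sum>k\<in>K - {k0}. \<beta> k * c k x) = (\<Sum>k\<in>K - {k0}. \<alpha> k * c k x)"
        by (intro sum.cong) (auto simp: \<beta>_def)
      finally show ?thesis
        by (simp add: \<beta>_def c'_def algebra_simps sum_subtractf sum_distrib_left sum_divide_distrib)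
    qed
    have "(\<Sum>k\<in>K. \<beta> k * c k x) = 0" if "x \<in> insert x0 X" for x
      using that \<alpha>(2) k0(2) unfolding eq by (auto simp: c'_def)
    moreover have "\<exists>k\<in>K. \<beta> k \<noteq> 0" using \<alpha>(1) by (auto simp: \<beta>_def)
    ultimately show ?thesis by (intro exI[of _ \<beta>]) auto
  qed
qed

definition kernel_op :: "'x set \<Rightarrow> ('x \<Rightarrow> 'x \<Rightarrow> complex) \<Rightarrow> ('x \<Rightarrow> complex) \<Rightarrow> 'x \<Rightarrow> complex" where
  "kernel_op X a u x = (\<Sum>y\<in>X. a x y * u y)"

lemma kernel_op_diff: "kernel_op X a (\<lambda>x. u x - v x) x = kernel_op X a u x - kernel_op X a v x"
  by (simp add: kernel_op_def algebra_simps sum_subtractf)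

lemma kernel_op_scale: "kernel_op X a (\<lambda>x. c * u x) x = c * kernel_op X a u x"
  by (simp add: kernel_op_def sum_distrib_left mult_ac)

lemma kernel_op_sum: "kernel_op X a (\<lambda>x. \<Sum>k\<in>K. u k x) x = (\<Sum>k\<in>K. kernel_op X a (u k) x)"
  unfolding kernel_op_def by (subst sum.swap) (simp add: sum_distrib_left)

lemma kernel_op_self_adjoint:
  assumes "\<And>x y. x \<in> X \<Longrightarrow> y \<in> X \<Longrightarrow> a y x = cnj (a x y)"
  shows "(\<Sum>x\<in>X. cnj (u x) * kernel_op X a v x) = (\<Sum>x\<in>X. cnj (kernel_op X a u x) * v x)"
proof -
  have "(\<Sum>x\<in>X. cnj (u x) * kernel_op X a v x) = (\<Sum>x\<in>X. \<Sum>y\<in>X. cnj (u x) * a x y * v y)"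
    by (simp add: kernel_op_def sum_distrib_left mult_ac)
  also have "\<dots> = (\<Sum>y\<in>X. \<Sum>x\<in>X. cnj (u x) * a x y * v y)" by (rule sum.swap)
  also have "\<dots> = (\<Sum>y\<in>X. cnj (kernel_op X a u y) * v y)"
  proof (rule sum.cong[OF refl])
    fix y assume y: "y \<in> X"
    have "cnj (kernel_op X a u y) * v y = (\<Sum>x\<in>X. cnj (a y x) * cnj (u x) * v y)"
      by (simp add: kernel_op_def sum_distrib_right)
    also have "\<dots> = (\<Sum>x\<in>X. cnj (u x) * a x y * v y)"
    proof (rule sum.cong[OF refl])
      fix x assume "x \<in> X"
      then have "a x y = cnj (a y x)" using assms y by blast
      then show "cnj (a y x) * cnj (u x) * v y = cnj (u x) * a x y * v y" by simp
    qed
    finally show "(\<Sum>x\<in>X. cnj (u x) * a x y * v y) = cnj (kernel_op X a u y) * v y" ..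
  qed
  finally show ?thesis .
qed

lemma sum_cnj_mult_self: "(\<Sum>x\<in>X. cnj (u x) * u x) = of_real (\<Sum>x\<in>X. (cmod (u x))\<^sup>2)"
  by (simp only: of_real_sum complex_norm_square mult.commute)

lemma sum_cnj_mult_self_eq_0:
  assumes "finite X" "(\<Sum>x\<in>X. cnj (u x) * u x) = 0" "x \<in> X" shows "u x = 0"
proof -
  have "(\<Sum>x\<in>X. (cmod (u x))\<^sup>2) = 0"
    using assms(2) unfolding sum_cnj_mult_self by (metis of_real_eq_0_iff)
  then show ?thesis using assms by (simp add: sum_nonneg_eq_0_iff)
qed

lemma kernel_op_eigenvalue_real:
  assumes "finite X" and herm: "\<And>x y. x \<in> X \<Longrightarrow> y \<in> X \<Longrightarrow> a y x = cnj (a x y)"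
    and eig: "\<And>x. x \<in> X \<Longrightarrow> kernel_op X a u x = l * u x" and "x \<in> X" "u x \<noteq> 0"
  shows "l \<in> \<real>"
proof -
  have "l * (\<Sum>x\<in>X. cnj (u x) * u x) = (\<Sum>x\<in>X. cnj (u x) * kernel_op X a u x)"
    by (simp add: eig sum_distrib_left mult_ac)
  also have "\<dots> = (\<Sum>x\<in>X. cnj (kernel_op X a u x) * u x)" by (rule kernel_op_self_adjoint[OF herm])
  also have "\<dots> = cnj l * (\<Sum>x\<in>X. cnj (u x) * u x)"
    by (simp add: eig sum_distrib_left mult_ac)
  finally have "l * (\<Sum>x\<in>X. cnj (u x) * u x) = cnj l * (\<Sum>x\<in>X. cnj (u x) * u x)" .
  moreover have "(\<Sum>x\<in>X. cnj (u x) * u x) \<noteq> 0" using sum_cnj_mult_self_eq_0 assms by metis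
  ultimately have "l = cnj l" by simp
  then show ?thesis by (metis Reals_cnj_iff)
qed

text \<open>A self-adjoint operator T has no Jordan blocks: for w = (T - l) u with (T - l) w = 0 one
  gets (w, w) = (u, (T - l) w) = 0. This handles repeated roots of an annihilating
  polynomial.\<close>

lemma kernel_op_square_kernel:
  assumes "finite X" and herm: "\<And>x y. x \<in> X \<Longrightarrow> y \<in> X \<Longrightarrow> a y x = cnj (a x y)"
    and "l \<in> \<real>" and w: "\<And>x. x \<in> X \<Longrightarrow> w x = kernel_op X a u x - l * u x"
    and eig: "\<And>x. x \<in> X \<Longrightarrow> kernel_op X a w x = l * w x" and "x \<in> X"
  shows "w x = 0"
proof -
  have l: "cnj l = l" using assms(3) by (simp add: Reals_cnj_iff)
  have "(\<Sum>x\<in>X. cnj (w x) * w x) = (\<Sum>x\<in>X. cnj (kernel_op X a u x) * w x) - (\<Sum>x\<in>X. l * cnj (u x) * w x)"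
    unfolding sum_subtractf[symmetric] by (intro sum.cong) (simp_all add: w l algebra_simps)
  also have "(\<Sum>x\<in>X. cnj (kernel_op X a u x) * w x) = (\<Sum>x\<in>X. cnj (u x) * kernel_op X a w x)"
    by (rule kernel_op_self_adjoint[OF herm, symmetric])
  also have "\<dots> = (\<Sum>x\<in>X. l * cnj (u x) * w x)" by (simp add: eig mult_ac)
  finally show ?thesis using sum_cnj_mult_self_eq_0[OF \<open>finite X\<close> _ \<open>x \<in> X\<close>, of w] by simp
qed

definition poly_op :: "'x set \<Rightarrow> ('x \<Rightarrow> 'x \<Rightarrow> complex) \<Rightarrow> complex poly \<Rightarrow> ('x \<Rightarrow> complex) \<Rightarrow> 'x \<Rightarrow> complex" where
  "poly_op X a q u x = (\<Sum>k\<le>degree q. coeff q k * (kernel_op X a ^^ k) u x)"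

lemma poly_op_eq:
  "degree q \<le> N \<Longrightarrow> poly_op X a q u x = (\<Sum>k\<le>N. coeff q k * (kernel_op X a ^^ k) u x)"
  unfolding poly_op_def by (rule sum.mono_neutral_left) (auto simp: coeff_eq_0)

lemma kernel_op_pow_diff_scale:
  "(kernel_op X a ^^ k) (\<lambda>x. kernel_op X a u x - l * u x) x =
     (kernel_op X a ^^ Suc k) u x - l * (kernel_op X a ^^ k) u x"
proof (induction k arbitrary: x)
  case (Suc k)
  have "(kernel_op X a ^^ k) (\<lambda>x. kernel_op X a u x - l * u x) =
      (\<lambda>x. (kernel_op X a ^^ Suc k) u x - l * (kernel_op X a ^^ k) u x)"
    by (rule ext) (rule Suc.IH)
  then have "(kernel_op X a ^^ Suc k) (\<lambda>x. kernel_op X a u x - l * u x) x =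
     kernel_op X a (\<lambda>x. (kernel_op X a ^^ Suc k) u x - l * (kernel_op X a ^^ k) u x) x"
    by simp
  also have "\<dots> = kernel_op X a ((kernel_op X a ^^ Suc k) u) x - l * kernel_op X a ((kernel_op X a ^^ k) u) x"
    unfolding kernel_op_diff kernel_op_scale ..
  finally show ?case by simp
qed simp

text \<open>Peels off one root: if a polynomial with root \<open>l\<close> annihilates
  \<open>u\<close>, the cofactor annihilates (T - l) u. This drives the induction on the
  degree.\<close>

lemma poly_op_linear_factor:
  "poly_op X a ([:- l, 1:] * q) u x = poly_op X a q (\<lambda>x. kernel_op X a u x - l * u x) x"
proof -
  let ?T = "kernel_op X a"
  define N where "N = Suc (degree q)"
  have "degree ([:- l, 1:] * q) \<le> N"
    using degree_mult_le[of "[:- l, 1:]" q] by (simp add: N_def)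
  then have "poly_op X a ([:- l, 1:] * q) u x = (\<Sum>k\<le>N. coeff ([:- l, 1:] * q) k * (?T ^^ k) u x)"
    by (rule poly_op_eq)
  also have "\<dots> = (\<Sum>k\<le>N. coeff (pCons 0 q) k * (?T ^^ k) u x) - (\<Sum>k\<le>N. l * coeff q k * (?T ^^ k) u x)"
    unfolding sum_subtractf[symmetric] by (intro sum.cong) (auto simp: algebra_simps)
  also have "(\<Sum>k\<le>N. coeff (pCons 0 q) k * (?T ^^ k) u x) = (\<Sum>k\<le>degree q. coeff q k * (?T ^^ Suc k) u x)"
    unfolding N_def by (subst sum.atMost_Suc_shift) simp
  also have "(\<Sum>k\<le>N. l * coeff q k * (?T ^^ k) u x) = (\<Sum>k\<le>degree q. l * coeff q k * (?T ^^ k) u x)"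
    unfolding N_def by (subst sum.atMost_Suc) (simp add: coeff_eq_0)
  also have "(\<Sum>k\<le>degree q. coeff q k * (?T ^^ Suc k) u x) - \<dots> = 
      (\<Sum>k\<le>degree q. coeff q k * (?T ^^ k) (\<lambda>x. kernel_op X a u x - l * u x) x)"
    unfolding sum_subtractf[symmetric] kernel_op_pow_diff_scale by (intro sum.cong) (auto simp: algebra_simps)
  finally show ?thesis by (simp add: poly_op_def)
qed

text \<open>Induction on the degree. For a root \<open>l\<close>, the induction hypothesis splits (T
  - l) u into eigenvectors. The components with eigenvalue different from \<open>l\<close> are
  pulled back through T - l, and what then remains of \<open>u\<close> is an eigenvector for
  \<open>l\<close>.\<close>

lemma spectral_decomposition_of_annihilator:
  assumes "finite X" and herm: "\<And>x y. x \<in> X \<Longrightarrow> y \<in> X \<Longrightarrow> a y x = cnj (a x y)"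
    and "q \<noteq> 0" "\<And>x. x \<in> X \<Longrightarrow> poly_op X a q u x = 0"
  shows "\<exists>(\<Lambda>::real set) v. finite \<Lambda> \<and>
      (\<forall>\<kappa>\<in>\<Lambda>. \<forall>x\<in>X. kernel_op X a (v \<kappa>) x = of_real \<kappa> * v \<kappa> x) \<and> (\<forall>x\<in>X. u x = (\<Sum>\<kappa>\<in>\<Lambda>. v \<kappa> x))"
  using assms(3,4)
proof (induction "degree q" arbitrary: q u)
  case 0
  then obtain c where c: "q = [:c:]" "c \<noteq> 0" by (metis degree_eq_zeroE pCons_0_0)
  then have "u x = 0" if "x \<in> X" for x using 0(3)[OF that] by (simp add: poly_op_def)
  then show ?case by (intro exI[of _ "{}"]) auto
next
  case (Suc n)
  have "\<not> constant (poly q)" using Suc.hyps(2) by (simp add: constant_degree)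
  then obtain l where "poly q l = 0" using fundamental_theorem_of_algebra by blast
  then obtain q' where q': "q = [:- l, 1:] * q'" by (metis poly_eq_0_iff_dvd dvdE)
  have "q' \<noteq> 0" using Suc.prems(1) q' by auto
  then have "degree q = degree q' + 1" unfolding q' by (subst degree_mult_eq) auto
  then have dq: "n = degree q'" using Suc.hyps(2) by simp
  define u' where "u' x = kernel_op X a u x - l * u x" for x
  have "poly_op X a q' u' x = 0" if "x \<in> X" for x
    using Suc.prems(2)[OF that] unfolding q' poly_op_linear_factor u'_def .
  from Suc.hyps(1)[OF dq \<open>q' \<noteq> 0\<close> this] obtain \<Lambda> :: "real set" and v where fin: "finite \<Lambda>" and
    v: "\<And>\<kappa> x. \<kappa> \<in> \<Lambda> \<Longrightarrow> x \<in> X \<Longrightarrow> kernel_op X a (v \<kappa>) x = of_real \<kappa> * v \<kappa> x" and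
    u': "\<And>x. x \<in> X \<Longrightarrow> u' x = (\<Sum>\<kappa>\<in>\<Lambda>. v \<kappa> x)" by blast
  define M where "M = {\<kappa>\<in>\<Lambda>. of_real \<kappa> \<noteq> l}"
  have finM: "finite M" using fin by (simp add: M_def)
  \<comment> \<open>On an eigenvector for \<kappa> the operator T - l is multiplication by \<kappa>
    - l; dividing by it gives a preimage of the part of \<open>u'\<close> carried by
    \<open>M\<close>.\<close>
  define y where "y x = (\<Sum>\<kappa>\<in>M. 1 / (of_real \<kappa> - l) * v \<kappa> x)" for x
  define e where "e x = u x - y x" for x
  define w where "w x = (\<Sum>\<kappa>\<in>\<Lambda> - M. v \<kappa> x)" for x
  have Ty: "kernel_op X a y x - l * y x = (\<Sum>\<kappa>\<in>M. v \<kappa> x)" if "x \<in> X" for x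
  proof -
    have cancel: "1 / (of_real \<kappa> - l) * (of_real \<kappa> * c) - l * (1 / (of_real \<kappa> - l) * c) = c"
      if "of_real \<kappa> \<noteq> l" for \<kappa> and c :: complex
    proof -
      define d where "d = 1 / (of_real \<kappa> - l)"
      have "d * (of_real \<kappa> * c) - l * (d * c) = ((of_real \<kappa> - l) * d) * c"
        by (simp add: algebra_simps)
      also have "(of_real \<kappa> - l) * d = 1" using that by (simp add: d_def)
      finally show ?thesis by (simp add: d_def)
    qed
    have "kernel_op X a y x - l * y x = (\<Sum>\<kappa>\<in>M. 1 / (of_real \<kappa> - l) * (of_real \<kappa> * v \<kappa> x) - l * (1 / (of_real \<kappa> - l) * v \<kappa> x))"
      unfolding y_def kernel_op_sum kernel_op_scale sum_distrib_left sum_subtractf[symmetric]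
      using v that by (intro sum.cong) (auto simp: M_def)
    also have "\<dots> = (\<Sum>\<kappa>\<in>M. v \<kappa> x)"
      by (intro sum.cong) (simp_all add: M_def cancel del: times_divide_eq_left times_divide_eq_right)
    finally show ?thesis .
  qed
  have we: "w x = kernel_op X a e x - l * e x" if "x \<in> X" for x
  proof -
    have "kernel_op X a e x - l * e x = u' x - (\<Sum>\<kappa>\<in>M. v \<kappa> x)"
      using Ty[OF that] unfolding e_def kernel_op_diff u'_def by (simp add: algebra_simps)
    also have "\<dots> = w x"
      using that sum.subset_diff[of M \<Lambda> "\<lambda>\<kappa>. v \<kappa> x"] fin by (auto simp: u' w_def M_def)
    finally show ?thesis ..
  qed
  have eigw: "kernel_op X a w x = l * w x" if "x \<in> X" for x
    using v that unfolding w_def kernel_op_sum sum_distrib_left by (intro sum.cong) (auto simp: M_def)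
  \<comment> \<open>For real \<open>l\<close>, \<open>w\<close> lies both in the image and in the
    kernel of T - l. For non-real \<open>l\<close> no \<kappa> equals \<open>l\<close>, and
    \<open>w\<close> is an empty sum.\<close>
  have w0: "w x = 0" if "x \<in> X" for x
  proof (cases "l \<in> \<real>")
    case True
    show ?thesis by (rule kernel_op_square_kernel[OF \<open>finite X\<close> herm True we eigw that])
  next
    case False
    then have "\<Lambda> - M = {}" by (auto simp: M_def)
    then show ?thesis by (simp only: w_def sum.empty)
  qed
  have eige: "kernel_op X a e x = l * e x" if "x \<in> X" for x using we[OF that] w0[OF that] by simp
  \<comment> \<open>A non-real root contributes no eigenvalue, because \<open>e\<close> then
    vanishes on \<open>X\<close>. If \<open>l\<close> is real, \<open>Re l\<close> is new:
    \<open>M\<close> was defined to exclude it.\<close>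
  define M' where "M' = (if l \<in> \<real> then insert (Re l) M else M)"
  define v' where "v' \<kappa> x = (if of_real \<kappa> = l then e x else 1 / (of_real \<kappa> - l) * v \<kappa> x)" for \<kappa> x
  have e0: "e x = 0" if "l \<notin> \<real>" "x \<in> X" for x
    using kernel_op_eigenvalue_real[OF \<open>finite X\<close> herm eige that(2)] that(1) by blast
  have sumM: "(\<Sum>\<kappa>\<in>M. v' \<kappa> x) = y x" for x
    unfolding y_def by (intro sum.cong) (auto simp: v'_def M_def)
  have "u x = (\<Sum>\<kappa>\<in>M'. v' \<kappa> x)" if "x \<in> X" for x
  proof (cases "l \<in> \<real>")
    case True
    then have "of_real (Re l) = l" by (simp add: complex_is_Real_iff complex_eq_iff)
    then have "Re l \<notin> M" "v' (Re l) x = e x" by (auto simp: M_def v'_def)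
    then show ?thesis using True finM by (simp add: M'_def sumM e_def)
  next
    case False
    then show ?thesis using e0[OF False that] by (simp add: M'_def sumM e_def)
  qed
  moreover have "kernel_op X a (v' \<kappa>) x = of_real \<kappa> * v' \<kappa> x" if "\<kappa> \<in> M'" "x \<in> X" for \<kappa> x
  proof (cases "of_real \<kappa> = l")
    case True
    then have "v' \<kappa> = e" by (auto simp: v'_def)
    then show ?thesis using eige[OF that(2)] True by simp
  next
    case False
    then have "\<kappa> \<in> M" using that by (auto simp: M'_def split: if_splits)
    then have "kernel_op X a (v \<kappa>) x = of_real \<kappa> * v \<kappa> x" using v that by (auto simp: M_def)
    moreover have "v' \<kappa> = (\<lambda>x. 1 / (of_real \<kappa> - l) * v \<kappa> x)" using False by (auto simp: v'_def)
    ultimately show ?thesis using kernel_op_scale[of X a "1 / (of_real \<kappa> - l)" "v \<kappa>" x] by simp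
  qed
  moreover have "finite M'" using finM by (simp add: M'_def)
  ultimately show ?case by (intro exI[of _ M'] exI[of _ v']) auto
qed

text \<open>The iterates T^k u with k = 0, ..., card X are one more than the points of
  \<open>X\<close>, hence linearly dependent; the relation is an annihilating polynomial.\<close>

lemma spectral_decomposition:
  assumes "finite X" and herm: "\<And>x y. x \<in> X \<Longrightarrow> y \<in> X \<Longrightarrow> a y x = cnj (a x y)"
  shows "\<exists>(\<Lambda>::real set) v. finite \<Lambda> \<and>
      (\<forall>\<kappa>\<in>\<Lambda>. \<forall>x\<in>X. kernel_op X a (v \<kappa>) x = of_real \<kappa> * v \<kappa> x) \<and> (\<forall>x\<in>X. u x = (\<Sum>\<kappa>\<in>\<Lambda>. v \<kappa> x))"
proof -
  obtain \<alpha> where \<alpha>: "\<exists>k\<in>{..card X}. \<alpha> k \<noteq> 0"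
      "\<And>x. x \<in> X \<Longrightarrow> (\<Sum>k\<in>{..card X}. \<alpha> k * (kernel_op X a ^^ k) u x) = 0"
    using exists_linear_relation[of X "{..card X}" "\<lambda>k. (kernel_op X a ^^ k) u"] \<open>finite X\<close> by auto
  define q where "q = (\<Sum>k\<le>card X. monom (\<alpha> k) k)"
  have cq: "coeff q k = (if k \<le> card X then \<alpha> k else 0)" for k
    by (simp add: q_def coeff_sum)
  have "q \<noteq> 0" using \<alpha>(1) cq by (metis atMost_iff coeff_0)
  moreover have "degree q \<le> card X" by (rule degree_le) (simp add: cq)
  then have "poly_op X a q u x = 0" if "x \<in> X" for x
    using \<alpha>(2)[OF that] by (simp add: poly_op_eq[of q "card X"] cq)
  ultimately show ?thesis by (intro spectral_decomposition_of_annihilator[OF assms])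
qed

text \<open>The spectral components of the indicator of \<open>e\<close>; \<open>w\<close> is the
  spectral measure of the operator at \<open>e\<close>. Eigenvalues without mass are excluded, so
  \<Lambda> is the support of that measure, which may be smaller than the spectrum.\<close>

definition spectral_resolution ::
    "'x set \<Rightarrow> ('x \<Rightarrow> 'x \<Rightarrow> complex) \<Rightarrow> 'x \<Rightarrow> real set \<Rightarrow> (real \<Rightarrow> 'x \<Rightarrow> complex) \<Rightarrow> (real \<Rightarrow> real) \<Rightarrow> bool" where
  "spectral_resolution X a e \<Lambda> v w \<longleftrightarrow> finite \<Lambda> \<and>
     (\<forall>\<kappa>\<in>\<Lambda>. \<forall>x\<in>X. kernel_op X a (v \<kappa>) x = of_real \<kappa> * v \<kappa> x) \<and>
     (\<forall>x\<in>X. (\<Sum>\<kappa>\<in>\<Lambda>. v \<kappa> x) = of_bool (x = e)) \<and>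
     (\<forall>\<kappa>\<in>\<Lambda>. v \<kappa> e = of_real (w \<kappa>) \<and> 0 < w \<kappa>)"

text \<open>Eigenvectors for distinct real eigenvalues are orthogonal. Pairing a component with the
  indicator of \<open>e\<close>, which is the sum of all components, therefore gives its squared
  norm: this is why the value at \<open>e\<close> is real and non-negative.\<close>

lemma spectral_resolution_exists:
  assumes "finite X" "e \<in> X" and herm: "\<And>x y. x \<in> X \<Longrightarrow> y \<in> X \<Longrightarrow> a y x = cnj (a x y)"
  obtains \<Lambda> v w where "spectral_resolution X a e \<Lambda> v w"
proof -
  have "\<exists>(M::real set) v. finite M \<and>
      (\<forall>\<kappa>\<in>M. \<forall>x\<in>X. kernel_op X a (v \<kappa>) x = of_real \<kappa> * v \<kappa> x) \<and>
      (\<forall>x\<in>X. of_bool (x = e) = (\<Sum>\<kappa>\<in>M. v \<kappa> x))"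
    by (intro spectral_decomposition assms(1) herm)
  then obtain M :: "real set" and v where fin: "finite M" and
    v': "\<forall>\<kappa>\<in>M. \<forall>x\<in>X. kernel_op X a (v \<kappa>) x = of_real \<kappa> * v \<kappa> x" and
    u': "\<forall>x\<in>X. of_bool (x = e) = (\<Sum>\<kappa>\<in>M. v \<kappa> x)"
    by (elim exE conjE)
  note v = v'[rule_format] and u = u'[rule_format]
  have orth: "(\<Sum>x\<in>X. cnj (v \<kappa> x) * v \<mu> x) = 0" if "\<kappa> \<in> M" "\<mu> \<in> M" "\<kappa> \<noteq> \<mu>" for \<kappa> \<mu>
  proof -
    have "of_real \<mu> * (\<Sum>x\<in>X. cnj (v \<kappa> x) * v \<mu> x) = (\<Sum>x\<in>X. cnj (v \<kappa> x) * kernel_op X a (v \<mu>) x)"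
      using v that by (simp add: sum_distrib_left mult_ac)
    also have "\<dots> = (\<Sum>x\<in>X. cnj (kernel_op X a (v \<kappa>) x) * v \<mu> x)"
      by (rule kernel_op_self_adjoint[OF herm])
    also have "\<dots> = of_real \<kappa> * (\<Sum>x\<in>X. cnj (v \<kappa> x) * v \<mu> x)"
      using v that by (simp add: sum_distrib_left mult_ac)
    finally show ?thesis using that by simp
  qed
  define w where "w \<kappa> = (\<Sum>x\<in>X. (cmod (v \<kappa> x))\<^sup>2)" for \<kappa>
  have ve: "v \<mu> e = of_real (w \<mu>)" if "\<mu> \<in> M" for \<mu>
  proof -
    have "v \<mu> e = (\<Sum>x\<in>X. cnj (of_bool (x = e)) * v \<mu> x)"
      using assms(1,2) by (simp add: of_bool_def if_distrib[of cnj] if_distrib[of "\<lambda>c. c * _"] cong: if_cong)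
    also have "\<dots> = (\<Sum>x\<in>X. \<Sum>\<kappa>\<in>M. cnj (v \<kappa> x) * v \<mu> x)"
      by (intro sum.cong refl) (simp only: u cnj_sum sum_distrib_right)
    also have "\<dots> = (\<Sum>\<kappa>\<in>M. \<Sum>x\<in>X. cnj (v \<kappa> x) * v \<mu> x)" by (rule sum.swap)
    also have "\<dots> = (\<Sum>\<kappa>\<in>M. if \<kappa> = \<mu> then of_real (w \<mu>) else 0)"
      using orth that by (intro sum.cong) (auto simp: w_def sum_cnj_mult_self)
    finally show ?thesis using that fin by simp
  qed
  define L where "L = {\<kappa>\<in>M. w \<kappa> \<noteq> 0}"
  have v0: "v \<kappa> x = 0" if "\<kappa> \<in> M - L" "x \<in> X" for \<kappa> x
    using that assms(1) by (auto simp: L_def w_def sum_nonneg_eq_0_iff)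
  have "spectral_resolution X a e L v w"
    unfolding spectral_resolution_def
  proof (intro conjI ballI)
    show "finite L" using fin by (simp add: L_def)
    show "(\<Sum>\<kappa>\<in>L. v \<kappa> x) = of_bool (x = e)" if "x \<in> X" for x
      unfolding u[OF that] using fin v0 that by (intro sum.mono_neutral_left) (auto simp: L_def)
    show "0 < w \<kappa>" if "\<kappa> \<in> L" for \<kappa>
      using that by (auto simp: L_def w_def less_le intro: sum_nonneg)
  qed (use v ve in \<open>auto simp: L_def\<close>)
  then show ?thesis by (rule that)
qed

section \<open>The subordination equations near a critical point\<close>

text \<open>The demand for two atoms makes the Cauchy-Schwarz inequality below strict;
  non-degeneracy of the critical point rests on it.\<close>

definition prob_weights :: "real set \<Rightarrow> (real \<Rightarrow> real) \<Rightarrow> bool" where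
  "prob_weights \<Lambda> w \<longleftrightarrow> finite \<Lambda> \<and> 2 \<le> card \<Lambda> \<and> (\<forall>\<kappa>\<in>\<Lambda>. 0 < w \<kappa>) \<and> sum w \<Lambda> = 1"

text \<open>For \<open>n = 1\<close> this is the Cauchy transform, that is, minus the resolvent
  entry. The type is general so that the same sums serve on the real ray above the spectrum and in
  the complex plane; up to the factor -n, differentiation raises \<open>n\<close> by one.\<close>

definition res_mom :: "nat \<Rightarrow> real set \<Rightarrow> (real \<Rightarrow> real) \<Rightarrow> 'a \<Rightarrow> 'a::real_normed_field" where
  "res_mom n \<Lambda> w z = (\<Sum>\<kappa>\<in>\<Lambda>. of_real (w \<kappa>) / (z - of_real \<kappa>) ^ n)"

lemma res_mom_of_real: "res_mom n \<Lambda> w (of_real x) = of_real (res_mom n \<Lambda> w x)"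
  by (simp add: res_mom_def)

lemma has_field_derivative_res_mom:
  assumes "finite \<Lambda>" "\<And>\<kappa>. \<kappa> \<in> \<Lambda> \<Longrightarrow> z \<noteq> of_real \<kappa>"
  shows "(res_mom n \<Lambda> w has_field_derivative - of_nat n * res_mom (Suc n) \<Lambda> w z) (at z)"
proof -
  have "((\<lambda>z. of_real (w \<kappa>) / (z - of_real \<kappa>) ^ n) has_field_derivative
      - of_nat n * (of_real (w \<kappa>) / (z - of_real \<kappa>) ^ Suc n)) (at z)" if "\<kappa> \<in> \<Lambda>" for \<kappa>
  proof (cases n)
    case (Suc k)
    define d where "d = z - of_real \<kappa>"
    have d: "d \<noteq> 0" using assms(2)[OF that] by (simp add: d_def)
    have "((\<lambda>z. of_real (w \<kappa>) / (z - of_real \<kappa>) ^ Suc k) has_field_derivative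
        (0 * d ^ Suc k - of_real (w \<kappa>) * (of_nat (Suc k) * d ^ k)) / (d ^ Suc k * d ^ Suc k)) (at z)"
    proof -
      have "((\<lambda>z. z - of_real \<kappa>) has_field_derivative 1) (at z)"
        by (auto intro!: derivative_eq_intros)
      from DERIV_power[OF this, of "Suc k"]
      have "((\<lambda>z. (z - of_real \<kappa>) ^ Suc k) has_field_derivative of_nat (Suc k) * d ^ k) (at z)"
        by (simp add: d_def)
      from DERIV_divide[OF DERIV_const this] d show ?thesis by (simp add: d_def)
    qed
    also have "(0 * d ^ Suc k - of_real (w \<kappa>) * (of_nat (Suc k) * d ^ k)) / (d ^ Suc k * d ^ Suc k) =
        - of_nat n * (of_real (w \<kappa>) / d ^ Suc n)"
      using d by (simp add: Suc divide_simps) (simp add: algebra_simps)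
    finally show ?thesis by (simp add: Suc d_def)
  qed simp
  then show ?thesis unfolding res_mom_def sum_distrib_left by (intro DERIV_sum) auto
qed

section \<open>The Cauchy transform and its inverse on the real ray above the spectrum\<close>

context
  fixes \<Lambda> :: "real set" and w :: "real \<Rightarrow> real"
  assumes pw: "prob_weights \<Lambda> w"
begin

lemma prob_weightsD: "finite \<Lambda>" "\<Lambda> \<noteq> {}" "\<And>\<kappa>. \<kappa> \<in> \<Lambda> \<Longrightarrow> 0 < w \<kappa>" "sum w \<Lambda> = 1"
proof -
  show "finite \<Lambda>" "sum w \<Lambda> = 1"
    using pw unfolding prob_weights_def by blast+
  show "0 < w \<kappa>" if "\<kappa> \<in> \<Lambda>" for \<kappa>
    using pw that unfolding prob_weights_def by blast
  have "2 \<le> card \<Lambda>" using pw unfolding prob_weights_def by blast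
  then show "\<Lambda> \<noteq> {}" by (metis card.empty not_numeral_le_zero)
qed

lemma above_Max: "x > Max \<Lambda> \<Longrightarrow> \<kappa> \<in> \<Lambda> \<Longrightarrow> \<kappa> < x"
  by (rule le_less_trans[OF Max_ge[OF prob_weightsD(1)]])

lemma Max_in_support: "Max \<Lambda> \<in> \<Lambda>"
  using prob_weightsD by (intro Max_in)

lemma res_mom_pos: "x > Max \<Lambda> \<Longrightarrow> res_mom n \<Lambda> w x > (0::real)"
  unfolding res_mom_def using prob_weightsD(1-3) by (intro sum_pos) auto

lemma continuous_on_res_mom: "continuous_on {Max \<Lambda><..} (res_mom n \<Lambda> w :: real \<Rightarrow> real)"
proof (intro continuous_at_imp_continuous_on ballI)
  fix x assume "x \<in> {Max \<Lambda><..}"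
  then have "x \<noteq> of_real \<kappa>" if "\<kappa> \<in> \<Lambda>" for \<kappa>
    using above_Max[of x \<kappa>] that by auto
  then show "isCont (res_mom n \<Lambda> w) x"
    by (intro DERIV_isCont[OF has_field_derivative_res_mom] prob_weightsD)
qed

lemma res_mom_1_strict_antimono:
  assumes "Max \<Lambda> < x" "x < y" shows "res_mom 1 \<Lambda> w y < (res_mom 1 \<Lambda> w x :: real)"
  unfolding res_mom_def
proof (intro sum_strict_mono prob_weightsD)
  show "of_real (w \<kappa>) / (y - of_real \<kappa>) ^ 1 < of_real (w \<kappa>) / (x - of_real \<kappa>) ^ 1" if "\<kappa> \<in> \<Lambda>" for \<kappa>
    using above_Max[OF assms(1) that] assms(2) prob_weightsD(3)[OF that]
    by (auto intro!: divide_strict_left_mono)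
qed

text \<open>Lagrange's identity: with u = 1 / (x - \<kappa>), the defect is half of the double sum
  of the non-negative terms \<open>w \<kappa> * w \<mu> * u \<kappa> * u \<mu> * (u \<kappa> - u
  \<mu>)\<^sup>2\<close>, and two distinct atoms give a positive one.\<close>

lemma res_mom_Cauchy_Schwarz:
  assumes x: "Max \<Lambda> < x"
  shows "(res_mom 2 \<Lambda> w x)\<^sup>2 < res_mom 1 \<Lambda> w x * (res_mom 3 \<Lambda> w x :: real)"
proof -
  define u where "u \<kappa> = 1 / (x - \<kappa>)" for \<kappa>
  have upos: "u \<kappa> > 0" if "\<kappa> \<in> \<Lambda>" for \<kappa> using above_Max[OF x that] by (simp add: u_def)
  have m: "res_mom n \<Lambda> w x = (\<Sum>\<kappa>\<in>\<Lambda>. w \<kappa> * u \<kappa> ^ n)" for n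
    by (simp add: res_mom_def u_def power_one_over)
  have "0 < (\<Sum>\<kappa>\<in>\<Lambda>. \<Sum>\<mu>\<in>\<Lambda>. w \<kappa> * w \<mu> * u \<kappa> * u \<mu> * (u \<kappa> - u \<mu>)\<^sup>2)"
  proof -
    obtain \<kappa> \<mu> where k: "\<kappa> \<in> \<Lambda>" "\<mu> \<in> \<Lambda>" "\<kappa> \<noteq> \<mu>"
      using pw card_le_Suc0_iff_eq[of \<Lambda>] unfolding prob_weights_def by fastforce
    have "u \<kappa> \<noteq> u \<mu>" using k above_Max[OF x k(1)] above_Max[OF x k(2)] by (auto simp: u_def)
    then have p: "0 < w \<kappa> * w \<mu> * u \<kappa> * u \<mu> * (u \<kappa> - u \<mu>)\<^sup>2"
      using k upos prob_weightsD(3) by simp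
    have nn: "0 \<le> w \<kappa> * w \<mu> * u \<kappa> * u \<mu> * (u \<kappa> - u \<mu>)\<^sup>2" if "\<kappa> \<in> \<Lambda>" "\<mu> \<in> \<Lambda>" for \<kappa> \<mu>
      using that upos prob_weightsD(3) by (intro mult_nonneg_nonneg) (auto intro: less_imp_le)
    have "0 < (\<Sum>\<mu>\<in>\<Lambda>. w \<kappa> * w \<mu> * u \<kappa> * u \<mu> * (u \<kappa> - u \<mu>)\<^sup>2)"
      using nn[OF k(1)] p k prob_weightsD(1) by (intro sum_pos2[of _ \<mu>]) auto
    then show ?thesis
      by (rule sum_pos2[OF prob_weightsD(1) k(1)]) (intro sum_nonneg nn)
  qed
  also have "\<dots> = (\<Sum>\<kappa>\<in>\<Lambda>. \<Sum>\<mu>\<in>\<Lambda>. (w \<kappa> * u \<kappa> ^ 3) * (w \<mu> * u \<mu> ^ 1) + (w \<kappa> * u \<kappa> ^ 1) * (w \<mu> * u \<mu> ^ 3)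
       - 2 * ((w \<kappa> * u \<kappa> ^ 2) * (w \<mu> * u \<mu> ^ 2)))"
    by (intro sum.cong refl) (simp add: power2_eq_square power3_eq_cube algebra_simps)
  also have "\<dots> = 2 * (res_mom 1 \<Lambda> w x * res_mom 3 \<Lambda> w x - (res_mom 2 \<Lambda> w x)\<^sup>2)"
    unfolding m power2_eq_square[of "sum _ _"] sum_subtractf sum.distrib sum_distrib_left[symmetric]
      sum_distrib_right[symmetric]
    by (simp add: algebra_simps)
  finally show ?thesis by simp
qed

lemma res_mom_1_at_top: "((\<lambda>x. res_mom 1 \<Lambda> w x :: real) \<longlongrightarrow> 0) at_top"
proof -
  have "((\<lambda>x. \<Sum>\<kappa>\<in>\<Lambda>. w \<kappa> / (x - \<kappa>)) \<longlongrightarrow> (\<Sum>\<kappa>\<in>\<Lambda>. 0)) at_top"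
    by (intro tendsto_sum) real_asymp
  then show ?thesis by (simp add: res_mom_def)
qed

lemma scaled_res_mom_at_right_Max:
  assumes "n \<ge> 1"
  shows "((\<lambda>x. (x - Max \<Lambda>) ^ n * res_mom n \<Lambda> w x) \<longlongrightarrow> w (Max \<Lambda>)) (at_right (Max \<Lambda>))"
proof -
  have "((\<lambda>x. (x - Max \<Lambda>) ^ n * (w \<kappa> / (x - \<kappa>) ^ n)) \<longlongrightarrow> (if \<kappa> = Max \<Lambda> then w \<kappa> else 0)) (at_right (Max \<Lambda>))"
    for \<kappa>
  proof (cases "\<kappa> = Max \<Lambda>")
    case True
    have "\<forall>\<^sub>F x in at_right (Max \<Lambda>). w \<kappa> = (x - Max \<Lambda>) ^ n * (w \<kappa> / (x - \<kappa>) ^ n)"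
      unfolding eventually_at_right_field by (rule exI[of _ "Max \<Lambda> + 1"]) (auto simp: True)
    then show ?thesis using True by (intro Lim_transform_eventually[OF tendsto_const]) auto
  next
    case False
    then have "((\<lambda>x. (x - Max \<Lambda>) ^ n * (w \<kappa> / (x - \<kappa>) ^ n)) \<longlongrightarrow> (Max \<Lambda> - Max \<Lambda>) ^ n * (w \<kappa> / (Max \<Lambda> - \<kappa>) ^ n)) (at_right (Max \<Lambda>))"
      by (intro tendsto_intros) auto
    then show ?thesis using False assms by (simp add: power_0_left)
  qed
  then have "((\<lambda>x. \<Sum>\<kappa>\<in>\<Lambda>. (x - Max \<Lambda>) ^ n * (w \<kappa> / (x - \<kappa>) ^ n)) \<longlongrightarrow>
      (\<Sum>\<kappa>\<in>\<Lambda>. if \<kappa> = Max \<Lambda> then w \<kappa> else 0)) (at_right (Max \<Lambda>))"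
    by (intro tendsto_sum)
  then show ?thesis using prob_weightsD(1) Max_in_support
    by (simp add: res_mom_def sum_distrib_left)
qed

lemma scaled_res_mom_at_top: "((\<lambda>x. x ^ n * res_mom n \<Lambda> w x) \<longlongrightarrow> (1::real)) at_top"
proof -
  have "((\<lambda>x. w \<kappa> * (x / (x - \<kappa>)) ^ n) \<longlongrightarrow> w \<kappa> * 1 ^ n) at_top" for \<kappa>
    by (intro tendsto_intros) real_asymp
  then have "((\<lambda>x. \<Sum>\<kappa>\<in>\<Lambda>. w \<kappa> * (x / (x - \<kappa>)) ^ n) \<longlongrightarrow> (\<Sum>\<kappa>\<in>\<Lambda>. w \<kappa> * 1 ^ n)) at_top"
    by (intro tendsto_sum)
  then show ?thesis using prob_weightsD(4)
    by (simp add: res_mom_def sum_distrib_left power_divide mult_ac)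
qed

lemma res_mom_ratio_at_top: "((\<lambda>x. (res_mom 1 \<Lambda> w x)\<^sup>2 / res_mom 2 \<Lambda> w x) \<longlongrightarrow> (1::real)) at_top"
proof -
  have "((\<lambda>x. (x ^ 1 * res_mom 1 \<Lambda> w x)\<^sup>2 / (x\<^sup>2 * res_mom 2 \<Lambda> w x)) \<longlongrightarrow> 1\<^sup>2 / (1::real)) at_top"
    by (intro tendsto_divide tendsto_power scaled_res_mom_at_top) auto
  moreover have "\<forall>\<^sub>F x in at_top. (x ^ 1 * res_mom 1 \<Lambda> w x)\<^sup>2 / (x\<^sup>2 * res_mom 2 \<Lambda> w x) =
      (res_mom 1 \<Lambda> w x)\<^sup>2 / (res_mom 2 \<Lambda> w x :: real)"
    using eventually_gt_at_top[of 0] by eventually_elim (simp add: power_mult_distrib)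
  ultimately show ?thesis by (simp add: tendsto_cong)
qed

text \<open>Near the largest atom that atom dominates both moments, of size w / d and w / d^2 at
  distance d. Together with the limit 1 at infinity this yields the two ends of the intermediate
  value argument for the critical point.\<close>

lemma res_mom_ratio_at_right_Max:
  "((\<lambda>x. (res_mom 1 \<Lambda> w x)\<^sup>2 / res_mom 2 \<Lambda> w x) \<longlongrightarrow> w (Max \<Lambda>)) (at_right (Max \<Lambda>))"
proof -
  have w0: "w (Max \<Lambda>) \<noteq> 0" using prob_weightsD(3) Max_in_support by force
  have "((\<lambda>x. ((x - Max \<Lambda>) ^ 1 * res_mom 1 \<Lambda> w x)\<^sup>2 / ((x - Max \<Lambda>)\<^sup>2 * res_mom 2 \<Lambda> w x)) \<longlongrightarrow>
      (w (Max \<Lambda>))\<^sup>2 / w (Max \<Lambda>)) (at_right (Max \<Lambda>))"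
    using w0 by (intro tendsto_divide tendsto_power scaled_res_mom_at_right_Max) auto
  moreover have "\<forall>\<^sub>F x in at_right (Max \<Lambda>).
      ((x - Max \<Lambda>) ^ 1 * res_mom 1 \<Lambda> w x)\<^sup>2 / ((x - Max \<Lambda>)\<^sup>2 * res_mom 2 \<Lambda> w x) =
      (res_mom 1 \<Lambda> w x)\<^sup>2 / (res_mom 2 \<Lambda> w x :: real)"
    using eventually_at_right_less[of "Max \<Lambda>"] by eventually_elim (simp add: power_mult_distrib)
  ultimately show ?thesis using w0 by (simp add: tendsto_cong power2_eq_square)
qed

lemma res_mom_1_surj:
  assumes "s > 0" shows "\<exists>x>Max \<Lambda>. res_mom 1 \<Lambda> w x = (s::real)"
proof -
  have "filterlim (\<lambda>x. res_mom 1 \<Lambda> w x :: real) at_top (at_right (Max \<Lambda>))"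
  proof -
    have "filterlim (\<lambda>x. (x - Max \<Lambda>) ^ 1 * res_mom 1 \<Lambda> w x * inverse (x - Max \<Lambda>)) at_top (at_right (Max \<Lambda>))"
      using prob_weightsD(3)[OF Max_in_support]
    proof (rule filterlim_tendsto_pos_mult_at_top[OF scaled_res_mom_at_right_Max[OF order_refl]])
      show "filterlim (\<lambda>x. inverse (x - Max \<Lambda>)) at_top (at_right (Max \<Lambda>))"
        by (rule filterlim_compose[OF filterlim_inverse_at_top_right])
          (auto simp: filterlim_at intro!: tendsto_eq_intros eventually_mono[OF eventually_at_right_less])
    qed
    moreover have "\<forall>\<^sub>F x in at_right (Max \<Lambda>). (x - Max \<Lambda>) ^ 1 * res_mom 1 \<Lambda> w x * inverse (x - Max \<Lambda>) = res_mom 1 \<Lambda> w x"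
      using eventually_at_right_less[of "Max \<Lambda>"] by eventually_elim (simp add: field_simps)
    ultimately show ?thesis by (rule iffD1[OF filterlim_cong[OF refl refl], rotated])
  qed
  then have "\<forall>\<^sub>F x in at_right (Max \<Lambda>). res_mom 1 \<Lambda> w x > s \<and> x > Max \<Lambda>"
    by (simp add: filterlim_at_top_dense eventually_conj eventually_at_right_less)
  then obtain a where a: "res_mom 1 \<Lambda> w a > s" "a > Max \<Lambda>"
    using eventually_happens'[OF trivial_limit_at_right_real] by blast
  have "\<forall>\<^sub>F x in at_top. res_mom 1 \<Lambda> w x < s \<and> x > a"
    using order_tendstoD(2)[OF res_mom_1_at_top assms] by (simp add: eventually_conj eventually_gt_at_top)
  then obtain b where b: "res_mom 1 \<Lambda> w b < s" "b > a"
    using eventually_happens'[OF trivial_limit_at_top_linorder] by blast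
  have "continuous_on {a..b} (res_mom 1 \<Lambda> w :: real \<Rightarrow> real)"
    using a by (intro continuous_on_subset[OF continuous_on_res_mom]) auto
  then have "\<exists>x\<ge>a. x \<le> b \<and> res_mom 1 \<Lambda> w x = s"
    using a b by (intro IVT2') auto
  then obtain x where "x \<ge> a" "res_mom 1 \<Lambda> w x = s" by blast
  then show ?thesis using less_le_trans[OF a(2)] by blast
qed

text \<open>The function K of the overview. For positive \<open>s\<close> the choice is forced,
  since the Cauchy transform is strictly decreasing on the ray.\<close>

definition res_inv :: "real \<Rightarrow> real" where
  "res_inv s = (SOME x. x > Max \<Lambda> \<and> res_mom 1 \<Lambda> w x = s)"

lemma res_inv:
  assumes "s > 0"
  shows "res_inv s > Max \<Lambda>" "res_mom 1 \<Lambda> w (res_inv s) = s"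
  using someI_ex[OF res_mom_1_surj[OF assms]] unfolding res_inv_def by blast+

lemma res_mom_1_less_iff:
  assumes "Max \<Lambda> < x" "Max \<Lambda> < y"
  shows "res_mom 1 \<Lambda> w x < (res_mom 1 \<Lambda> w y :: real) \<longleftrightarrow> y < x"
  using res_mom_1_strict_antimono[OF assms(1), of y] res_mom_1_strict_antimono[OF assms(2), of x]
  by (metis less_asym less_irrefl linorder_less_linear)

lemma res_inv_unique:
  assumes "x > Max \<Lambda>" shows "res_inv (res_mom 1 \<Lambda> w x) = x"
proof -
  note r = res_inv[OF res_mom_pos[OF assms, of 1]]
  show ?thesis
    using res_mom_1_less_iff[OF r(1) assms] res_mom_1_less_iff[OF assms r(1)] r(2) by linarith
qed

lemma res_inv_less_iff:
  assumes "s > 0" "x > Max \<Lambda>" shows "res_inv s < x \<longleftrightarrow> res_mom 1 \<Lambda> w x < s"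
  using res_mom_1_less_iff[OF assms(2) res_inv(1)[OF assms(1)]] res_inv(2)[OF assms(1)] by simp

lemma continuous_on_res_inv: "continuous_on {0<..} res_inv"
proof -
  \<comment> \<open>Negation makes the decreasing inverse monotone increasing, and a monotone
    function with open image is continuous.\<close>
  have "continuous_on {0<..} (\<lambda>s. - res_inv s)"
  proof (rule continuous_onI_mono)
    have "(\<lambda>s. - res_inv s) ` {0<..} = {..<- Max \<Lambda>}"
    proof (intro equalityI subsetI)
      fix y assume "y \<in> {..<- Max \<Lambda>}"
      then have "Max \<Lambda> < - y" by (simp only: lessThan_iff less_minus_iff)
      then have "y = - res_inv (res_mom 1 \<Lambda> w (- y))" "res_mom 1 \<Lambda> w (- y) \<in> {0<..}"
        by (simp_all only: res_inv_unique res_mom_pos greaterThan_iff minus_minus)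
      then show "y \<in> (\<lambda>s. - res_inv s) ` {0<..}" by (rule image_eqI)
    next
      fix y assume "y \<in> (\<lambda>s. - res_inv s) ` {0<..}"
      then obtain s where "s > 0" "y = - res_inv s" by auto
      then show "y \<in> {..<- Max \<Lambda>}" using res_inv(1)[of s] by (simp only: lessThan_iff neg_less_iff_less)
    qed
    then show "open ((\<lambda>s. - res_inv s) ` {0<..})" by simp
  next
    fix x y :: real assume "x \<in> {0<..}" "y \<in> {0<..}" "x \<le> y"
    then have pos: "0 < x" "0 < y" and le: "x \<le> y" by auto
    show "- res_inv x \<le> - res_inv y"
      using res_inv_less_iff[OF pos(1) res_inv(1)[OF pos(2)]] res_inv(2)[OF pos(2)] le by linarith
  qed
  from continuous_on_minus[OF this] show ?thesis by simp
qed

text \<open>In other words, \<open>res_inv s\<close> tends to \<open>Max \<Lambda>\<close> from the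
  right as s grows; the counterpart below says that it tends to infinity as s decreases to
  0.\<close>

lemma eventually_res_inv_at_top:
  assumes "eventually P (at_right (Max \<Lambda>))"
  shows "\<forall>\<^sub>F s in at_top. P (res_inv s)"
proof -
  obtain b where b: "b > Max \<Lambda>" "\<And>y. y > Max \<Lambda> \<Longrightarrow> y < b \<Longrightarrow> P y"
    using assms unfolding eventually_at_right_field by blast
  show ?thesis
    using eventually_gt_at_top[of "res_mom 1 \<Lambda> w b"] eventually_gt_at_top[of 0]
  proof eventually_elim
    case (elim s)
    then show ?case using b(2)[of "res_inv s"] res_inv(1)[of s] res_inv_less_iff[OF _ b(1), of s] by blast
  qed
qed

lemma eventually_res_inv_at_0:
  assumes "eventually P at_top"
  shows "\<forall>\<^sub>F s in at_right 0. P (res_inv s)"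
proof -
  obtain b0 where b0: "\<And>y. y \<ge> b0 \<Longrightarrow> P y" using assms unfolding eventually_at_top_linorder by blast
  define b where "b = max b0 (Max \<Lambda> + 1)"
  have "res_mom 1 \<Lambda> w b > (0::real)" by (rule res_mom_pos) (simp add: b_def)
  then have "\<forall>\<^sub>F s in at_right 0. s < res_mom 1 \<Lambda> w b"
    by (auto simp: eventually_at_right_field)
  then show ?thesis using eventually_at_right_less[of 0]
  proof eventually_elim
    case (elim s)
    have "Max \<Lambda> < b" by (simp add: b_def)
    then have "\<not> res_inv s < b" using res_inv_less_iff[of s b] elim by linarith
    then have "res_inv s \<ge> b0" by (simp add: b_def)
    then show ?case by (rule b0)
  qed
qed

end

text \<open>The last equation is Z'(s) = 0, because K_i' = -1 / \<open>res_mom 2\<close> at K_i. Its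
  left side tends to \<open>card I\<close> as s decreases to 0 and to the sum of the top weights as
  s grows; the hypothesis places \<open>card I - 1\<close> strictly between these limits.\<close>

lemma critical_point_exists:
  fixes \<Lambda> :: "'i \<Rightarrow> real set" and w :: "'i \<Rightarrow> real \<Rightarrow> real"
  assumes fin: "finite I" and pw: "\<And>i. i \<in> I \<Longrightarrow> prob_weights (\<Lambda> i) (w i)"
    and lt: "(\<Sum>i\<in>I. w i (Max (\<Lambda> i))) < real (card I) - 1"
  obtains s x where "s > 0" "\<And>i. i \<in> I \<Longrightarrow> x i > Max (\<Lambda> i)"
    "\<And>i. i \<in> I \<Longrightarrow> res_mom 1 (\<Lambda> i) (w i) (x i) = s"
    "(\<Sum>i\<in>I. s\<^sup>2 / res_mom 2 (\<Lambda> i) (w i) (x i)) = real (card I) - 1"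
proof -
  define h where "h i y = (res_mom 1 (\<Lambda> i) (w i) y)\<^sup>2 / res_mom 2 (\<Lambda> i) (w i) y" for i and y :: real
  define K where "K i = res_inv (\<Lambda> i) (w i)" for i
  define H where "H s = (\<Sum>i\<in>I. h i (K i s))" for s
  have K: "K i s > Max (\<Lambda> i)" "res_mom 1 (\<Lambda> i) (w i) (K i s) = s" if "i \<in> I" "s > 0" for i s
    using res_inv[OF pw] that by (auto simp: K_def)
  \<comment> \<open>The gap in the hypothesis divided by more than the number of factors, so that
    all errors together stay below the gap.\<close>
  define d where "d = (real (card I) - 1 - (\<Sum>i\<in>I. w i (Max (\<Lambda> i)))) / (card I + 1)"
  have d: "d > 0" using lt by (auto simp: d_def)
  have "\<forall>\<^sub>F s in at_top. \<forall>i\<in>I. h i (K i s) < w i (Max (\<Lambda> i)) + d"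
    using fin
  proof (rule eventually_ball_finite, intro ballI)
    fix i assume i: "i \<in> I"
    have "\<forall>\<^sub>F y in at_right (Max (\<Lambda> i)). h i y < w i (Max (\<Lambda> i)) + d"
      unfolding h_def by (rule order_tendstoD(2)[OF res_mom_ratio_at_right_Max[OF pw[OF i]]]) (use d in simp)
    then show "\<forall>\<^sub>F s in at_top. h i (K i s) < w i (Max (\<Lambda> i)) + d"
      unfolding K_def by (rule eventually_res_inv_at_top[OF pw[OF i]])
  qed
  then have 1: "\<forall>\<^sub>F s in at_top. H s < real (card I) - 1"
  proof eventually_elim
    case (elim s)
    have "H s \<le> (\<Sum>i\<in>I. w i (Max (\<Lambda> i)) + d)" unfolding H_def using elim by (intro sum_mono) (auto intro: less_imp_le)
    also have "\<dots> = (\<Sum>i\<in>I. w i (Max (\<Lambda> i))) + card I * d" by (simp add: sum.distrib)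
    also have "card I * d < (card I + 1) * d" using d by simp
    also have "\<dots> = real (card I) - 1 - (\<Sum>i\<in>I. w i (Max (\<Lambda> i)))" by (simp add: d_def)
    finally show ?case by simp
  qed
  \<comment> \<open>Smaller than 1 / \<open>card I\<close>, so that all errors together stay below
    1.\<close>
  define e where "e = 1 / (real (card I) + 1)"
  have "\<forall>\<^sub>F s in at_right 0. \<forall>i\<in>I. h i (K i s) > 1 - e"
    using fin
  proof (rule eventually_ball_finite, intro ballI)
    fix i assume i: "i \<in> I"
    have "\<forall>\<^sub>F y in at_top. h i y > 1 - e"
      unfolding h_def by (rule order_tendstoD(1)[OF res_mom_ratio_at_top[OF pw[OF i]]]) (simp add: e_def)
    then show "\<forall>\<^sub>F s in at_right 0. h i (K i s) > 1 - e"
      unfolding K_def by (rule eventually_res_inv_at_0[OF pw[OF i]])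
  qed
  then have 2: "\<forall>\<^sub>F s in at_right 0. H s > real (card I) - 1"
  proof eventually_elim
    case (elim s)
    have "real (card I) - 1 < (\<Sum>i\<in>I. 1 - e)" by (simp add: e_def field_simps)
    also have "\<dots> \<le> H s" unfolding H_def using elim by (intro sum_mono) (auto intro: less_imp_le)
    finally show ?case .
  qed
  obtain s1 where s1: "s1 > 0" "H s1 > real (card I) - 1"
    using eventually_happens'[OF trivial_limit_at_right_real eventually_conj[OF 2 eventually_at_right_less]] by blast
  obtain s2 where s2: "s2 > s1" "H s2 < real (card I) - 1"
    using eventually_happens'[OF trivial_limit_at_top_linorder eventually_conj[OF 1 eventually_gt_at_top[of s1]]] by blast
  have "continuous_on {s1..s2} (\<lambda>s. h i (K i s))" if i: "i \<in> I" for i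
  proof -
    have cK: "continuous_on {s1..s2} (K i)"
      unfolding K_def using s1 by (intro continuous_on_subset[OF continuous_on_res_inv[OF pw[OF i]]]) auto
    have "continuous_on {s1..s2} (\<lambda>s. res_mom n (\<Lambda> i) (w i) (K i s))" for n
      by (rule continuous_on_compose2[OF continuous_on_res_mom[OF pw[OF i]] cK]) (use K[OF i] s1 in auto)
    moreover have "res_mom 2 (\<Lambda> i) (w i) (K i s) \<noteq> 0" if "s \<in> {s1..s2}" for s
      using res_mom_pos[OF pw[OF i] K(1)[OF i], of s 2] s1 that by (simp only: atLeastAtMost_iff) linarith
    ultimately show ?thesis unfolding h_def by (intro continuous_intros) blast+
  qed
  then have "continuous_on {s1..s2} H" unfolding H_def by (intro continuous_on_sum)
  then have "\<exists>s\<ge>s1. s \<le> s2 \<and> H s = real (card I) - 1" using s1 s2 by (intro IVT2') auto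
  then obtain s where s: "s \<ge> s1" "H s = real (card I) - 1" by blast
  show ?thesis
  proof (rule that[of s "\<lambda>i. K i s"])
    show "(\<Sum>i\<in>I. s\<^sup>2 / res_mom 2 (\<Lambda> i) (w i) (K i s)) = real (card I) - 1"
      unfolding s(2)[symmetric] H_def h_def using K(2) s s1 by (intro sum.cong) auto
  qed (use s s1 K in auto)
qed

section \<open>Complex extension and solution of the system near a real energy\<close>

lemma has_field_derivative_res_mom_right:
  fixes z :: complex
  assumes "prob_weights \<Lambda> w" "Max \<Lambda> < Re z"
  shows "(res_mom n \<Lambda> w has_field_derivative - of_nat n * res_mom (Suc n) \<Lambda> w z) (at z)"
proof (rule has_field_derivative_res_mom)
  show "z \<noteq> of_real \<kappa>" if "\<kappa> \<in> \<Lambda>" for \<kappa>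
    using above_Max[OF assms that] by auto
qed (rule prob_weightsD(1)[OF assms(1)])

lemma Im_res_mom_1: "Im (res_mom 1 \<Lambda> w z) = - Im z * (\<Sum>\<kappa>\<in>\<Lambda>. w \<kappa> / (cmod (z - of_real \<kappa>))\<^sup>2)"
  by (simp add: res_mom_def Im_divide sum_distrib_left cmod_power2 sum_negf[symmetric] mult_ac)

text \<open>The Cauchy transform of a positive measure reverses the sign of the imaginary part.
  Hence positivity of Im r forces all zeta_i into the upper half plane, even when \<open>z\<close>
  is real.\<close>

lemma Im_pos_of_Im_res_mom_1_neg:
  assumes "prob_weights \<Lambda> w" "Im (res_mom 1 \<Lambda> w z) < 0" shows "Im z > 0"
proof (rule ccontr)
  assume "\<not> Im z > 0"
  moreover have "(\<Sum>\<kappa>\<in>\<Lambda>. w \<kappa> / (cmod (z - of_real \<kappa>))\<^sup>2) \<ge> 0"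
    by (intro sum_nonneg divide_nonneg_nonneg zero_le_power2 less_imp_le prob_weightsD(3)[OF assms(1)])
  ultimately have "- Im z * (\<Sum>\<kappa>\<in>\<Lambda>. w \<kappa> / (cmod (z - of_real \<kappa>))\<^sup>2) \<ge> 0"
    by (intro mult_nonneg_nonneg) auto
  then show False using assms(2) unfolding Im_res_mom_1 by linarith
qed

text \<open>The derivative of the Cauchy transform is minus \<open>res_mom 2\<close>, which does not
  vanish on the real ray, so \<open>res_inv\<close> extends holomorphically. Staying right of
  \<open>Max \<Lambda>\<close> keeps the poles away.\<close>

lemma res_mom_local_inverse:
  assumes pw: "prob_weights \<Lambda> w" and x: "Max \<Lambda> < x" and s: "res_mom 1 \<Lambda> w x = s"
  obtains U k where "open U" "of_real s \<in> U" "k (of_real s) = of_real x"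
    "\<And>u. u \<in> U \<Longrightarrow> Max \<Lambda> < Re (k u)" "\<And>u. u \<in> U \<Longrightarrow> res_mom 1 \<Lambda> w (k u) = u"
    "\<And>u. u \<in> U \<Longrightarrow> res_mom 2 \<Lambda> w (k u) \<noteq> 0"
    "\<And>u. u \<in> U \<Longrightarrow> (k has_field_derivative - 1 / res_mom 2 \<Lambda> w (k u)) (at u)"
proof -
  define S where "S = {z. Max \<Lambda> < Re z}"
  define f :: "complex \<Rightarrow> complex" where "f = res_mom 1 \<Lambda> w"
  have S: "open S" unfolding S_def by (rule open_halfspace_Re_gt)
  have der: "(f has_field_derivative - res_mom 2 \<Lambda> w z) (at z)" if "z \<in> S" for z
    using has_field_derivative_res_mom_right[OF pw, of z 1] that by (simp add: f_def S_def numeral_2_eq_2)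
  then have holf: "f holomorphic_on S" using S by (auto simp: holomorphic_on_open)
  have dz: "deriv f z = - res_mom 2 \<Lambda> w z" if "z \<in> S" for z using der[OF that] by (rule DERIV_imp_deriv)
  have xS: "of_real x \<in> S" using x by (simp add: S_def del: Max_less_iff)
  have "deriv f (of_real x) \<noteq> 0"
    using res_mom_pos[OF pw x, of 2] unfolding dz[OF xS] res_mom_of_real by simp
  with has_complex_derivative_locally_invertible[OF holf xS S] obtain r where
    r: "r > 0" "ball (of_real x) r \<subseteq> S" "open (f ` ball (of_real x) r)" "inj_on f (ball (of_real x) r)"
    by blast
  obtain k where k: "k holomorphic_on f ` ball (of_real x) r"
      "\<And>z. z \<in> ball (of_real x) r \<Longrightarrow> deriv f z * deriv k (f z) = 1"
      "\<And>z. z \<in> ball (of_real x) r \<Longrightarrow> k (f z) = z"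
    using holomorphic_has_inverse[OF holomorphic_on_subset[OF holf r(2)] open_ball r(4)] by blast
  have fx: "f (of_real x) = of_real s" unfolding f_def res_mom_of_real s ..
  have xb: "of_real x \<in> ball (of_real x :: complex) r" using r(1) by simp
  have *: "Max \<Lambda> < Re (k u) \<and> res_mom 1 \<Lambda> w (k u) = u \<and> res_mom 2 \<Lambda> w (k u) \<noteq> 0 \<and>
      (k has_field_derivative - 1 / res_mom 2 \<Lambda> w (k u)) (at u)" if u: "u \<in> f ` ball (of_real x) r" for u
  proof -
    obtain z where z: "z \<in> ball (of_real x) r" "u = f z" using u by blast
    have kz: "k u = z" using k(3)[OF z(1)] z(2) by simp
    have zS: "z \<in> S" using z(1) r(2) by blast
    \<comment> \<open>The chain rule for the inverse shows more than the derivative of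
      \<open>k\<close>: \<open>res_mom 2\<close> has no zero on the whole neighbourhood.\<close>
    have e: "- res_mom 2 \<Lambda> w z * deriv k u = 1" using k(2)[OF z(1)] unfolding dz[OF zS] z(2) .
    then have n0: "res_mom 2 \<Lambda> w z \<noteq> 0" by auto
    then have "deriv k u = - 1 / res_mom 2 \<Lambda> w z" using e by (simp add: field_simps) (metis minus_minus)
    moreover have "(k has_field_derivative deriv k u) (at u)"
      using holomorphic_derivI[OF k(1) r(3) u] .
    ultimately show ?thesis using kz n0 zS z(2) unfolding S_def f_def by simp
  qed
  show ?thesis
  proof (rule that[of "f ` ball (of_real x) r" k])
    show "of_real s \<in> f ` ball (of_real x) r" using fx xb by (metis image_eqI)
    show "k (of_real s) = of_real x" using k(3)[OF xb] fx by simp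
  qed (use r * in blast)+
qed

text \<open>A holomorphic function with a non-degenerate critical point on the real line, real on the
  real line, folds the lower half disc onto a slit disc and hence takes real values off the real
  line; the sign change of the imaginary part happens on a horizontal segment just below the
  critical point.\<close>

lemma real_value_near_critical_point:
  fixes Z :: "complex \<Rightarrow> complex"
  assumes U: "open U" "of_real c \<in> U" and hol: "Z holomorphic_on U"
    and real: "\<And>t. of_real t \<in> U \<Longrightarrow> Z (of_real t) \<in> \<real>"
    and d1: "deriv Z (of_real c) = 0" and d2: "deriv (deriv Z) (of_real c) \<noteq> 0"
  obtains s where "s \<in> U" "Im s < 0" "Z s \<in> \<real>" "deriv Z s \<noteq> 0"
proof -
  define \<xi> where "\<xi> = complex_of_real c"
  have \<xi>U: "\<xi> \<in> U" using U by (simp add: \<xi>_def)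
  have A: "(deriv ^^ 2) Z \<xi> \<noteq> 0" using d2 by (simp add: \<xi>_def numeral_2_eq_2)
  have B: "(deriv ^^ i) Z \<xi> = 0" if "0 < i" "i < 2" for i
  proof -
    have "i = 1" using that by simp
    then show ?thesis using d1 by (simp add: \<xi>_def)
  qed
  obtain g r where g: "0 < r" "g holomorphic_on ball \<xi> r"
      "\<And>w. w \<in> ball \<xi> r \<Longrightarrow> Z w - Z \<xi> = (w - \<xi>) ^ 2 * g w" "\<And>w. w \<in> ball \<xi> r \<Longrightarrow> g w \<noteq> 0"
    by (rule holomorphic_factor_order_of_zero[OF hol U(1) \<xi>U pos2 A B]; blast intro: that)
  have contg: "isCont g \<xi>"
    by (rule continuous_on_interior[OF holomorphic_on_imp_continuous_on[OF g(2)]]) (use g(1) in simp)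
  obtain r' where r': "0 < r'" "ball \<xi> r' \<subseteq> U" using U(1) \<xi>U openE by blast
  have "(deriv Z has_field_derivative deriv (deriv Z) \<xi>) (at \<xi>)"
    using holomorphic_derivI[OF holomorphic_deriv[OF hol U(1)] U(1) \<xi>U] .
  then have "((\<lambda>y. (deriv Z y - deriv Z \<xi>) / (y - \<xi>)) \<longlongrightarrow> deriv (deriv Z) \<xi>) (at \<xi>)"
    by (simp add: has_field_derivative_iff)
  then have "\<forall>\<^sub>F y in at \<xi>. (deriv Z y - deriv Z \<xi>) / (y - \<xi>) \<noteq> 0"
    using d2 unfolding \<xi>_def by (rule tendsto_imp_eventually_ne)
  then have "\<forall>\<^sub>F y in at \<xi>. deriv Z y \<noteq> 0"
    by eventually_elim (use d1 in \<open>auto simp: \<xi>_def\<close>)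
  then obtain r'' where r'': "r'' > 0" "\<And>y. y \<noteq> \<xi> \<Longrightarrow> dist y \<xi> < r'' \<Longrightarrow> deriv Z y \<noteq> 0"
    unfolding eventually_at by blast
  define \<rho> where "\<rho> = min r (min r' r'')"
  have \<rho>: "\<rho> > 0" using g r' r'' by (simp add: \<rho>_def)
  \<comment> \<open>On the real line \<open>g\<close> is a quotient of real numbers away from the
    critical point; its value there is a limit of these.\<close>
  have greal: "g \<xi> \<in> \<real>"
  proof -
    define t where "t n = \<rho> / (real n + 2)" for n
    have t: "0 < t n" "t n < \<rho>" for n using \<rho> by (auto simp: t_def field_simps intro!: add_pos_nonneg)
    have "t \<longlonglongrightarrow> 0" unfolding t_def by real_asymp
    then have "(\<lambda>n. \<xi> + of_real (t n)) \<longlonglongrightarrow> \<xi> + of_real 0" by (intro tendsto_intros)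
    then have lim: "(\<lambda>n. g (\<xi> + of_real (t n))) \<longlonglongrightarrow> g \<xi>"
      using isCont_tendsto_compose[OF contg] by simp
    have "g (\<xi> + of_real (t n)) \<in> \<real>" for n
    proof -
      have b: "\<xi> + of_real (t n) \<in> ball \<xi> r" "\<xi> + of_real (t n) \<in> U"
        using t[of n] r' by (auto simp: \<rho>_def dist_norm)
      have "Z (of_real (c + t n)) \<in> \<real>" "Z \<xi> \<in> \<real>"
        using b(2) \<xi>U real[of "c + t n"] real[of c] by (simp_all add: \<xi>_def)
      moreover have "g (\<xi> + of_real (t n)) = (Z (of_real (c + t n)) - Z \<xi>) / of_real ((t n)\<^sup>2)"
        using g(3)[OF b(1)] t[of n] by (simp add: \<xi>_def field_simps)
      ultimately show ?thesis by (auto intro!: Reals_divide Reals_diff)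
    qed
    then show ?thesis using lim closed_complex_Reals by (meson closed_sequentially)
  qed
  then obtain \<gamma> where \<gamma>: "g \<xi> = of_real \<gamma>" by (elim Reals_cases)
  have \<gamma>0: "\<gamma> \<noteq> 0" using g(1,4) \<gamma> by force
  \<comment> \<open>A horizontal segment at depth \<epsilon> below the critical point, parametrised
    by \<open>t\<close> on the scale \<epsilon>.\<close>
  define p where "p \<epsilon> t = \<xi> + of_real \<epsilon> * (of_real t - \<i>)" for \<epsilon> t :: real
  have lim: "((\<lambda>\<epsilon>. Im ((of_real t - \<i>)\<^sup>2 * g (p \<epsilon> t))) \<longlongrightarrow> - 2 * t * \<gamma>) (at_right 0)" for t
  proof -
    have "((\<lambda>\<epsilon>. p \<epsilon> t) \<longlongrightarrow> \<xi> + of_real 0 * (of_real t - \<i>)) (at_right 0)"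
      unfolding p_def by (intro tendsto_intros)
    then have "((\<lambda>\<epsilon>. g (p \<epsilon> t)) \<longlongrightarrow> g \<xi>) (at_right 0)"
      using isCont_tendsto_compose[OF contg] by simp
    then have "((\<lambda>\<epsilon>. Im ((of_real t - \<i>)\<^sup>2 * g (p \<epsilon> t))) \<longlongrightarrow> Im ((of_real t - \<i>)\<^sup>2 * g \<xi>)) (at_right 0)"
      by (intro tendsto_intros)
    moreover have "Im ((of_real t - \<i>)\<^sup>2 * g \<xi>) = - 2 * t * \<gamma>"
      by (simp add: \<gamma> power2_eq_square)
    ultimately show ?thesis by simp
  qed
  \<comment> \<open>To leading order the imaginary part is that of (t - i)^2 \<gamma>, namely -2 t
    \<gamma>. Multiplying by \<open>\<gamma>\<close> and by \<open>t\<close> treats both signs of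
    \<gamma> and both ends of the segment at once.\<close>
  have ev: "\<forall>\<^sub>F \<epsilon> in at_right 0. \<gamma> * Im ((of_real t - \<i>)\<^sup>2 * g (p \<epsilon> t)) * t < 0" if "t \<noteq> 0" for t
  proof -
    have lim': "((\<lambda>\<epsilon>. \<gamma> * Im ((of_real t - \<i>)\<^sup>2 * g (p \<epsilon> t)) * t) \<longlongrightarrow> \<gamma> * (- 2 * t * \<gamma>) * t) (at_right 0)"
      by (intro tendsto_intros lim)
    have "\<gamma> * (- 2 * t * \<gamma>) * t = - 2 * (t * \<gamma>)\<^sup>2" by (simp add: power2_eq_square)
    moreover have "(t * \<gamma>)\<^sup>2 > 0" using that \<gamma>0 by simp
    ultimately have "\<gamma> * (- 2 * t * \<gamma>) * t < 0" by linarith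
    then show ?thesis by (rule order_tendstoD(2)[OF lim'])
  qed
  have "\<forall>\<^sub>F \<epsilon> in at_right 0. \<epsilon> < \<rho> / 2" using \<rho> by (intro eventually_at_rightI[of 0 "\<rho> / 2"]) auto
  from eventually_happens'[OF trivial_limit_at_right_real
      eventually_conj[OF eventually_conj[OF ev[of 1] ev[of "-1"]] eventually_conj[OF this eventually_at_right_less[of 0]]]]
  obtain \<epsilon> where \<epsilon>: "0 < \<epsilon>" "\<epsilon> < \<rho> / 2" "\<gamma> * Im ((of_real 1 - \<i>)\<^sup>2 * g (p \<epsilon> 1)) < 0"
      "\<gamma> * Im ((of_real (-1) - \<i>)\<^sup>2 * g (p \<epsilon> (-1))) > 0"
    by auto
  \<comment> \<open>The modulus of t - i is at most 2, which is why \<epsilon> was taken below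
    \<rho> / 2. The segment avoids the critical point since it lies strictly below it.\<close>
  have pd: "p \<epsilon> t \<noteq> \<xi>" "dist (p \<epsilon> t) \<xi> < \<rho>" if "t \<in> {-1..1}" for t
  proof -
    have "cmod (of_real t - \<i>) \<le> 2"
    proof -
      have "\<bar>t\<bar> \<le> 1" using that by auto
      then show ?thesis using norm_triangle_ineq4[of "of_real t" \<i>] by simp
    qed
    then have "\<epsilon> * cmod (of_real t - \<i>) \<le> \<epsilon> * 2" using \<epsilon> by (intro mult_left_mono) auto
    then have "\<epsilon> * cmod (of_real t - \<i>) < \<rho>" using \<epsilon>(2) by linarith
    then show "dist (p \<epsilon> t) \<xi> < \<rho>" using \<epsilon>(1) by (simp add: p_def dist_norm norm_mult)
    show "p \<epsilon> t \<noteq> \<xi>" using \<epsilon>(1) by (simp add: p_def complex_eq_iff)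
  qed
  have ZE: "Im (Z (p \<epsilon> t)) = \<epsilon>\<^sup>2 * Im ((of_real t - \<i>)\<^sup>2 * g (p \<epsilon> t))" if "t \<in> {-1..1}" for t
  proof -
    have b: "p \<epsilon> t \<in> ball \<xi> r" using pd[OF that] by (simp add: \<rho>_def dist_commute)
    have "Z (p \<epsilon> t) = Z \<xi> + of_real (\<epsilon>\<^sup>2) * ((of_real t - \<i>)\<^sup>2 * g (p \<epsilon> t))"
    proof -
      have "p \<epsilon> t - \<xi> = of_real \<epsilon> * (of_real t - \<i>)" by (simp add: p_def)
      then have "Z (p \<epsilon> t) - Z \<xi> = of_real (\<epsilon>\<^sup>2) * (of_real t - \<i>)\<^sup>2 * g (p \<epsilon> t)"
        using g(3)[OF b] by (simp add: power_mult_distrib)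
      then show ?thesis by (simp add: algebra_simps)
    qed
    moreover have "Im (Z \<xi>) = 0" using real[of c] \<xi>U by (simp add: \<xi>_def complex_is_Real_iff)
    moreover have "Im (of_real a * y) = a * Im y" for a y by simp
    ultimately show ?thesis by (simp only: plus_complex.sel add_0)
  qed
  have pU: "p \<epsilon> t \<in> U" if "t \<in> {-1..1}" for t
    using pd(2)[OF that] r'(2) by (auto simp: \<rho>_def dist_commute)
  have "continuous_on {-1..1} (\<lambda>t. Z (p \<epsilon> t))"
  proof (rule continuous_on_compose2[OF holomorphic_on_imp_continuous_on[OF hol]])
    show "continuous_on {-1..1} (p \<epsilon>)" unfolding p_def by (intro continuous_intros)
  qed (use pU in auto)
  then have "continuous_on {-1..1} (\<lambda>t. - \<gamma> * Im (Z (p \<epsilon> t)))" by (intro continuous_intros)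
  moreover have "- \<gamma> * Im (Z (p \<epsilon> (-1))) \<le> 0"
  proof -
    have "0 \<le> \<epsilon>\<^sup>2 * (\<gamma> * Im ((of_real (-1) - \<i>)\<^sup>2 * g (p \<epsilon> (-1))))"
      by (intro mult_nonneg_nonneg[OF zero_le_power2] less_imp_le[OF \<epsilon>(4)])
    then show ?thesis using ZE[of "-1"] by (simp add: mult.left_commute)
  qed
  moreover have "0 \<le> - \<gamma> * Im (Z (p \<epsilon> 1))"
  proof -
    have "0 \<le> \<epsilon>\<^sup>2 * (- (\<gamma> * Im ((of_real 1 - \<i>)\<^sup>2 * g (p \<epsilon> 1))))"
      using \<epsilon>(3) by (intro mult_nonneg_nonneg zero_le_power2) linarith
    then show ?thesis using ZE[of 1] by (simp add: mult.left_commute)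
  qed
  ultimately have "\<exists>t\<ge>-1. t \<le> 1 \<and> - \<gamma> * Im (Z (p \<epsilon> t)) = 0" by (intro IVT') auto
  then obtain t where t: "t \<in> {-1..1}" "Im (Z (p \<epsilon> t)) = 0" using \<gamma>0 by auto
  show ?thesis
  proof (rule that)
    show "p \<epsilon> t \<in> U" by (rule pU[OF t(1)])
    show "Im (p \<epsilon> t) < 0" using \<epsilon>(1) by (simp add: p_def \<xi>_def)
    show "Z (p \<epsilon> t) \<in> \<real>" using t(2) by (simp add: complex_is_Real_iff)
    show "deriv Z (p \<epsilon> t) \<noteq> 0" using r''(2)[OF pd(1)[OF t(1)]] pd(2)[OF t(1)] by (simp add: \<rho>_def)
  qed
qed

text \<open>The parameter is s = \<sigma> = -r, hence the negative imaginary part. Near a point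
  \<open>s\<close> below the real axis with Z(s) = E real and Z'(s) non-zero, \<sigma> inverts Z,
  and the zeta_i are the K_i composed with \<sigma>.\<close>

lemma local_subordination_aux:
  fixes \<Lambda> :: "'i \<Rightarrow> real set" and w :: "'i \<Rightarrow> real \<Rightarrow> real"
  assumes fin: "finite I" and pw: "\<And>i. i \<in> I \<Longrightarrow> prob_weights (\<Lambda> i) (w i)"
    and lt: "(\<Sum>i\<in>I. w i (Max (\<Lambda> i))) < real (card I) - 1"
  obtains E :: real and W \<sigma> \<zeta> where "open W" "of_real E \<in> W" "continuous_on W \<sigma>"
    "\<And>i. i \<in> I \<Longrightarrow> continuous_on W (\<zeta> i)" "Im (\<sigma> (of_real E)) < 0"
    "\<And>z i. z \<in> W \<Longrightarrow> i \<in> I \<Longrightarrow> res_mom 1 (\<Lambda> i) (w i) (\<zeta> i z) = \<sigma> z"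
    "\<And>z. z \<in> W \<Longrightarrow> (\<Sum>i\<in>I. \<zeta> i z) = z + (of_nat (card I) - 1) / \<sigma> z"
proof -
  obtain c x where c: "c > 0" "\<And>i. i \<in> I \<Longrightarrow> x i > Max (\<Lambda> i)"
    "\<And>i. i \<in> I \<Longrightarrow> res_mom 1 (\<Lambda> i) (w i) (x i) = c"
    "(\<Sum>i\<in>I. c\<^sup>2 / res_mom 2 (\<Lambda> i) (w i) (x i)) = real (card I) - 1"
    by (rule critical_point_exists[OF fin pw lt]; blast intro: that)
  have "I \<noteq> {}"
  proof
    assume "I = {}"
    then show False using lt by simp
  qed
  define Q where "Q i V k \<longleftrightarrow> open V \<and> complex_of_real c \<in> V \<and> k (of_real c) = of_real (x i) \<and>
      (\<forall>u\<in>V. Max (\<Lambda> i) < Re (k u) \<and> res_mom 1 (\<Lambda> i) (w i) (k u) = u \<and> res_mom 2 (\<Lambda> i) (w i) (k u) \<noteq> 0 \<and>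
        (k has_field_derivative - 1 / res_mom 2 (\<Lambda> i) (w i) (k u)) (at u))" for i V and k :: "complex \<Rightarrow> complex"
  have "\<exists>V k. Q i V k" if "i \<in> I" for i
    unfolding Q_def by (rule res_mom_local_inverse[OF pw[OF that] c(2)[OF that] c(3)[OF that]]) blast
  then obtain V k where Q: "\<And>i. i \<in> I \<Longrightarrow> Q i (V i) (k i)" by metis
  \<comment> \<open>Zero is removed because Z contains the term (m - 1) / s.\<close>
  define U where "U = (\<Inter>i\<in>I. V i) \<inter> - {0}"
  have oU: "open U" unfolding U_def using fin Q by (intro open_Int open_INT) (auto simp: Q_def)
  have cU: "of_real c \<in> U" using Q c(1) by (auto simp: U_def Q_def)
  have k: "Max (\<Lambda> i) < Re (k i u)" "res_mom 1 (\<Lambda> i) (w i) (k i u) = u" "res_mom 2 (\<Lambda> i) (w i) (k i u) \<noteq> 0"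
     "(k i has_field_derivative - 1 / res_mom 2 (\<Lambda> i) (w i) (k i u)) (at u)" if "i \<in> I" "u \<in> U" for i u
  proof -
    have "u \<in> V i" using that by (simp add: U_def)
    then show "Max (\<Lambda> i) < Re (k i u)" "res_mom 1 (\<Lambda> i) (w i) (k i u) = u" "res_mom 2 (\<Lambda> i) (w i) (k i u) \<noteq> 0"
      "(k i has_field_derivative - 1 / res_mom 2 (\<Lambda> i) (w i) (k i u)) (at u)"
      using Q[OF that(1)] unfolding Q_def by blast+
  qed
  have kc: "k i (of_real c) = of_real (x i)" if "i \<in> I" for i using Q[OF that] by (simp add: Q_def)
  have U0: "u \<noteq> 0" if "u \<in> U" for u using that by (simp add: U_def)
  define M where "M = real (card I) - 1"
  define Z where "Z u = (\<Sum>i\<in>I. k i u) - of_real M / u" for u :: complex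
  define Z1 where "Z1 u = (\<Sum>i\<in>I. - 1 / res_mom 2 (\<Lambda> i) (w i) (k i u)) + of_real M / u\<^sup>2" for u :: complex
  define Z2 where "Z2 u = (\<Sum>i\<in>I. 2 * res_mom 3 (\<Lambda> i) (w i) (k i u) / res_mom 2 (\<Lambda> i) (w i) (k i u) ^ 3) - 2 * of_real M / u ^ 3"
    for u :: complex
  have DZ: "(Z has_field_derivative Z1 u) (at u)" if u: "u \<in> U" for u
  proof -
    have "((\<lambda>u. of_real M / u) has_field_derivative - (of_real M / u\<^sup>2)) (at u)"
      using U0[OF u] by (auto intro!: derivative_eq_intros simp: power2_eq_square)
    moreover have "((\<lambda>u. \<Sum>i\<in>I. k i u) has_field_derivative
        (\<Sum>i\<in>I. - 1 / res_mom 2 (\<Lambda> i) (w i) (k i u))) (at u)"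
      by (intro DERIV_sum k(4) u)
    ultimately have "(Z has_field_derivative (\<Sum>i\<in>I. - 1 / res_mom 2 (\<Lambda> i) (w i) (k i u)) - - (of_real M / u\<^sup>2)) (at u)"
      unfolding Z_def by (rule DERIV_diff[rotated])
    then show ?thesis by (simp add: Z1_def)
  qed
  have DZ1: "(Z1 has_field_derivative Z2 u) (at u)" if u: "u \<in> U" for u
  proof -
    have "((\<lambda>u. of_real M / u\<^sup>2) has_field_derivative - (2 * of_real M / u ^ 3)) (at u)"
      using U0[OF u] by (auto intro!: derivative_eq_intros simp: power2_eq_square power3_eq_cube mult_ac)
    moreover have "((\<lambda>u. - 1 / res_mom 2 (\<Lambda> i) (w i) (k i u)) has_field_derivative
        2 * res_mom 3 (\<Lambda> i) (w i) (k i u) / res_mom 2 (\<Lambda> i) (w i) (k i u) ^ 3) (at u)" if i: "i \<in> I" for i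
    proof -
      let ?m2 = "res_mom 2 (\<Lambda> i) (w i) (k i u)" and ?m3 = "res_mom 3 (\<Lambda> i) (w i) (k i u)"
      have "(res_mom 2 (\<Lambda> i) (w i) has_field_derivative - 2 * ?m3) (at (k i u))"
        using has_field_derivative_res_mom_right[OF pw[OF i] k(1)[OF i u], of 2]
        by (simp add: numeral_3_eq_3 numeral_2_eq_2)
      from DERIV_chain2[OF this k(4)[OF i u]]
      have "((\<lambda>u. res_mom 2 (\<Lambda> i) (w i) (k i u)) has_field_derivative - 2 * ?m3 * (- 1 / ?m2)) (at u)" .
      from DERIV_divide[OF DERIV_const[of "-1"] this k(3)[OF i u]]
      show ?thesis using k(3)[OF i u] by (simp add: power3_eq_cube mult.assoc)
    qed
    then have "((\<lambda>u. \<Sum>i\<in>I. - 1 / res_mom 2 (\<Lambda> i) (w i) (k i u)) has_field_derivative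
        (\<Sum>i\<in>I. 2 * res_mom 3 (\<Lambda> i) (w i) (k i u) / res_mom 2 (\<Lambda> i) (w i) (k i u) ^ 3)) (at u)"
      by (intro DERIV_sum)
    ultimately have "(Z1 has_field_derivative (\<Sum>i\<in>I. 2 * res_mom 3 (\<Lambda> i) (w i) (k i u) /
        res_mom 2 (\<Lambda> i) (w i) (k i u) ^ 3) + - (2 * of_real M / u ^ 3)) (at u)"
      unfolding Z1_def by (rule DERIV_add[rotated])
    then show ?thesis by (simp add: Z2_def)
  qed
  have holZ: "Z holomorphic_on U" using oU DZ by (auto simp: holomorphic_on_open)
  have dZ: "deriv Z u = Z1 u" if "u \<in> U" for u using DZ[OF that] by (rule DERIV_imp_deriv)
  have ddZ: "deriv (deriv Z) (of_real c) = Z2 (of_real c)"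
  proof -
    have "(deriv Z has_field_derivative Z2 (of_real c)) (at (of_real c))"
      by (rule has_field_derivative_transform_within_open[OF DZ1[OF cU] oU cU]) (simp add: dZ)
    then show ?thesis by (rule DERIV_imp_deriv)
  qed
  have "Z1 (of_real c) = of_real ((\<Sum>i\<in>I. - 1 / res_mom 2 (\<Lambda> i) (w i) (x i)) + M / c\<^sup>2)"
    unfolding Z1_def by (simp add: kc res_mom_of_real)
  \<comment> \<open>The critical equation divided by c^2. It gives Z'(c) = 0, and it is used again
    to distribute the last term of Z''(c) over the factors.\<close>
  also have M: "M / c\<^sup>2 = (\<Sum>i\<in>I. 1 / res_mom 2 (\<Lambda> i) (w i) (x i))"
    unfolding M_def c(4)[symmetric] sum_divide_distrib using c(1) by simp
  finally have d1: "deriv Z (of_real c) = 0"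
    unfolding dZ[OF cU] by (simp add: sum_negf)
  have "Z2 (of_real c) = of_real ((\<Sum>i\<in>I. 2 * res_mom 3 (\<Lambda> i) (w i) (x i) / res_mom 2 (\<Lambda> i) (w i) (x i) ^ 3) - 2 / c * (M / c\<^sup>2))"
    unfolding Z2_def by (simp add: kc res_mom_of_real power2_eq_square power3_eq_cube)
  also have "(\<Sum>i\<in>I. 2 * res_mom 3 (\<Lambda> i) (w i) (x i) / res_mom 2 (\<Lambda> i) (w i) (x i) ^ 3) - 2 / c * (M / c\<^sup>2) =
      (\<Sum>i\<in>I. 2 * res_mom 3 (\<Lambda> i) (w i) (x i) / res_mom 2 (\<Lambda> i) (w i) (x i) ^ 3
        - 2 / c * (1 / res_mom 2 (\<Lambda> i) (w i) (x i)))"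
    unfolding M sum_distrib_left sum_subtractf ..
  finally have Z2: "Z2 (of_real c) = of_real \<dots>" .
  have "(\<Sum>i\<in>I. 2 * res_mom 3 (\<Lambda> i) (w i) (x i) / res_mom 2 (\<Lambda> i) (w i) (x i) ^ 3
        - 2 / c * (1 / res_mom 2 (\<Lambda> i) (w i) (x i))) > 0"
  proof (rule sum_pos[OF fin \<open>I \<noteq> {}\<close>])
    fix i assume i: "i \<in> I"
    \<comment> \<open>With \<open>a\<close>, \<open>b\<close> the second and third moments and
      \<open>c\<close> the first one, the summand is a positive multiple of the Cauchy-Schwarz
      defect.\<close>
    have alg: "2 * b / a ^ 3 - 2 / c * (1 / a) = 2 * (c * b - a\<^sup>2) / (c * a ^ 3)" if "a > 0" for a b :: real
      using that c(1) by (simp add: field_simps power2_eq_square power3_eq_cube)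
    have pos: "res_mom 2 (\<Lambda> i) (w i) (x i) > 0" by (rule res_mom_pos[OF pw[OF i] c(2)[OF i]])
    show "2 * res_mom 3 (\<Lambda> i) (w i) (x i) / res_mom 2 (\<Lambda> i) (w i) (x i) ^ 3
        - 2 / c * (1 / res_mom 2 (\<Lambda> i) (w i) (x i)) > 0"
      using res_mom_Cauchy_Schwarz[OF pw[OF i] c(2)[OF i]] c(1) pos
      unfolding c(3)[OF i] alg[OF pos]
      by (intro divide_pos_pos mult_pos_pos zero_less_power) linarith+
  qed
  then have d2: "deriv (deriv Z) (of_real c) \<noteq> 0"
    unfolding ddZ Z2 of_real_eq_0_iff by (rule less_imp_neq[THEN not_sym])
  \<comment> \<open>To the right of all atoms the imaginary part of the Cauchy transform is a
    negative multiple of that of its argument, so a real value forces a real argument.\<close>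
  have real: "Z (of_real t) \<in> \<real>" if t: "of_real t \<in> U" for t
  proof -
    have "k i (of_real t) \<in> \<real>" if i: "i \<in> I" for i
    proof -
      define z where "z = k i (of_real t)"
      have "Im z * (\<Sum>\<kappa>\<in>\<Lambda> i. w i \<kappa> / (cmod (z - of_real \<kappa>))\<^sup>2) = 0"
        using Im_res_mom_1[of "\<Lambda> i" "w i" z] k(2)[OF i t] by (simp add: z_def)
      moreover have "(\<Sum>\<kappa>\<in>\<Lambda> i. w i \<kappa> / (cmod (z - of_real \<kappa>))\<^sup>2) > 0"
      proof (intro sum_pos prob_weightsD[OF pw[OF i]] divide_pos_pos)
        fix \<kappa> assume "\<kappa> \<in> \<Lambda> i"
        then have "\<kappa> < Re z" unfolding z_def by (rule above_Max[OF pw[OF i] k(1)[OF i t]])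
        then show "0 < (cmod (z - of_real \<kappa>))\<^sup>2" by auto
      qed
      ultimately show ?thesis by (simp add: z_def complex_is_Real_iff)
    qed
    then show ?thesis unfolding Z_def by (intro Reals_diff sum_in_Reals Reals_divide) auto
  qed
  obtain s where s: "s \<in> U" "Im s < 0" "Z s \<in> \<real>" "deriv Z s \<noteq> 0"
    by (rule real_value_near_critical_point[OF oU cU holZ real d1 d2])
  obtain \<rho> where \<rho>: "\<rho> > 0" "ball s \<rho> \<subseteq> U" "open (Z ` ball s \<rho>)" "inj_on Z (ball s \<rho>)"
    by (rule has_complex_derivative_locally_invertible[OF holZ s(1) oU s(4)])
  obtain \<sigma> where \<sigma>: "\<sigma> holomorphic_on Z ` ball s \<rho>" "\<And>u. u \<in> ball s \<rho> \<Longrightarrow> \<sigma> (Z u) = u"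
    by (rule holomorphic_has_inverse[OF holomorphic_on_subset[OF holZ \<rho>(2)] open_ball \<rho>(4)]; blast intro: that)
  obtain E where E: "Z s = of_real E" using s(3) by (elim Reals_cases)
  have sb: "s \<in> ball s \<rho>" using \<rho>(1) by simp
  have \<sigma>W: "\<sigma> z \<in> U" "Z (\<sigma> z) = z" if "z \<in> Z ` ball s \<rho>" for z
    using that \<sigma>(2) \<rho>(2) by auto
  show ?thesis
  proof (rule that[of "Z ` ball s \<rho>" E \<sigma> "\<lambda>i z. k i (\<sigma> z)"])
    show "open (Z ` ball s \<rho>)" by (rule \<rho>(3))
    show "of_real E \<in> Z ` ball s \<rho>" using E sb by (metis image_eqI)
    show c\<sigma>: "continuous_on (Z ` ball s \<rho>) \<sigma>" using \<sigma>(1) by (rule holomorphic_on_imp_continuous_on)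
    show "continuous_on (Z ` ball s \<rho>) (\<lambda>z. k i (\<sigma> z))" if i: "i \<in> I" for i
    proof (rule continuous_on_compose2[OF _ c\<sigma>])
      show "continuous_on U (k i)"
        using DERIV_isCont[OF k(4)[OF i]] by (simp add: continuous_at_imp_continuous_on)
    qed (use \<sigma>W in auto)
    show "Im (\<sigma> (of_real E)) < 0" using s(2) \<sigma>(2)[OF sb] E by simp
    show "res_mom 1 (\<Lambda> i) (w i) (k i (\<sigma> z)) = \<sigma> z" if "z \<in> Z ` ball s \<rho>" "i \<in> I" for z i
      by (rule k(2)[OF that(2) \<sigma>W(1)[OF that(1)]])
    show "(\<Sum>i\<in>I. k i (\<sigma> z)) = z + (of_nat (card I) - 1) / \<sigma> z" if "z \<in> Z ` ball s \<rho>" for z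
      using \<sigma>W(2)[OF that] unfolding Z_def M_def by (simp add: algebra_simps)
  qed
qed

text \<open>If the condition fails at the top of the spectra it is imposed at the bottom; the reflection
  \<open>z \<mapsto> - cnj z\<close> exchanges the two ends.\<close>

lemma local_subordination:
  fixes \<Lambda> :: "'i \<Rightarrow> real set" and w :: "'i \<Rightarrow> real \<Rightarrow> real"
  assumes fin: "finite I" and pw: "\<And>i. i \<in> I \<Longrightarrow> prob_weights (\<Lambda> i) (w i)"
    and lt: "(\<Sum>i\<in>I. w i (Max (\<Lambda> i))) < real (card I) - 1 \<or> (\<Sum>i\<in>I. w i (Min (\<Lambda> i))) < real (card I) - 1"
  obtains E :: real and W r \<zeta> where "open W" "of_real E \<in> W" "continuous_on W r"
    "\<And>i. i \<in> I \<Longrightarrow> continuous_on W (\<zeta> i)" "Im (r (of_real E)) > 0"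
    "\<And>z i. z \<in> W \<Longrightarrow> i \<in> I \<Longrightarrow> r z = (\<Sum>\<kappa>\<in>\<Lambda> i. of_real (w i \<kappa>) / (of_real \<kappa> - \<zeta> i z))"
    "\<And>z. z \<in> W \<Longrightarrow> (\<Sum>i\<in>I. \<zeta> i z) = z - (of_nat (card I) - 1) / r z"
  using lt
proof
  assume lt: "(\<Sum>i\<in>I. w i (Max (\<Lambda> i))) < real (card I) - 1"
  obtain E :: real and W \<sigma> \<zeta> where *: "open W" "of_real E \<in> W" "continuous_on W \<sigma>"
    "\<And>i. i \<in> I \<Longrightarrow> continuous_on W (\<zeta> i)" "Im (\<sigma> (of_real E)) < 0"
    "\<And>z i. z \<in> W \<Longrightarrow> i \<in> I \<Longrightarrow> res_mom 1 (\<Lambda> i) (w i) (\<zeta> i z) = \<sigma> z"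
    "\<And>z. z \<in> W \<Longrightarrow> (\<Sum>i\<in>I. \<zeta> i z) = z + (of_nat (card I) - 1) / \<sigma> z"
    by (rule local_subordination_aux[OF fin pw lt]; blast intro: that)
  show ?thesis
  proof (rule that[of W E "\<lambda>z. - \<sigma> z" \<zeta>])
    show "- \<sigma> z = (\<Sum>\<kappa>\<in>\<Lambda> i. of_real (w i \<kappa>) / (of_real \<kappa> - \<zeta> i z))" if "z \<in> W" "i \<in> I" for z i
      unfolding *(6)[OF that, symmetric] res_mom_def sum_negf[symmetric]
      by (intro sum.cong refl) (simp add: minus_divide_right)
  qed (use * in \<open>auto intro: continuous_on_minus\<close>)
next
  assume lt: "(\<Sum>i\<in>I. w i (Min (\<Lambda> i))) < real (card I) - 1"
  \<comment> \<open>Negating the spectra turns the bottom weights into top weights.\<close>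
  define \<Lambda>' where "\<Lambda>' i = uminus ` \<Lambda> i" for i
  define w' where "w' i \<kappa> = w i (- \<kappa>)" for i \<kappa>
  have pw': "prob_weights (\<Lambda>' i) (w' i)" if "i \<in> I" for i
    using pw[OF that] by (auto simp: prob_weights_def \<Lambda>'_def w'_def card_image sum.reindex)
  have "w' i (Max (\<Lambda>' i)) = w i (Min (\<Lambda> i))" if "i \<in> I" for i
    unfolding \<Lambda>'_def w'_def minus_Min_eq_Max[OF prob_weightsD(1,2)[OF pw[OF that]], symmetric] by simp
  then have lt': "(\<Sum>i\<in>I. w' i (Max (\<Lambda>' i))) < real (card I) - 1" using lt by simp
  obtain E :: real and W \<sigma> \<zeta> where *: "open W" "of_real E \<in> W" "continuous_on W \<sigma>"
    "\<And>i. i \<in> I \<Longrightarrow> continuous_on W (\<zeta> i)" "Im (\<sigma> (of_real E)) < 0"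
    "\<And>z i. z \<in> W \<Longrightarrow> i \<in> I \<Longrightarrow> res_mom 1 (\<Lambda>' i) (w' i) (\<zeta> i z) = \<sigma> z"
    "\<And>z. z \<in> W \<Longrightarrow> (\<Sum>i\<in>I. \<zeta> i z) = z + (of_nat (card I) - 1) / \<sigma> z"
    by (rule local_subordination_aux[OF fin pw' lt']; blast intro: that)
  \<comment> \<open>Reflection in the imaginary axis: it keeps the upper half plane, and its
    conjugation compensates the missing minus sign in r = \<open>cnj (\<sigma> (f z))\<close>, so
    that Im r is still positive.\<close>
  define f where "f z = - cnj z" for z
  have ff: "f (f z) = z" for z by (simp add: f_def)
  have cf: "continuous_on S f" for S unfolding f_def by (intro continuous_intros)
  define W' where "W' = f -` W"
  have W': "f z \<in> W" if "z \<in> W'" for z using that by (simp add: W'_def)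
  show ?thesis
  proof (rule that[of W' "- E" "\<lambda>z. cnj (\<sigma> (f z))" "\<lambda>i z. f (\<zeta> i (f z))"])
    show "open W'" unfolding W'_def using *(1) cf by (simp add: open_vimage)
    show "of_real (- E) \<in> W'" using *(2) by (simp add: W'_def f_def)
    show "continuous_on W' (\<lambda>z. cnj (\<sigma> (f z)))"
      by (intro continuous_on_cnj continuous_on_compose2[OF *(3) cf]) (auto simp: W'_def)
    show "continuous_on W' (\<lambda>z. f (\<zeta> i (f z)))" if "i \<in> I" for i
      unfolding f_def[of "\<zeta> _ _"]
      by (intro continuous_on_minus continuous_on_cnj continuous_on_compose2[OF *(4)[OF that] cf]) (auto simp: W'_def)
    show "Im (cnj (\<sigma> (f (of_real (- E))))) > 0" using *(5) by (simp add: f_def)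
    show "cnj (\<sigma> (f z)) = (\<Sum>\<kappa>\<in>\<Lambda> i. of_real (w i \<kappa>) / (of_real \<kappa> - f (\<zeta> i (f z))))"
      if "z \<in> W'" "i \<in> I" for z i
    proof -
      have "cnj (\<sigma> (f z)) = (\<Sum>\<kappa>\<in>\<Lambda>' i. of_real (w' i \<kappa>) / (cnj (\<zeta> i (f z)) - of_real \<kappa>))"
        unfolding *(6)[OF W'[OF that(1)] that(2), symmetric] res_mom_def by simp
      also have "\<dots> = (\<Sum>\<kappa>\<in>\<Lambda> i. of_real (w i \<kappa>) / (cnj (\<zeta> i (f z)) + of_real \<kappa>))"
        unfolding \<Lambda>'_def by (subst sum.reindex) (auto simp: w'_def)
      finally show ?thesis by (simp add: f_def[of "\<zeta> _ _"] add.commute)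
    qed
    show "(\<Sum>i\<in>I. f (\<zeta> i (f z))) = z - (of_nat (card I) - 1) / cnj (\<sigma> (f z))" if "z \<in> W'" for z
    proof -
      have "(\<Sum>i\<in>I. f (\<zeta> i (f z))) = f (\<Sum>i\<in>I. \<zeta> i (f z))" by (simp add: f_def sum_negf)
      also have "\<dots> = z - (of_nat (card I) - 1) / cnj (\<sigma> (f z))"
        unfolding *(7)[OF W'[OF that]] by (simp add: f_def)
      finally show ?thesis .
    qed
  qed
qed

section \<open>Strict contraction of the fourth-power sums\<close>

text \<open>With a = A / (1 + A), the ratio A^2 / (1 + A^2) equals a g(a), where g increases on
  [0, 1/2] and g(1/2) = 1. If every a_i is below 1/2 the claim is immediate. Otherwise, for one a_j
  at least 1/2, the identity a g(a) + (1 - a) g(1 - a) = 1 reduces the claim to the remaining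
  indices, whose sum is at most 1 - a_j.\<close>

lemma sum_square_ratio_less_one:
  fixes A B :: "'i \<Rightarrow> real"
  assumes fin: "finite I" and card: "3 \<le> card I"
    and A: "\<And>i. i \<in> I \<Longrightarrow> 0 < A i" and B: "\<And>i. i \<in> I \<Longrightarrow> 0 \<le> B i \<and> B i \<le> (A i)\<^sup>2"
    and le: "(\<Sum>i\<in>I. A i / (1 + A i)) \<le> 1"
  shows "(\<Sum>i\<in>I. B i / (1 + B i)) < 1"
proof -
  define a where "a i = A i / (1 + A i)" for i
  define g where "g t = t / (1 - 2 * t + 2 * t\<^sup>2)" for t :: real
  have den: "1 - 2 * t + 2 * t\<^sup>2 > 0" for t :: real
  proof -
    have "1 - 2 * t + 2 * t\<^sup>2 = (1 - t)\<^sup>2 + t\<^sup>2" by (simp add: power2_eq_square algebra_simps)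
    moreover have "(1 - t)\<^sup>2 + t\<^sup>2 > 0" by (cases "t = 0") (auto intro: add_nonneg_pos)
    ultimately show ?thesis by simp
  qed
  have g_mono: "g s < g t" if "0 \<le> s" "s < t" "t \<le> 1 / 2" for s t
  proof -
    have "s * t \<le> (1/2) * (1/2)" using that by (intro mult_mono) auto
    then have "(t - s) * (1 - 2 * (s * t)) > 0" using that by (intro mult_pos_pos) auto
    then show ?thesis unfolding g_def using den[of s] den[of t]
      by (simp add: divide_simps power2_eq_square algebra_simps)
  qed
  have g_refl: "t * g t = 1 - (1 - t) * g (1 - t)" for t
  proof -
    have "1 - 2 * (1 - t) + 2 * (1 - t)\<^sup>2 = 1 - 2 * t + 2 * t\<^sup>2"
      by (simp add: power2_eq_square algebra_simps)
    then show ?thesis unfolding g_def using den[of t]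
      by (simp add: divide_simps) (simp add: power2_eq_square algebra_simps)
  qed
  have a: "0 < a i" "a i < 1" if "i \<in> I" for i
    using A[OF that] by (auto simp: a_def)
  have le_g: "B i / (1 + B i) \<le> a i * g (a i)" if "i \<in> I" for i
  proof -
    have "B i / (1 + B i) \<le> (A i)\<^sup>2 / (1 + (A i)\<^sup>2)"
      using B[OF that] by (simp add: divide_simps add_nonneg_eq_0_iff) (auto simp: algebra_simps)
    also have "\<dots> = a i * g (a i)"
    proof -
      have e: "A i = a i / (1 - a i)" using A[OF that] by (simp add: a_def field_simps)
      have "1 - a i \<noteq> 0" using a[OF that] by simp
      then show ?thesis using den[of "a i"] unfolding e g_def
        by (simp add: divide_simps add_nonneg_eq_0_iff) (simp add: power2_eq_square algebra_simps)
    qed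
    finally show ?thesis .
  qed
  have le': "(\<Sum>i\<in>I. a i) \<le> 1" using le by (simp add: a_def)
  have ne: "I \<noteq> {}" using card by auto
  have "(\<Sum>i\<in>I. a i * g (a i)) < 1"
  proof (cases "\<exists>i\<in>I. a i \<ge> 1 / 2")
    case False
    have "g (1/2) = 1" by (simp add: g_def power2_eq_square)
    then have "a i * g (a i) < a i * 1" if "i \<in> I" for i
      using False that a[OF that] g_mono[of "a i" "1/2"] by (intro mult_strict_left_mono) force+
    then have "(\<Sum>i\<in>I. a i * g (a i)) < (\<Sum>i\<in>I. a i * 1)"
      using fin ne by (intro sum_strict_mono) auto
    then show ?thesis using le' by simp
  next
    case True
    then obtain j where j: "j \<in> I" "a j \<ge> 1 / 2" by auto
    define J where "J = I - {j}"
    define s where "s = (\<Sum>i\<in>J. a i)"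
    have fJ: "finite J" and cJ: "card J \<ge> 2" using fin card j by (auto simp: J_def)
    have s: "s \<le> 1 - a j" using le' fin j by (simp add: s_def J_def sum.remove)
    \<comment> \<open>The third index enters here: besides \<open>j\<close> and \<open>i\<close> a
      positive summand is left, which makes the comparison of g at a_i and at s strict.\<close>
    have lt: "a i < s" if "i \<in> J" for i
    proof -
      have "card (J - {i}) \<ge> 1" using cJ fJ that by auto
      then have "J - {i} \<noteq> {}" by (metis card.empty not_one_le_zero)
      then have "(\<Sum>k\<in>J - {i}. a k) > 0" using fJ a by (intro sum_pos) (auto simp: J_def)
      then show ?thesis using fJ that by (simp add: s_def sum.remove)
    qed
    have "J \<noteq> {}" using cJ by auto
    then have s0: "s > 0" unfolding s_def using fJ a by (intro sum_pos) (auto simp: J_def)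
    have "(\<Sum>i\<in>J. a i * g (a i)) < (\<Sum>i\<in>J. a i * g s)"
      using fJ \<open>J \<noteq> {}\<close> lt a s j
      by (intro sum_strict_mono mult_strict_left_mono g_mono) (auto simp: J_def less_imp_le)
    also have "\<dots> = s * g s" by (simp add: s_def sum_distrib_right)
    also have "\<dots> \<le> (1 - a j) * g (1 - a j)"
    proof (cases "s = 1 - a j")
      case False
      have "g 0 < g s" using s0 s j by (intro g_mono) auto
      moreover have "g s < g (1 - a j)" using s s0 j False by (intro g_mono) auto
      ultimately show ?thesis using s s0 by (intro mult_mono) (auto simp: g_def)
    qed simp
    finally show ?thesis
      using g_refl[of "a j"] fin j by (simp add: J_def sum.remove)
  qed
  moreover have "(\<Sum>i\<in>I. B i / (1 + B i)) \<le> (\<Sum>i\<in>I. a i * g (a i))"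
    using le_g by (rule sum_mono)
  ultimately show ?thesis by simp
qed

text \<open>For two terms the ratios add up to at most 1 exactly when A1 A2 is at most 1, and to
  less than 1 exactly when B1 B2 is less than 1. The factor 1/2 on one side provides the
  strictness.\<close>

lemma sum_square_ratio_less_one_pair:
  fixes A1 A2 B1 B2 :: real
  assumes "0 \<le> A1" "0 \<le> A2" "0 \<le> B1" "B1 \<le> A1\<^sup>2 / 2" "0 \<le> B2" "B2 \<le> A2\<^sup>2"
    and "A1 / (1 + A1) + A2 / (1 + A2) \<le> 1"
  shows "B1 / (1 + B1) + B2 / (1 + B2) < 1"
proof -
  have "A1 * A2 \<le> 1" using assms(1,2,7)
    by (simp add: divide_simps add_nonneg_eq_0_iff) (auto simp: algebra_simps split: if_splits)
  then have "(A1 * A2)\<^sup>2 \<le> 1" using assms by (simp add: power_le_one)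
  moreover have "B1 * B2 \<le> A1\<^sup>2 / 2 * A2\<^sup>2" using assms by (intro mult_mono) auto
  ultimately have "B1 * B2 < 1" by (simp add: power_mult_distrib)
  then show ?thesis using assms(3,5)
    by (simp add: divide_simps add_nonneg_eq_0_iff) (auto simp: algebra_simps)
qed

section \<open>Resolvents of self-adjoint elements of the group algebra\<close>

lemma l2D: "f \<in> l2 A \<Longrightarrow> x \<notin> A \<Longrightarrow> f x = 0" "f \<in> l2 A \<Longrightarrow> (\<lambda>x. (cmod (f x))\<^sup>2) summable_on A"
  by (auto simp: l2_def)

lemma l2_add: assumes "f \<in> l2 A" "h \<in> l2 A" shows "(\<lambda>x. f x + h x) \<in> l2 A"
proof -
  have s: "(\<lambda>x. 2 * (cmod (f x))\<^sup>2 + 2 * (cmod (h x))\<^sup>2) summable_on A"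
    using assms by (intro summable_on_add summable_on_cmult_right l2D)
  have "(cmod (f x + h x))\<^sup>2 \<le> 2 * (cmod (f x))\<^sup>2 + 2 * (cmod (h x))\<^sup>2" for x
  proof -
    have "(cmod (f x + h x))\<^sup>2 \<le> (cmod (f x) + cmod (h x))\<^sup>2"
      by (intro power_mono norm_triangle_ineq norm_ge_zero)
    also have "\<dots> \<le> 2 * (cmod (f x))\<^sup>2 + 2 * (cmod (h x))\<^sup>2"
      using sum_squares_bound[of "cmod (f x)" "cmod (h x)"] by (simp add: power2_sum)
    finally show ?thesis .
  qed
  then have "(\<lambda>x. (cmod (f x + h x))\<^sup>2) summable_on A"
    by (intro summable_on_comparison_test[OF s]) auto
  then show ?thesis using assms by (auto simp: l2_def)
qed

lemma l2_scale: assumes "f \<in> l2 A" shows "(\<lambda>x. c * f x) \<in> l2 A"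
  using assms summable_on_cmult_right[of "\<lambda>x. (cmod (f x))\<^sup>2" A "(cmod c)\<^sup>2"]
  by (auto simp: l2_def norm_mult power_mult_distrib)

lemma l2_zero: "(\<lambda>x. 0) \<in> l2 A"
  by (simp add: l2_def)

lemma l2_diff: assumes "f \<in> l2 A" "h \<in> l2 A" shows "(\<lambda>x. f x - h x) \<in> l2 A"
  using l2_add[OF assms(1) l2_scale[OF assms(2), of "-1"]] by simp

lemma l2_sum: assumes "\<And>k. k \<in> K \<Longrightarrow> f k \<in> l2 A" shows "(\<lambda>x. \<Sum>k\<in>K. f k x) \<in> l2 A"
  using assms by (induction K rule: infinite_finite_induct) (auto intro: l2_zero l2_add)

lemma l2_delta: assumes "g \<in> A" shows "delta g \<in> l2 A"
proof -
  have "(\<lambda>x. (cmod (delta g x))\<^sup>2) summable_on A"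
  proof (rule finite_nonzero_values_imp_summable_on)
    have "{x \<in> A. (cmod (delta g x))\<^sup>2 \<noteq> 0} \<subseteq> {g}" by (auto simp: delta_def indicator_def)
    then show "finite {x \<in> A. (cmod (delta g x))\<^sup>2 \<noteq> 0}" by (rule finite_subset) simp
  qed
  then show ?thesis using assms by (auto simp: l2_def delta_def indicator_def)
qed

lemma l2_bij:
  assumes "f \<in> l2 A" "bij_betw \<phi> A A"
  shows "(\<lambda>x. if x \<in> A then f (\<phi> x) else 0) \<in> l2 A"
proof -
  have "(\<lambda>x. (cmod (f (\<phi> x)))\<^sup>2) summable_on A"
    using summable_on_reindex_bij_betw[OF assms(2), of "\<lambda>x. (cmod (f x))\<^sup>2"] l2D(2)[OF assms(1)] by simp
  then have "(\<lambda>x. (cmod (if x \<in> A then f (\<phi> x) else 0))\<^sup>2) summable_on A"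
    by (rule summable_on_cong[THEN iffD1, rotated]) auto
  then show ?thesis by (auto simp: l2_def)
qed

lemma l2_mult_summable:
  assumes "f \<in> l2 A" "h \<in> l2 A" shows "(\<lambda>x. cnj (f x) * h x) summable_on A"
proof -
  have s: "(\<lambda>x. (cmod (f x))\<^sup>2 + (cmod (h x))\<^sup>2) summable_on A"
    using assms by (intro summable_on_add l2D)
  have "norm (cnj (f x) * h x) \<le> (cmod (f x))\<^sup>2 + (cmod (h x))\<^sup>2" for x
  proof -
    have "2 * (cmod (f x) * cmod (h x)) \<le> (cmod (f x))\<^sup>2 + (cmod (h x))\<^sup>2"
      using sum_squares_bound[of "cmod (f x)" "cmod (h x)"] by simp
    moreover have "0 \<le> cmod (f x) * cmod (h x)" by simp
    ultimately have "cmod (f x) * cmod (h x) \<le> (cmod (f x))\<^sup>2 + (cmod (h x))\<^sup>2" by linarith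
    then show ?thesis by (simp add: norm_mult)
  qed
  then have "(\<lambda>x. norm (cnj (f x) * h x)) summable_on A"
    by (intro summable_on_comparison_test[OF s]) auto
  then show ?thesis by (rule abs_summable_summable)
qed

lemma l2_inner_add_right:
  "f \<in> l2 A \<Longrightarrow> h \<in> l2 A \<Longrightarrow> k \<in> l2 A \<Longrightarrow> l2_inner A f (\<lambda>x. h x + k x) = l2_inner A f h + l2_inner A f k"
  unfolding l2_inner_def by (subst infsum_add[symmetric]) (simp_all add: l2_mult_summable distrib_left)

lemma l2_inner_scale_right: "l2_inner A f (\<lambda>x. c * h x) = c * l2_inner A f h"
  unfolding l2_inner_def by (subst infsum_cmult_right'[symmetric]) (simp add: mult_ac)

lemma l2_inner_cnj: "l2_inner A h f = cnj (l2_inner A f h)"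
  unfolding l2_inner_def by (subst infsum_cnj[symmetric]) (simp add: mult.commute)

lemma l2_inner_diff_right:
  assumes "f \<in> l2 A" "h \<in> l2 A" "k \<in> l2 A"
  shows "l2_inner A f (\<lambda>x. h x - k x) = l2_inner A f h - l2_inner A f k"
  using l2_inner_add_right[OF assms(1,2) l2_scale[OF assms(3), of "-1"]] l2_inner_scale_right[of A f "-1" k]
  by simp

lemma l2_inner_diff_left:
  assumes "f \<in> l2 A" "h \<in> l2 A" "k \<in> l2 A"
  shows "l2_inner A (\<lambda>x. h x - k x) f = l2_inner A h f - l2_inner A k f"
  using l2_inner_diff_right[OF assms] by (subst (1 2 3) l2_inner_cnj) simp

lemma l2_inner_scale_left: "l2_inner A (\<lambda>x. c * h x) f = cnj c * l2_inner A h f"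
  using l2_inner_scale_right[of A f c h] by (subst (1 2) l2_inner_cnj) simp

lemma l2_inner_sum_right:
  assumes "f \<in> l2 A" "\<And>k. k \<in> K \<Longrightarrow> h k \<in> l2 A"
  shows "l2_inner A f (\<lambda>x. \<Sum>k\<in>K. h k x) = (\<Sum>k\<in>K. l2_inner A f (h k))"
  using assms(2)
proof (induction K rule: infinite_finite_induct)
  case (insert k K)
  then show ?case by (simp add: l2_inner_add_right[OF assms(1) _ l2_sum])
qed (simp_all add: l2_inner_def)

lemma l2_inner_sum_left:
  assumes "f \<in> l2 A" "\<And>k. k \<in> K \<Longrightarrow> h k \<in> l2 A"
  shows "l2_inner A (\<lambda>x. \<Sum>k\<in>K. h k x) f = (\<Sum>k\<in>K. l2_inner A (h k) f)"
  using arg_cong[OF l2_inner_sum_right[OF assms(1), of K h, OF assms(2)], of cnj]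
  by (simp add: l2_inner_cnj[symmetric])

lemma l2_inner_delta_left: assumes "g \<in> A" shows "l2_inner A (delta g) h = h g"
proof -
  have "l2_inner A (delta g) h = infsum (\<lambda>x. cnj (delta g x) * h x) {g}"
    unfolding l2_inner_def using assms by (intro infsum_cong_neutral) (auto simp: delta_def)
  then show ?thesis by (simp add: delta_def)
qed

lemma l2_inner_delta_right: assumes "g \<in> A" shows "l2_inner A h (delta g) = cnj (h g)"
  using l2_inner_delta_left[OF assms, of h] by (subst l2_inner_cnj) simp

definition sq_norm :: "'g set \<Rightarrow> ('g \<Rightarrow> complex) \<Rightarrow> real" where
  "sq_norm A f = (\<Sum>\<^sub>\<infinity>x\<in>A. (cmod (f x))\<^sup>2)"

lemma l2_inner_self:
  assumes "f \<in> l2 A" shows "l2_inner A f f = of_real (sq_norm A f)"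
proof -
  have "cnj (f x) * f x = of_real ((cmod (f x))\<^sup>2)" for x
    by (simp only: complex_norm_square mult.commute)
  then show ?thesis unfolding l2_inner_def sq_norm_def
    by (simp only: infsumI[OF has_sum_of_real[OF has_sum_infsum[OF l2D(2)[OF assms]]]])
qed

lemma sq_norm_nonneg: "0 \<le> sq_norm A f"
  unfolding sq_norm_def by (intro infsum_nonneg) simp

lemma sum_le_sq_norm:
  assumes "f \<in> l2 A" "finite F" "F \<subseteq> A" shows "(\<Sum>x\<in>F. (cmod (f x))\<^sup>2) \<le> sq_norm A f"
  unfolding sq_norm_def using assms by (intro finite_sum_le_infsum l2D) auto

lemma cmod_le_sq_norm: assumes "f \<in> l2 A" shows "(cmod (f x))\<^sup>2 \<le> sq_norm A f"
proof (cases "x \<in> A")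
  case True
  then show ?thesis using sum_le_sq_norm[OF assms, of "{x}"] by simp
next
  case False
  then show ?thesis using l2D(1)[OF assms] sq_norm_nonneg by simp
qed

lemma sq_norm_eq_0: "f \<in> l2 A \<Longrightarrow> sq_norm A f = 0 \<Longrightarrow> f = (\<lambda>x. 0)"
  using cmod_le_sq_norm[of f A] by (intro ext) (metis norm_eq_zero power2_less_eq_zero_iff)

lemma sq_norm_scale: "sq_norm A (\<lambda>x. c * f x) = (cmod c)\<^sup>2 * sq_norm A f"
  unfolding sq_norm_def by (subst infsum_cmult_right'[symmetric]) (simp add: norm_mult power_mult_distrib)

lemma sq_norm_add:
  assumes "f \<in> l2 A" "h \<in> l2 A"
  shows "sq_norm A (\<lambda>x. f x + h x) = sq_norm A f + sq_norm A h + 2 * Re (l2_inner A f h)"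
proof -
  have fh: "(\<lambda>x. f x + h x) \<in> l2 A" by (rule l2_add[OF assms])
  have "l2_inner A (\<lambda>x. f x + h x) (\<lambda>x. f x + h x) =
      l2_inner A (\<lambda>x. f x + h x) f + l2_inner A (\<lambda>x. f x + h x) h"
    by (rule l2_inner_add_right[OF fh assms])
  also have "\<dots> = cnj (l2_inner A f f + l2_inner A f h) + cnj (l2_inner A h f + l2_inner A h h)"
    using assms by (simp add: l2_inner_cnj[of A "\<lambda>x. f x + h x"] l2_inner_add_right)
  finally have "of_real (sq_norm A (\<lambda>x. f x + h x)) =
     cnj (of_real (sq_norm A f) + l2_inner A f h) + cnj (cnj (l2_inner A f h) + of_real (sq_norm A h))"
    by (simp add: l2_inner_self fh assms l2_inner_cnj[of A h f])
  from arg_cong[OF this, of Re] show ?thesis by simp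
qed

lemma sq_norm_add_le:
  assumes "f \<in> l2 A" "h \<in> l2 A"
  shows "sq_norm A (\<lambda>x. f x + h x) \<le> 2 * sq_norm A f + 2 * sq_norm A h"
proof -
  have "sq_norm A (\<lambda>x. f x + h x) + sq_norm A (\<lambda>x. f x + (- 1) * h x) = 2 * sq_norm A f + 2 * sq_norm A h"
    unfolding sq_norm_add[OF assms] sq_norm_add[OF assms(1) l2_scale[OF assms(2)]]
    unfolding sq_norm_scale l2_inner_scale_right by simp
  then show ?thesis using sq_norm_nonneg[of A "\<lambda>x. f x + (- 1) * h x"] by linarith
qed

text \<open>Iterates the two-term bound, which doubles the constant at each step. The size of the
  constant does not matter: it only has to be finite and independent of \<open>N\<close>.\<close>

lemma sq_norm_sum_le:
  assumes "finite K" "\<And>k. k \<in> K \<Longrightarrow> f k \<in> l2 A" "\<And>k. k \<in> K \<Longrightarrow> sq_norm A (f k) \<le> c k * N" "\<And>k. k \<in> K \<Longrightarrow> 0 \<le> c k" "0 \<le> N"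
  shows "sq_norm A (\<lambda>x. \<Sum>k\<in>K. f k x) \<le> 2 ^ card K * (\<Sum>k\<in>K. c k) * N"
  using assms(1-4)
proof (induction K rule: finite_induct)
  case empty
  then show ?case by (simp add: sq_norm_def)
next
  case (insert k K)
  have "sq_norm A (\<lambda>x. \<Sum>j\<in>insert k K. f j x) = sq_norm A (\<lambda>x. f k x + (\<Sum>j\<in>K. f j x))"
    using insert.hyps by simp
  also have "\<dots> \<le> 2 * sq_norm A (f k) + 2 * sq_norm A (\<lambda>x. \<Sum>j\<in>K. f j x)"
    using insert.prems by (intro sq_norm_add_le l2_sum) auto
  also have "\<dots> \<le> 2 * (c k * N) + 2 * (2 ^ card K * (\<Sum>k\<in>K. c k) * N)"
    using insert by (intro add_mono mult_left_mono) auto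
  also have "2 * (c k * N) \<le> 2 * (2 ^ card K * (c k * N))"
    using insert.prems assms(5) mult_right_mono[of 1 "2 ^ card K" "c k * N"] by (intro mult_left_mono) auto
  finally show ?case using insert.hyps by (simp add: algebra_simps)
qed

section \<open>Convolution by a self-adjoint element: resolvent and Green function\<close>

locale hermitian_element = group G for G :: "('g, 'm) monoid_scheme" (structure) +
  fixes p :: "'g \<Rightarrow> complex"
  assumes p_alg: "p \<in> group_algebra G" and p_star: "p = galg_star G p"
begin

abbreviation "V \<equiv> carrier G"
abbreviation "P \<equiv> left_regular G p"

lemma supp_finite: "finite (supp p)" and supp_carrier: "supp p \<subseteq> V"
  using p_alg by (auto simp: group_algebra_def)

lemma p_inv: assumes "g \<in> V" shows "p (inv g) = cnj (p g)"
proof -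
  have "p (inv g) = galg_star G p (inv g)" using p_star by (rule arg_cong)
  then show ?thesis using assms by (simp add: galg_star_def)
qed

lemma bij_left_mult: "g \<in> V \<Longrightarrow> bij_betw (\<lambda>x. g \<otimes> x) V V"
  by (rule bij_betwI[of _ _ _ "\<lambda>x. inv g \<otimes> x"]) (auto simp: m_assoc[symmetric])

lemma bij_right_mult: "g \<in> V \<Longrightarrow> bij_betw (\<lambda>x. x \<otimes> g) V V"
  by (rule bij_betwI[of _ _ _ "\<lambda>x. x \<otimes> inv g"]) (auto simp: m_assoc)

lemma l2_translation: "f \<in> l2 V \<Longrightarrow> g \<in> V \<Longrightarrow> left_translation G g f \<in> l2 V"
  unfolding left_translation_def by (rule l2_bij[OF _ bij_left_mult]) auto

lemma sq_norm_translation: assumes "g \<in> V" shows "sq_norm V (left_translation G g f) = sq_norm V f"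
proof -
  have "sq_norm V (left_translation G g f) = infsum (\<lambda>x. (cmod (f (inv g \<otimes> x)))\<^sup>2) V"
    unfolding sq_norm_def by (intro infsum_cong) (simp add: left_translation_def)
  also have "\<dots> = sq_norm V f" unfolding sq_norm_def
    using infsum_reindex_bij_betw[OF bij_left_mult[of "inv g"], of "\<lambda>x. (cmod (f x))\<^sup>2"] assms by simp
  finally show ?thesis .
qed

lemma translation_adjoint:
  assumes "g \<in> V" shows "l2_inner V (left_translation G g f) h = l2_inner V f (left_translation G (inv g) h)"
proof -
  have "l2_inner V (left_translation G g f) h = infsum (\<lambda>x. cnj (f (inv g \<otimes> x)) * h x) V"
    unfolding l2_inner_def by (intro infsum_cong) (simp add: left_translation_def)
  also have "\<dots> = infsum (\<lambda>y. cnj (f (inv g \<otimes> (g \<otimes> y))) * h (g \<otimes> y)) V"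
    using infsum_reindex_bij_betw[OF bij_left_mult[OF assms], of "\<lambda>x. cnj (f (inv g \<otimes> x)) * h x"] by simp
  also have "\<dots> = l2_inner V f (left_translation G (inv g) h)"
    unfolding l2_inner_def using assms
    by (intro infsum_cong) (simp add: left_translation_def m_assoc[symmetric])
  finally show ?thesis .
qed

lemma P_l2: "f \<in> l2 V \<Longrightarrow> P f \<in> l2 V"
  unfolding left_regular_def using supp_carrier by (intro l2_sum l2_scale l2_translation) auto

lemma P_self_adjoint:
  assumes "f \<in> l2 V" "h \<in> l2 V" shows "l2_inner V (P f) h = l2_inner V f (P h)"
proof -
  have S: "g \<in> V" if "g \<in> supp p" for g using that supp_carrier by auto
  have "l2_inner V (P f) h = (\<Sum>g\<in>supp p. cnj (p g) * l2_inner V (left_translation G g f) h)"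
    unfolding left_regular_def using assms S
    by (subst l2_inner_sum_left) (auto simp: l2_inner_scale_left l2_scale l2_translation)
  also have "\<dots> = (\<Sum>g\<in>supp p. p (inv g) * l2_inner V f (left_translation G (inv g) h))"
    using S by (intro sum.cong) (auto simp: p_inv translation_adjoint)
  also have "\<dots> = (\<Sum>g\<in>supp p. p g * l2_inner V f (left_translation G g h))"
    using S by (intro sum.reindex_bij_witness[of _ "\<lambda>g. inv g" "\<lambda>g. inv g"]) (auto simp: supp_def p_inv)
  also have "\<dots> = l2_inner V f (P h)"
    unfolding left_regular_def using assms S
    by (subst l2_inner_sum_right) (auto simp: l2_inner_scale_right l2_scale l2_translation)
  finally show ?thesis .
qed

text \<open>A bound for the square of the operator norm, not for the norm.\<close>

definition op_bound :: real where
  "op_bound = 2 ^ card (supp p) * (\<Sum>g\<in>supp p. (cmod (p g))\<^sup>2)"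

lemma op_bound_nonneg: "0 \<le> op_bound"
  by (simp add: op_bound_def sum_nonneg)

lemma sq_norm_P_le: assumes "f \<in> l2 V" shows "sq_norm V (P f) \<le> op_bound * sq_norm V f"
  unfolding left_regular_def op_bound_def using supp_carrier assms
  by (intro sq_norm_sum_le supp_finite l2_scale l2_translation sq_norm_nonneg)
     (auto simp: sq_norm_scale sq_norm_translation subset_iff)

lemma P_linear: "P (\<lambda>x. f x + h x) x = P f x + P h x" "P (\<lambda>x. f x - h x) x = P f x - P h x" "P (\<lambda>x. c * f x) x = c * P f x"
  by (auto simp: left_regular_def left_translation_def sum.distrib[symmetric] sum_subtractf[symmetric]
      sum_distrib_left algebra_simps intro!: sum.cong)

lemma shifted_l2: "f \<in> l2 V \<Longrightarrow> (\<lambda>x. P f x - z * f x) \<in> l2 V"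
  by (intro l2_diff P_l2 l2_scale)

text \<open>The form of \<open>P\<close> is real by self-adjointness, so only \<open>z\<close>
  contributes. This identity gives injectivity of P - z, kills the cross term in the contraction
  estimate, and yields the Ward identity \<open>Im_green\<close>.\<close>

lemma Im_quadratic_form:
  assumes "f \<in> l2 V" shows "Im (l2_inner V f (\<lambda>x. P f x - z * f x)) = - Im z * sq_norm V f"
proof -
  have "l2_inner V f (P f) = cnj (l2_inner V f (P f))"
    using P_self_adjoint[OF assms assms] l2_inner_cnj[of V "P f" f] by simp
  then have "Im (l2_inner V f (P f)) = 0" by (simp add: complex_eq_iff)
  then show ?thesis
    unfolding l2_inner_diff_right[OF assms P_l2[OF assms] l2_scale[OF assms]] l2_inner_scale_right
      l2_inner_self[OF assms]
    by simp
qed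

lemma shifted_inj:
  assumes "Im z \<noteq> 0" "f \<in> l2 V" "h \<in> l2 V" "\<And>x. P f x - z * f x = P h x - z * h x"
  shows "f = h"
proof -
  define k where "k x = f x - h x" for x
  have k: "k \<in> l2 V" unfolding k_def by (rule l2_diff[OF assms(2,3)])
  have "(\<lambda>x. P k x - z * k x) = (\<lambda>x. 0)"
    using assms(4) unfolding k_def P_linear by (auto simp: algebra_simps)
  then have "Im z * sq_norm V k = 0"
    using Im_quadratic_form[OF k, of z] by (simp add: l2_inner_def)
  then have "k = (\<lambda>x. 0)" using assms(1) sq_norm_eq_0[OF k] by simp
  then show ?thesis unfolding k_def by (metis eq_iff_diff_eq_0 ext)
qed

text \<open>As \<open>P\<close> is self-adjoint, \<open>1 - \<i> t (P - z)\<close> is a contraction for suitable real \<open>t\<close>; its Neumann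
  series inverts \<open>P - z\<close>.\<close>

lemma shifted_surj:
  assumes z: "Im z \<noteq> 0" and h: "h \<in> l2 V"
  obtains f where "f \<in> l2 V" "\<And>x. P f x - z * f x = h x"
proof -
  define E \<eta> M where "E = Re z" and "\<eta> = Im z" and "M = 2 * op_bound + 2 * E\<^sup>2"
  have M0: "0 \<le> M" using op_bound_nonneg by (simp add: M_def)
  \<comment> \<open>The minimiser of (1 - t \<eta>)^2 + t^2 M; the minimum is \<open>q\<close>,
    which is below 1 because \<eta> is non-zero.\<close>
  define t where "t = \<eta> / (\<eta>\<^sup>2 + M)"
  define q where "q = M / (\<eta>\<^sup>2 + M)"
  have \<eta>2: "\<eta>\<^sup>2 > 0" using z by (simp add: \<eta>_def)
  then have den: "\<eta>\<^sup>2 + M > 0" using M0 by (rule add_pos_nonneg)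
  have q: "0 \<le> q" "q < 1"
    unfolding q_def divide_less_eq_1_pos[OF den] using M0 den \<eta>2 by (simp_all only: divide_nonneg_pos less_add_same_cancel2)
  have t0: "t \<noteq> 0" using \<eta>2 den by (auto simp: t_def)
  have q_eq: "(1 - t * \<eta>)\<^sup>2 + t\<^sup>2 * M = q"
  proof -
    have a: "1 - t * \<eta> = M / (\<eta>\<^sup>2 + M)" using den by (simp add: t_def field_simps power2_eq_square)
    have "t\<^sup>2 * M = \<eta>\<^sup>2 * M / (\<eta>\<^sup>2 + M)\<^sup>2" by (simp add: t_def power_divide)
    then have "(1 - t * \<eta>)\<^sup>2 + t\<^sup>2 * M = (M * (\<eta>\<^sup>2 + M)) / (\<eta>\<^sup>2 + M)\<^sup>2"
      unfolding a by (simp add: power_divide add_divide_distrib[symmetric] power2_eq_square algebra_simps)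
    then show ?thesis using den by (simp add: q_def power2_eq_square)
  qed
  define U where "U f x = f x - \<i> * of_real t * (P f x - z * f x)" for f x
  have U_l2: "U f \<in> l2 V" if "f \<in> l2 V" for f
    unfolding U_def using that by (intro l2_diff l2_scale shifted_l2)
  have U_contr: "sq_norm V (U f) \<le> q * sq_norm V f" if f: "f \<in> l2 V" for f
  proof -
    define k where "k x = P f x - of_real E * f x" for x
    have k: "k \<in> l2 V" unfolding k_def by (rule shifted_l2[OF f])
    have kN: "sq_norm V k \<le> M * sq_norm V f"
    proof -
      have "sq_norm V k = sq_norm V (\<lambda>x. P f x + (- of_real E) * f x)" by (simp add: k_def[abs_def])
      also have "\<dots> \<le> 2 * sq_norm V (P f) + 2 * sq_norm V (\<lambda>x. (- of_real E) * f x)"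
        by (intro sq_norm_add_le P_l2 l2_scale f)
      also have "\<dots> \<le> 2 * (op_bound * sq_norm V f) + 2 * (E\<^sup>2 * sq_norm V f)"
        using sq_norm_P_le[OF f] unfolding sq_norm_scale by simp
      finally show ?thesis by (simp add: M_def algebra_simps)
    qed
    have U_eq: "U f = (\<lambda>x. of_real (1 - t * \<eta>) * f x + (- \<i> * of_real t) * k x)"
    proof
      fix x
      have "z = of_real E + \<i> * of_real \<eta>" by (simp add: E_def \<eta>_def complex_eq_iff)
      then show "U f x = of_real (1 - t * \<eta>) * f x + (- \<i> * of_real t) * k x"
        by (simp add: U_def k_def algebra_simps)
    qed
    have "sq_norm V (U f) = (1 - t * \<eta>)\<^sup>2 * sq_norm V f + t\<^sup>2 * sq_norm V k
        + 2 * Re (of_real (1 - t * \<eta>) * (- \<i> * of_real t) * l2_inner V f k)"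
      unfolding U_eq sq_norm_add[OF l2_scale[OF f] l2_scale[OF k]] l2_inner_scale_left l2_inner_scale_right sq_norm_scale
        complex_cnj_complex_of_real norm_of_real power2_abs
      by (simp add: norm_mult mult.assoc)
    also have "Re (of_real (1 - t * \<eta>) * (- \<i> * of_real t) * l2_inner V f k) = 0"
      using Im_quadratic_form[OF f, of "of_real E"] by (simp add: k_def[abs_def])
    also have "(1 - t * \<eta>)\<^sup>2 * sq_norm V f + t\<^sup>2 * sq_norm V k + 2 * 0 \<le>
        (1 - t * \<eta>)\<^sup>2 * sq_norm V f + t\<^sup>2 * (M * sq_norm V f)"
      using kN by (simp add: mult_left_mono)
    also have "\<dots> = q * sq_norm V f" unfolding q_eq[symmetric] by (simp add: algebra_simps)
    finally show ?thesis .
  qed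
  define d where "d n = (U ^^ n) h" for n
  have d_l2: "d n \<in> l2 V" for n by (induction n) (auto simp: d_def h U_l2)
  have d_norm: "sq_norm V (d n) \<le> q ^ n * sq_norm V h" for n
  proof (induction n)
    case (Suc n)
    have "sq_norm V (d (Suc n)) \<le> q * sq_norm V (d n)" using U_contr[OF d_l2[of n]] by (simp add: d_def)
    also have "\<dots> \<le> q * (q ^ n * sq_norm V h)" using Suc q by (intro mult_left_mono)
    finally show ?case by (simp add: mult.assoc)
  qed (simp add: d_def)
  define b where "b n = sqrt q ^ n * sqrt (sq_norm V h)" for n
  have b_eq: "b n = sqrt (q ^ n * sq_norm V h)" for n by (simp add: b_def real_sqrt_mult real_sqrt_power)
  have b0: "0 \<le> b n" for n by (simp add: b_eq q sq_norm_nonneg)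
  have "sqrt q < 1" using q by simp
  then have sb: "summable b" unfolding b_def using q by (intro summable_mult2 summable_geometric) simp
  have d_le: "cmod (d n x) \<le> b n" for n x
    unfolding b_eq using cmod_le_sq_norm[OF d_l2[of n], of x] d_norm[of n] by (intro real_le_rsqrt) linarith
  have sd: "summable (\<lambda>n. d n x)" for x
    by (rule summable_comparison_test[OF _ sb]) (use d_le in auto)
  define c where "c = \<i> * of_real t"
  define fN where "fN N x = c * (\<Sum>n<N. d n x)" for N x
  define f where "f x = c * (\<Sum>n. d n x)" for x
  have lim: "(\<lambda>N. fN N x) \<longlonglongrightarrow> f x" for x
    unfolding fN_def f_def by (intro tendsto_mult tendsto_const summable_LIMSEQ sd)
  have fN_l2: "fN N \<in> l2 V" for N
    unfolding fN_def by (intro l2_scale l2_sum d_l2)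
  \<comment> \<open>Square-summability of the pointwise limit is checked on finite sets: Minkowski's
    inequality bounds the partial sums there by \<open>suminf b\<close>, uniformly in the number of
    terms and in the set.\<close>
  have f_l2: "f \<in> l2 V"
  proof -
    define B where "B = (\<bar>t\<bar> * suminf b)\<^sup>2"
    have bound: "(\<Sum>x\<in>F. (cmod (f x))\<^sup>2) \<le> B" if F: "finite F" "F \<subseteq> V" for F
    proof -
      have "L2_set (\<lambda>x. cmod (d n x)) F \<le> b n" for n
        unfolding b_eq L2_set_def using sum_le_sq_norm[OF d_l2[of n] F] d_norm[of n]
        by (intro real_sqrt_le_mono) linarith
      then have "L2_set (\<lambda>x. cmod (\<Sum>n<N. d n x)) F \<le> (\<Sum>n<N. b n)" for N
      proof (induction N)
        case (Suc N)
        have "L2_set (\<lambda>x. cmod (\<Sum>n<Suc N. d n x)) F \<le> L2_set (\<lambda>x. cmod (\<Sum>n<N. d n x) + cmod (d N x)) F"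
          by (intro L2_set_mono) (auto intro: norm_triangle_ineq)
        also have "\<dots> \<le> L2_set (\<lambda>x. cmod (\<Sum>n<N. d n x)) F + L2_set (\<lambda>x. cmod (d N x)) F"
          by (rule L2_set_triangle_ineq)
        finally show ?case using Suc.IH[OF Suc.prems] Suc.prems[of N] by simp
      qed (simp add: L2_set_def)
      moreover have "(\<Sum>n<N. b n) \<le> suminf b" for N by (intro sum_le_suminf sb) (use b0 in auto)
      ultimately have le: "L2_set (\<lambda>x. cmod (\<Sum>n<N. d n x)) F \<le> suminf b" for N by (meson order_trans)
      have "(\<Sum>x\<in>F. (cmod (fN N x))\<^sup>2) \<le> B" for N
      proof -
        have "(\<Sum>x\<in>F. (cmod (fN N x))\<^sup>2) = (\<bar>t\<bar> * L2_set (\<lambda>x. cmod (\<Sum>n<N. d n x)) F)\<^sup>2"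
          by (simp add: fN_def c_def norm_mult power_mult_distrib L2_set_def sum_nonneg flip: sum_distrib_left)
        also have "\<dots> \<le> B" unfolding B_def using le
          by (intro power_mono mult_left_mono mult_nonneg_nonneg L2_set_nonneg) auto
        finally show ?thesis .
      qed
      moreover have "(\<lambda>N. \<Sum>x\<in>F. (cmod (fN N x))\<^sup>2) \<longlonglongrightarrow> (\<Sum>x\<in>F. (cmod (f x))\<^sup>2)"
        by (intro tendsto_sum tendsto_power tendsto_norm lim)
      ultimately show ?thesis by (intro LIMSEQ_le_const2) auto
    qed
    have "(\<lambda>x. (cmod (f x))\<^sup>2) summable_on V"
      by (rule nonneg_bdd_above_summable_on) (auto intro!: bdd_aboveI[of _ B] bound)
    moreover have "f x = 0" if "x \<notin> V" for x
      using l2D(1)[OF d_l2 that] by (simp add: f_def)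
    ultimately show ?thesis by (simp add: l2_def)
  qed
  have "P f x - z * f x = h x" for x
  proof -
    \<comment> \<open>The sum telescopes: \<open>c\<close> times (P - z) applied to
      \<open>d N\<close> is \<open>d N - d (Suc N)\<close>.\<close>
    have "P (fN N) x - z * fN N x = h x - d N x" for N
    proof (induction N)
      case 0
      have "P (\<lambda>x. 0) x = 0" by (simp add: left_regular_def left_translation_def)
      then show ?case by (simp add: fN_def[abs_def] d_def)
    next
      case (Suc N)
      have "fN (Suc N) = (\<lambda>x. fN N x + c * d N x)" by (auto simp: fN_def algebra_simps)
      then have "P (fN (Suc N)) x - z * fN (Suc N) x = (h x - d N x) + c * (P (d N) x - z * d N x)"
        using Suc.IH by (simp add: P_linear algebra_simps)
      also have "c * (P (d N) x - z * d N x) = d N x - d (Suc N) x"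
        by (simp add: c_def d_def U_def)
      finally show ?case by simp
    qed
    moreover have "(\<lambda>N. h x - d N x) \<longlonglongrightarrow> h x - 0"
      by (intro tendsto_diff tendsto_const summable_LIMSEQ_zero sd)
    ultimately have "(\<lambda>N. P (fN N) x - z * fN N x) \<longlonglongrightarrow> h x" by simp
    moreover have "(\<lambda>N. P (fN N) x - z * fN N x) \<longlonglongrightarrow> P f x - z * f x"
    proof -
      have "(\<lambda>N. P (fN N) x) \<longlonglongrightarrow> P f x"
        unfolding left_regular_def left_translation_def
        by (cases "x \<in> V") (auto intro!: tendsto_intros lim)
      then show ?thesis by (intro tendsto_intros lim)
    qed
    ultimately show ?thesis by (rule LIMSEQ_unique[rotated])
  qed
  with f_l2 show ?thesis by (rule that)
qed

abbreviation "Res z \<equiv> op_resolvent V P z"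

text \<open>By injectivity, the \<open>inv_into\<close> in the definition of the resolvent can be
  evaluated by exhibiting any square-summable solution.\<close>

lemma Res_eqI:
  assumes "Im z \<noteq> 0" "k \<in> l2 V" "\<And>x. P k x - z * k x = f x"
  shows "Res z f = k"
proof -
  have "inj_on (\<lambda>f x. P f x - z * f x) (l2 V)"
    by (rule inj_onI) (rule shifted_inj[OF assms(1)], auto dest: fun_cong)
  then have "inv_into (l2 V) (\<lambda>f x. P f x - z * f x) (\<lambda>x. P k x - z * k x) = k"
    using assms(2) by (rule inv_into_f_f)
  moreover have "f = (\<lambda>x. P k x - z * k x)" using assms(3) by auto
  ultimately show ?thesis by (simp only: op_resolvent_def)
qed

lemma Res:
  assumes "Im z \<noteq> 0" "f \<in> l2 V"
  shows "Res z f \<in> l2 V" "P (Res z f) x - z * Res z f x = f x"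
proof -
  obtain k where "k \<in> l2 V" "\<And>x. P k x - z * k x = f x" using shifted_surj[OF assms] by blast
  moreover from this have "Res z f = k" by (intro Res_eqI[OF assms(1)])
  ultimately show "Res z f \<in> l2 V" "P (Res z f) x - z * Res z f x = f x" by auto
qed

lemma Res_adjoint:
  assumes z: "Im z \<noteq> 0" and f: "f \<in> l2 V" and h: "h \<in> l2 V"
  shows "l2_inner V (Res z f) h = l2_inner V f (Res (cnj z) h)"
proof -
  have z': "Im (cnj z) \<noteq> 0" using z by simp
  define u v where "u = Res z f" and "v = Res (cnj z) h"
  have u: "u \<in> l2 V" and v: "v \<in> l2 V" using Res(1)[OF z f] Res(1)[OF z' h] by (auto simp: u_def v_def)
  have f': "f = (\<lambda>x. P u x - z * u x)" and h': "h = (\<lambda>x. P v x - cnj z * v x)"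
    using Res(2)[OF z f] Res(2)[OF z' h] by (auto simp: u_def v_def)
  have "l2_inner V u h = l2_inner V f v"
    unfolding f' h' l2_inner_diff_right[OF u P_l2[OF v] l2_scale[OF v]] l2_inner_diff_left[OF v P_l2[OF u] l2_scale[OF u]]
      l2_inner_scale_right l2_inner_scale_left P_self_adjoint[OF u v] ..
  then show ?thesis by (simp add: u_def v_def)
qed

text \<open>The definite description in \<open>op_adjoint\<close> requires uniqueness: testing
  against \<open>delta g\<close> determines the values on \<open>V\<close>, and members of
  \<open>l2 V\<close> vanish elsewhere.\<close>

lemma op_adjoint_Res:
  assumes z: "Im z \<noteq> 0" and h: "h \<in> l2 V"
  shows "op_adjoint V (Res z) h = Res (cnj z) h"
  unfolding op_adjoint_def
proof (rule the_equality)
  have z': "Im (cnj z) \<noteq> 0" using z by simp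
  show "Res (cnj z) h \<in> l2 V \<and> (\<forall>f\<in>l2 V. l2_inner V (Res z f) h = l2_inner V f (Res (cnj z) h))"
    using Res(1)[OF z' h] Res_adjoint[OF z _ h] by blast
  fix k assume k: "k \<in> l2 V \<and> (\<forall>f\<in>l2 V. l2_inner V (Res z f) h = l2_inner V f k)"
  show "k = Res (cnj z) h"
  proof
    fix g
    show "k g = Res (cnj z) h g"
    proof (cases "g \<in> V")
      case True
      then have "l2_inner V (delta g) k = l2_inner V (delta g) (Res (cnj z) h)"
        using k l2_delta[OF True] Res_adjoint[OF z _ h] by metis
      then show ?thesis using l2_inner_delta_left[OF True] by simp
    next
      case False
      then show ?thesis using k l2D(1) Res(1)[OF z' h] by metis
    qed
  qed
qed

definition green :: "complex \<Rightarrow> 'g \<Rightarrow> complex" where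
  "green z = Res z (delta \<one>)"

lemma green:
  assumes "Im z \<noteq> 0"
  shows "green z \<in> l2 V" "P (green z) x - z * green z x = delta \<one> x"
  using Res[OF assms l2_delta[OF one_closed]] by (auto simp: green_def)

text \<open>Right translations commute with left convolution, so every column of the resolvent is a
  right translate of the Green function.\<close>

lemma Res_delta:
  assumes z: "Im z \<noteq> 0" and g: "g \<in> V"
  shows "Res z (delta g) = (\<lambda>x. if x \<in> V then green z (x \<otimes> inv g) else 0)"
proof (rule Res_eqI[OF z])
  let ?k = "\<lambda>x. if x \<in> V then green z (x \<otimes> inv g) else 0"
  show "?k \<in> l2 V" using g by (intro l2_bij green(1)[OF z] bij_right_mult) auto
  fix x
  show "P ?k x - z * ?k x = delta g x"
  proof (cases "x \<in> V")
    case True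
    have "P ?k x = P (green z) (x \<otimes> inv g)"
      unfolding left_regular_def using True g supp_carrier
      by (intro sum.cong refl) (auto simp: left_translation_def m_assoc subset_iff)
    then have "P ?k x - z * ?k x = delta \<one> (x \<otimes> inv g)"
      using green(2)[OF z, of "x \<otimes> inv g"] True by simp
    also have "x \<otimes> inv g = \<one> \<longleftrightarrow> x = g"
      using True g by (metis inv_closed inv_equality inv_inv r_inv)
    then have "delta \<one> (x \<otimes> inv g) = delta g x" by (auto simp: delta_def indicator_def)
    finally show ?thesis .
  next
    case False
    then show ?thesis using g by (auto simp: left_regular_def left_translation_def delta_def indicator_def)
  qed
qed

text \<open>The entry of R at (e, g) is the Green function at the inverse of \<open>g\<close>, by
  right invariance; the entry of the adjoint is the conjugate of the Green function at
  \<open>g\<close> itself. For this reason the fourth-power sums below run over words and over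
  inverses of words.\<close>

lemma op_entry_Im_Res:
  assumes z: "Im z \<noteq> 0" and g: "g \<in> V"
  shows "op_entry V (op_Im V (Res z)) \<one> g = (green z (inv g) - cnj (green z g)) / (2 * \<i>)"
proof -
  have z': "Im (cnj z) \<noteq> 0" using z by simp
  have "op_adjoint V (Res z) (delta g) \<one> = l2_inner V (delta \<one>) (Res (cnj z) (delta g))"
    by (simp add: op_adjoint_Res[OF z l2_delta[OF g]] l2_inner_delta_left)
  also have "\<dots> = cnj (green z g)"
    unfolding Res_adjoint[OF z l2_delta[OF one_closed] l2_delta[OF g], symmetric]
    by (simp add: l2_inner_delta_right[OF g] green_def)
  finally show ?thesis
    using g by (simp add: op_entry_def op_Im_def l2_inner_delta_left Res_delta[OF z g])
qed

lemma Im_green: assumes z: "Im z \<noteq> 0" shows "Im (green z \<one>) = Im z * sq_norm V (green z)"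
proof -
  have "l2_inner V (green z) (\<lambda>x. P (green z) x - z * green z x) = cnj (green z \<one>)"
    unfolding green(2)[OF z] by (simp add: l2_inner_delta_right)
  then show ?thesis using Im_quadratic_form[OF green(1)[OF z], of z] by simp
qed

lemma cmod_green_le: assumes z: "Im z > 0" shows "cmod (green z \<one>) \<le> 1 / Im z"
proof -
  have "(cmod (green z \<one>))\<^sup>2 \<le> sq_norm V (green z)" using z by (intro cmod_le_sq_norm green) simp
  then have "Im z * (cmod (green z \<one>))\<^sup>2 \<le> Im (green z \<one>)" using z by (simp add: Im_green)
  also have "\<dots> \<le> cmod (green z \<one>)" using abs_Im_le_cmod[of "green z \<one>"] by simp
  finally have "(Im z * cmod (green z \<one>)) * cmod (green z \<one>) \<le> 1 * cmod (green z \<one>)"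
    by (simp add: power2_eq_square mult.assoc)
  then have "cmod (green z \<one>) = 0 \<or> Im z * cmod (green z \<one>) \<le> 1"
    by (metis mult_right_le_imp_le norm_ge_zero order_le_less)
  then show ?thesis using z by (auto simp: field_simps)
qed

text \<open>From 1 = norm of (P - z) G and boundedness of \<open>P\<close> comes a lower bound for
  the norm of the Green function G, which the Ward identity turns into one for Im G(e). It covers
  spectral parameters away from the real axis.\<close>

lemma Im_green_ge:
  assumes z: "Im z > 0" shows "Im z / (2 * op_bound + 2 * (cmod z)\<^sup>2) \<le> Im (green z \<one>)"
proof -
  have z0: "Im z \<noteq> 0" using z by simp
  have "1 = sq_norm V (delta \<one>)"
    using l2_inner_self[OF l2_delta[OF one_closed]] by (simp add: l2_inner_delta_left) (simp add: delta_def)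
  also have "delta \<one> = (\<lambda>x. P (green z) x + (- z) * green z x)" using green(2)[OF z0] by auto
  also have "sq_norm V \<dots> \<le> 2 * sq_norm V (P (green z)) + 2 * sq_norm V (\<lambda>x. (- z) * green z x)"
    by (intro sq_norm_add_le P_l2 l2_scale green z0)
  also have "\<dots> \<le> 2 * (op_bound * sq_norm V (green z)) + 2 * ((cmod z)\<^sup>2 * sq_norm V (green z))"
    using sq_norm_P_le[OF green(1)[OF z0]] unfolding sq_norm_scale by simp
  finally have "1 \<le> (2 * op_bound + 2 * (cmod z)\<^sup>2) * sq_norm V (green z)" by (simp add: algebra_simps)
  moreover have "0 < 2 * op_bound + 2 * (cmod z)\<^sup>2"
    using op_bound_nonneg z by (intro add_nonneg_pos) auto
  ultimately have "1 / (2 * op_bound + 2 * (cmod z)\<^sup>2) \<le> sq_norm V (green z)" by (simp add: field_simps)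
  then show ?thesis using z mult_left_mono[of _ _ "Im z"] unfolding Im_green[OF z0] by fastforce
qed

end

section \<open>Products over reduced words\<close>

abbreviation (input) punctured :: "('a, 'b) monoid_scheme \<Rightarrow> 'a set" where
  "punctured G \<equiv> carrier G - {\<one>\<^bsub>G\<^esub>}"

definition word_weight :: "('i \<Rightarrow> 'a \<Rightarrow> 'c::comm_monoid_mult) \<Rightarrow> ('i \<times> 'a) list \<Rightarrow> 'c" where
  "word_weight F w = prod_list (map (\<lambda>(i, x). F i x) w)"

lemma word_weight_simps [simp]:
  "word_weight F [] = 1" "word_weight F ((i, x) # w) = F i x * word_weight F w"
  by (simp_all add: word_weight_def)

text \<open>The additional \<open>t\<close> per letter becomes an exponential in the number of
  syllables. The choice t = 1, k = 2 serves square-summability; t above 1 with k = 4 absorbs the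
  polynomial weight in (R4).\<close>

lemma word_weight_cmod_power:
  "word_weight (\<lambda>i x. t * cmod (F i x) ^ k) w = t ^ length w * cmod (word_weight F w) ^ k"
  by (induction w) (auto simp: norm_mult power_mult_distrib mult_ac)

lemma word_weight_nonneg:
  fixes b :: "'i \<Rightarrow> 'a \<Rightarrow> real"
  shows "(\<And>i x. 0 \<le> b i x) \<Longrightarrow> 0 \<le> word_weight b w"
  by (induction w) auto

text \<open>Prescribing the factors allowed for the first letter closes the recursion: deleting a
  first letter from factor \<open>j\<close> leaves a word allowed to start in
  \<open>I - {j}\<close>. The length bound keeps the sets finite.\<close>

definition words_from :: "'i set \<Rightarrow> ('i \<Rightarrow> ('a, 'b) monoid_scheme) \<Rightarrow> 'i set \<Rightarrow> nat \<Rightarrow> ('i \<times> 'a) list set" where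
  "words_from I G J N = {w \<in> reduced_words I G. length w \<le> N \<and> (w = [] \<or> fst (hd w) \<in> J)}"

lemma words_from_0: "words_from I G J 0 = {[]}"
  by (auto simp: words_from_def)

lemma words_from_Suc:
  assumes "J \<subseteq> I"
  shows "words_from I G J (Suc N) = insert [] ((\<lambda>(l, w). l # w) `
      Sigma (Sigma J (\<lambda>j. punctured (G j))) (\<lambda>l. words_from I G (I - {fst l}) N))"
proof (intro equalityI subsetI)
  fix w assume w: "w \<in> words_from I G J (Suc N)"
  show "w \<in> insert [] ((\<lambda>(l, w). l # w) `
      Sigma (Sigma J (\<lambda>j. punctured (G j))) (\<lambda>l. words_from I G (I - {fst l}) N))"
  proof (cases w)
    case (Cons l w')
    obtain j x where l: "l = (j, x)" by (cases l)
    have "w' = [] \<or> fst (hd w') \<in> I"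
      using w unfolding Cons l words_from_def by (cases w') (auto simp: reduced_words_Cons)
    then have "((j, x), w') \<in> Sigma (Sigma J (\<lambda>j. punctured (G j))) (\<lambda>l. words_from I G (I - {fst l}) N)"
      using w unfolding Cons l words_from_def by (auto simp: reduced_words_Cons)
    then show ?thesis unfolding Cons l by (intro insertI2 rev_image_eqI) auto
  qed simp
qed (use assms in \<open>auto simp: words_from_def reduced_words_Cons\<close>)

lemma finite_words_from:
  assumes "finite I" "\<And>i. i \<in> I \<Longrightarrow> finite (carrier (G i))" "J \<subseteq> I"
  shows "finite (words_from I G J N)"
  using assms(3)
proof (induction N arbitrary: J)
  case (Suc N)
  have "finite J" using Suc.prems assms(1) by (rule finite_subset)
  then show ?case unfolding words_from_Suc[OF Suc.prems]
    using Suc assms(2) by (intro finite.insertI finite_imageI finite_SigmaI) auto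
qed (simp add: words_from_0)

lemma sum_words_from_Suc:
  fixes b :: "'i \<Rightarrow> 'a \<Rightarrow> real"
  assumes "finite I" "\<And>i. i \<in> I \<Longrightarrow> finite (carrier (G i))" "J \<subseteq> I"
  shows "(\<Sum>w\<in>words_from I G J (Suc N). word_weight b w) =
    1 + (\<Sum>j\<in>J. (\<Sum>x\<in>punctured (G j). b j x) * (\<Sum>w\<in>words_from I G (I - {j}) N. word_weight b w))"
proof -
  let ?L = "Sigma J (\<lambda>j. punctured (G j))"
  let ?S = "Sigma ?L (\<lambda>l. words_from I G (I - {fst l}) N)"
  have fJ: "finite J" using assms(1,3) by (metis finite_subset)
  have fL: "finite ?L" using fJ assms by (intro finite_SigmaI) auto
  have fW: "finite (words_from I G (I - {j}) N)" for j by (intro finite_words_from assms) auto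
  have inj: "inj_on (\<lambda>(l, w). l # w) ?S" by (auto simp: inj_on_def)
  have "(\<Sum>w\<in>words_from I G J (Suc N). word_weight b w) =
      1 + (\<Sum>w\<in>(\<lambda>(l, w). l # w) ` ?S. word_weight b w)"
    unfolding words_from_Suc[OF assms(3)] using fL fW by (subst sum.insert) auto
  also have "(\<Sum>w\<in>(\<lambda>(l, w). l # w) ` ?S. word_weight b w) = (\<Sum>(l, w)\<in>?S. word_weight b (l # w))"
    by (subst sum.reindex[OF inj]) (simp add: case_prod_unfold)
  also have "\<dots> = (\<Sum>l\<in>?L. \<Sum>w\<in>words_from I G (I - {fst l}) N. word_weight b (l # w))"
    using fL fW by (subst sum.Sigma) auto
  also have "\<dots> = (\<Sum>(j, x)\<in>?L. b j x * (\<Sum>w\<in>words_from I G (I - {j}) N. word_weight b w))"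
    by (intro sum.cong) (auto simp: sum_distrib_left)
  also have "\<dots> = (\<Sum>j\<in>J. \<Sum>x\<in>punctured (G j). b j x * (\<Sum>w\<in>words_from I G (I - {j}) N. word_weight b w))"
    using fJ assms by (subst sum.Sigma) auto
  finally show ?thesis by (simp add: sum_distrib_right)
qed

text \<open>The bound is the fixed point of the recursion with equality in \<open>B\<close>. If F is
  the sum over all words, those not starting in factor j contribute F / (1 + B_j), so those starting
  in j contribute F B_j / (1 + B_j), whence F = 1 / (1 - \<beta>). Induction on the length
  reproduces this value.\<close>

lemma sum_words_from_le:
  fixes b :: "'i \<Rightarrow> 'a \<Rightarrow> real"
  assumes fin: "finite I" "\<And>i. i \<in> I \<Longrightarrow> finite (carrier (G i))"
    and b: "\<And>i x. 0 \<le> b i x"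
    and B: "\<And>i. i \<in> I \<Longrightarrow> (\<Sum>x\<in>punctured (G i). b i x) \<le> B i"
    and lt: "(\<Sum>i\<in>I. B i / (1 + B i)) < 1" and J: "J \<subseteq> I"
  shows "(\<Sum>w\<in>words_from I G J N. word_weight b w) \<le>
    1 + (\<Sum>j\<in>J. B j / (1 + B j)) / (1 - (\<Sum>i\<in>I. B i / (1 + B i)))"
  using J
proof (induction N arbitrary: J)
  have B0: "0 \<le> B i" if "i \<in> I" for i
    by (rule order_trans[OF sum_nonneg B[OF that]]) (rule b)
  define \<beta> where "\<beta> = (\<Sum>i\<in>I. B i / (1 + B i))"
  have \<beta>: "\<beta> < 1" using lt by (simp add: \<beta>_def)
  {
    case 0
    have "0 \<le> (\<Sum>j\<in>J. B j / (1 + B j))" using 0 B0 by (intro sum_nonneg divide_nonneg_nonneg) force+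
    then show ?case using lt by (simp add: words_from_0)
  next
    case (Suc N)
    have "(\<Sum>x\<in>punctured (G j). b j x) * (\<Sum>w\<in>words_from I G (I - {j}) N. word_weight b w)
        \<le> B j / (1 + B j) / (1 - \<beta>)" if "j \<in> J" for j
    proof -
      have j: "j \<in> I" using that Suc.prems by auto
      have "(\<Sum>x\<in>punctured (G j). b j x) * (\<Sum>w\<in>words_from I G (I - {j}) N. word_weight b w)
          \<le> B j * (1 + (\<Sum>i\<in>I - {j}. B i / (1 + B i)) / (1 - \<beta>))"
        unfolding \<beta>_def using Suc.IH[of "I - {j}"] B[OF j] B0[OF j]
        by (intro mult_mono) (auto intro!: sum_nonneg word_weight_nonneg b)
      also have "(\<Sum>i\<in>I - {j}. B i / (1 + B i)) = \<beta> - B j / (1 + B j)"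
        unfolding \<beta>_def using fin(1) j by (simp add: sum_diff1)
      also have "B j * (1 + (\<beta> - B j / (1 + B j)) / (1 - \<beta>)) = B j / (1 + B j) / (1 - \<beta>)"
      proof -
        have "1 + B j \<noteq> 0" "1 - \<beta> \<noteq> 0" using B0[OF j] \<beta> by auto
        then show ?thesis by (simp add: divide_simps) (simp add: algebra_simps)
      qed
      finally show ?thesis .
    qed
    moreover have "(\<Sum>w\<in>words_from I G J (Suc N). word_weight b w) =
        1 + (\<Sum>j\<in>J. (\<Sum>x\<in>punctured (G j). b j x) *
          (\<Sum>w\<in>words_from I G (I - {j}) N. word_weight b w))"
      by (intro sum_words_from_Suc fin Suc.prems)
    ultimately have "(\<Sum>w\<in>words_from I G J (Suc N). word_weight b w) \<le> 1 + (\<Sum>j\<in>J. B j / (1 + B j) / (1 - \<beta>))"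
      by (simp add: sum_mono)
    then show ?case by (simp add: \<beta>_def sum_divide_distrib)
  }
qed

lemma sum_reduced_words_le:
  fixes b :: "'i \<Rightarrow> 'a \<Rightarrow> real"
  assumes fin: "finite I" "\<And>i. i \<in> I \<Longrightarrow> finite (carrier (G i))"
    and b: "\<And>i x. 0 \<le> b i x"
    and B: "\<And>i. i \<in> I \<Longrightarrow> (\<Sum>x\<in>punctured (G i). b i x) \<le> B i"
    and lt: "(\<Sum>i\<in>I. B i / (1 + B i)) < 1" and X: "finite X" "X \<subseteq> reduced_words I G"
  shows "(\<Sum>w\<in>X. word_weight b w) \<le> 1 / (1 - (\<Sum>i\<in>I. B i / (1 + B i)))"
proof -
  define N where "N = Max (insert 0 (length ` X))"
  have "X \<subseteq> words_from I G I N"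
  proof
    fix w assume w: "w \<in> X"
    have "length w \<le> N" using X w by (auto simp: N_def)
    moreover have "w = [] \<or> fst (hd w) \<in> I"
      using w X by (cases w) (auto simp: reduced_words_def)
    ultimately show "w \<in> words_from I G I N" using w X by (auto simp: words_from_def)
  qed
  then have "(\<Sum>w\<in>X. word_weight b w) \<le> (\<Sum>w\<in>words_from I G I N. word_weight b w)"
    by (intro sum_mono2 finite_words_from fin word_weight_nonneg b) auto
  also have "\<dots> \<le> 1 + (\<Sum>i\<in>I. B i / (1 + B i)) / (1 - (\<Sum>i\<in>I. B i / (1 + B i)))"
    by (rule sum_words_from_le[OF fin b B lt]) auto
  also have "\<dots> = 1 / (1 - (\<Sum>i\<in>I. B i / (1 + B i)))" using lt by (simp add: field_simps)
  finally show ?thesis .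
qed

section \<open>Word length of a group element\<close>

context group
begin

lemma foldr_mult_closed: "set ws \<subseteq> carrier G \<Longrightarrow> foldr (mult G) ws \<one> \<in> carrier G"
  by (induction ws) auto

lemma foldr_mult_append:
  "set us \<subseteq> carrier G \<Longrightarrow> set ws \<subseteq> carrier G \<Longrightarrow>
    foldr (mult G) (us @ ws) \<one> = foldr (mult G) us \<one> \<otimes> foldr (mult G) ws \<one>"
  by (induction us) (auto simp: m_assoc foldr_mult_closed)

lemma generate_word:
  assumes T: "T \<subseteq> carrier G" and g: "g \<in> generate G T"
  shows "\<exists>ws. set ws \<subseteq> T \<union> m_inv G ` T \<and> g = foldr (mult G) ws \<one>"
  using g
proof induction
  case one
  show ?case by (intro exI[of _ "[]"]) auto
next
  case (incl h)
  then show ?case using T by (intro exI[of _ "[h]"]) auto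
next
  case (inv h)
  then show ?case using T by (intro exI[of _ "[inv h]"]) auto
next
  case (eng h1 h2)
  then obtain us ws where "set us \<subseteq> T \<union> m_inv G ` T" "h1 = foldr (mult G) us \<one>"
    "set ws \<subseteq> T \<union> m_inv G ` T" "h2 = foldr (mult G) ws \<one>" by blast
  moreover have "T \<union> m_inv G ` T \<subseteq> carrier G" using T by auto
  ultimately show ?case
    by (intro exI[of _ "us @ ws"]) (metis Un_least foldr_mult_append set_append subset_trans)
qed

lemma word_length_attained:
  assumes T: "finite_generating_set G T" and g: "g \<in> carrier G"
  obtains ws where "length ws = word_length G T g" "set ws \<subseteq> T \<union> m_inv G ` T" "g = foldr (mult G) ws \<one>"
proof -
  have "\<exists>n ws. length ws = n \<and> set ws \<subseteq> T \<union> m_inv G ` T \<and> g = foldr (mult G) ws \<one>"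
    using generate_word[of T g] T g by (auto simp: finite_generating_set_def)
  from LeastI_ex[OF this] show ?thesis unfolding word_length_def[symmetric] using that by blast
qed

lemma word_length_le:
  "set ws \<subseteq> T \<union> m_inv G ` T \<Longrightarrow> g = foldr (mult G) ws \<one> \<Longrightarrow> word_length G T g \<le> length ws"
  unfolding word_length_def by (rule Least_le) blast

lemma word_length_one: "word_length G T \<one> = 0"
  using word_length_le[of "[]" T \<one>] by simp

lemma word_length_mult:
  assumes T: "finite_generating_set G T" and "g \<in> carrier G" "h \<in> carrier G"
  shows "word_length G T (g \<otimes> h) \<le> word_length G T g + word_length G T h"
proof -
  obtain us where us: "length us = word_length G T g" "set us \<subseteq> T \<union> m_inv G ` T" "g = foldr (mult G) us \<one>"
    by (rule word_length_attained[OF T assms(2)])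
  obtain ws where ws: "length ws = word_length G T h" "set ws \<subseteq> T \<union> m_inv G ` T" "h = foldr (mult G) ws \<one>"
    by (rule word_length_attained[OF T assms(3)])
  have "T \<union> m_inv G ` T \<subseteq> carrier G" using T by (auto simp: finite_generating_set_def)
  then have "g \<otimes> h = foldr (mult G) (us @ ws) \<one>" using us ws by (metis foldr_mult_append subset_trans)
  then have "word_length G T (g \<otimes> h) \<le> length (us @ ws)" using us ws by (intro word_length_le) auto
  then show ?thesis using us ws by simp
qed

end

section \<open>Operators on a free product assembled from the factors\<close>

lemma inv_eq_one_iff: "group G \<Longrightarrow> x \<in> carrier G \<Longrightarrow> inv\<^bsub>G\<^esub> x = \<one>\<^bsub>G\<^esub> \<longleftrightarrow> x = \<one>\<^bsub>G\<^esub>"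
  using group.inv_inv group.inv_inj by (metis group.is_monoid monoid.inv_one)

lemma free_product_inv_Nil:
  assumes "\<And>i. i \<in> I \<Longrightarrow> group (G i)" shows "inv\<^bsub>free_product I G\<^esub> [] = []"
  using monoid.inv_one[OF group.is_monoid[OF group_free_product[OF assms]]] by (simp add: free_product_def)

lemma free_product_inv_letter:
  assumes grp: "\<And>i. i \<in> I \<Longrightarrow> group (G i)" and x: "i \<in> I" "x \<in> carrier (G i)" "x \<noteq> \<one>\<^bsub>G i\<^esub>"
  shows "inv\<^bsub>free_product I G\<^esub> [(i, x)] = [(i, inv\<^bsub>G i\<^esub> x)]"
proof -
  interpret G: group "G i" by (rule grp[OF x(1)])
  interpret group "free_product I G" by (rule group_free_product[OF grp])
  have "inv\<^bsub>G i\<^esub> x \<noteq> \<one>\<^bsub>G i\<^esub>" using inv_eq_one_iff[OF grp[OF x(1)] x(2)] x(3) by simp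
  then show ?thesis using x
    by (intro inv_equality) (auto simp: free_product_def reduced_words_Cons)
qed

text \<open>Here \<open>p\<close> is the sum of the images of group algebra elements
  \<open>q i\<close> of the factors. The units of all factors are identified, so only the sum of the
  coefficients there is prescribed and its distribution is free.\<close>

locale free_product_operator =
  fixes I :: "'i set" and \<Gamma> :: "'i \<Rightarrow> ('a, 'b) monoid_scheme"
    and p :: "('i \<times> 'a) list \<Rightarrow> complex" and q :: "'i \<Rightarrow> 'a \<Rightarrow> complex"
  assumes fin_I: "finite I" and grp: "\<And>i. i \<in> I \<Longrightarrow> group (\<Gamma> i)"
    and fin: "\<And>i. i \<in> I \<Longrightarrow> finite (carrier (\<Gamma> i))"
    and q_inv: "\<And>i x. i \<in> I \<Longrightarrow> x \<in> carrier (\<Gamma> i) \<Longrightarrow> q i (inv\<^bsub>\<Gamma> i\<^esub> x) = cnj (q i x)"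
    and q_nontrivial: "\<And>i. i \<in> I \<Longrightarrow> \<exists>x\<in>punctured (\<Gamma> i). q i x \<noteq> 0"
    and p_one: "p [] = (\<Sum>i\<in>I. q i \<one>\<^bsub>\<Gamma> i\<^esub>)"
    and p_letter: "\<And>i x. i \<in> I \<Longrightarrow> x \<in> carrier (\<Gamma> i) \<Longrightarrow> x \<noteq> \<one>\<^bsub>\<Gamma> i\<^esub> \<Longrightarrow> p [(i, x)] = q i x"
    and p_supp: "supp p \<subseteq> insert [] ((\<lambda>l. [l]) ` Sigma I (\<lambda>i. punctured (\<Gamma> i)))"
begin

abbreviation "FP \<equiv> free_product I \<Gamma>"
abbreviation "W \<equiv> reduced_words I \<Gamma>"
abbreviation "letters \<equiv> (\<lambda>l. [l]) ` Sigma I (\<lambda>i. punctured (\<Gamma> i))"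

lemma FP_simps [simp]: "carrier FP = W" "\<one>\<^bsub>FP\<^esub> = []"
  by (simp_all add: free_product_def)

lemma FP_mult: "u \<otimes>\<^bsub>FP\<^esub> v = foldr (letter_mult \<Gamma>) u v"
  by (simp add: free_product_def)

lemma group_FP: "group FP"
  by (rule group_free_product[OF grp])

lemma letter_in_W: "i \<in> I \<Longrightarrow> x \<in> carrier (\<Gamma> i) \<Longrightarrow> x \<noteq> \<one>\<^bsub>\<Gamma> i\<^esub> \<Longrightarrow> [(i, x)] \<in> W"
  by (simp add: reduced_words_Cons)

lemma finite_letters: "finite letters"
  using fin_I fin by (intro finite_imageI finite_SigmaI) auto

lemmas inv_one_iff = inv_eq_one_iff[OF grp]

lemma inv_Nil: "inv\<^bsub>FP\<^esub> [] = []"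
  by (rule free_product_inv_Nil[OF grp])

lemma inv_letter:
  "i \<in> I \<Longrightarrow> x \<in> carrier (\<Gamma> i) \<Longrightarrow> x \<noteq> \<one>\<^bsub>\<Gamma> i\<^esub> \<Longrightarrow> inv\<^bsub>FP\<^esub> [(i, x)] = [(i, inv\<^bsub>\<Gamma> i\<^esub> x)]"
  by (rule free_product_inv_letter[OF grp])

lemma hermitian: "hermitian_element FP p"
proof -
  interpret group FP by (rule group_FP)
  have "supp p \<subseteq> W" using p_supp letter_in_W by fastforce
  moreover have "finite (supp p)" by (rule finite_subset[OF p_supp]) (use finite_letters in simp)
  ultimately have alg: "p \<in> group_algebra FP" by (simp add: group_algebra_def)
  have "p w = galg_star FP p w" for w
  proof (cases "w \<in> W")
    case False
    then show ?thesis using \<open>supp p \<subseteq> W\<close> by (auto simp: galg_star_def supp_def)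
  next
    case True
    have star: "galg_star FP p w = cnj (p (inv\<^bsub>FP\<^esub> w))" using True by (simp add: galg_star_def)
    have letter: "p (inv\<^bsub>FP\<^esub> u) = cnj (p u)" if uL: "u \<in> insert [] letters" for u
    proof (cases "u = []")
      case True
      have "inv\<^bsub>\<Gamma> i\<^esub> \<one>\<^bsub>\<Gamma> i\<^esub> = \<one>\<^bsub>\<Gamma> i\<^esub>" if "i \<in> I" for i
        using inv_one_iff[OF that] group.is_monoid[OF grp[OF that]] by (simp add: monoid.one_closed)
      then have "q i \<one>\<^bsub>\<Gamma> i\<^esub> = cnj (q i \<one>\<^bsub>\<Gamma> i\<^esub>)" if "i \<in> I" for i
        using q_inv[OF that, of "\<one>\<^bsub>\<Gamma> i\<^esub>"] group.is_monoid[OF grp[OF that]] that by (simp add: monoid.one_closed)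
      then have "p [] = cnj (p [])" unfolding p_one by (simp only: cnj_sum cong: sum.cong)
      then show ?thesis using True inv_Nil by simp
    next
      case False
      then obtain i x where u: "u = [(i, x)]" "i \<in> I" "x \<in> carrier (\<Gamma> i)" "x \<noteq> \<one>\<^bsub>\<Gamma> i\<^esub>" using uL by blast
      interpret G: group "\<Gamma> i" by (rule grp[OF u(2)])
      show ?thesis using u inv_one_iff[OF u(2,3)] by (simp add: inv_letter p_letter q_inv)
    qed
    show ?thesis
    proof (cases "w \<in> insert [] letters \<or> inv\<^bsub>FP\<^esub> w \<in> insert [] letters")
      case True
      then show ?thesis
      proof
        assume "w \<in> insert [] letters"
        then show ?thesis using letter star by simp
      next
        assume "inv\<^bsub>FP\<^esub> w \<in> insert [] letters"
        from letter[OF this] show ?thesis using star \<open>w \<in> W\<close> by simp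
      qed
    next
      case False
      then have "p w = 0" "p (inv\<^bsub>FP\<^esub> w) = 0" using p_supp unfolding supp_def by blast+
      then show ?thesis using star by simp
    qed
  qed
  then have "p = galg_star FP p" by auto
  then show ?thesis using alg group_FP by (simp add: hermitian_element_def hermitian_element_axioms_def)
qed

sublocale hermitian_element FP p
  by (rule hermitian)

text \<open>On the right the empty word occurs once for each factor; \<open>p_one\<close> accounts
  for exactly these repetitions.\<close>

lemma sum_p:
  fixes \<phi> :: "('i \<times> 'a) list \<Rightarrow> complex"
  shows "(\<Sum>g\<in>supp p. p g * \<phi> g) = (\<Sum>i\<in>I. \<Sum>x\<in>carrier (\<Gamma> i). q i x * \<phi> (fp_embed \<Gamma> i x))"
proof -
  have one: "\<one>\<^bsub>\<Gamma> i\<^esub> \<in> carrier (\<Gamma> i)" if "i \<in> I" for i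
    using group.is_monoid[OF grp[OF that]] by (rule monoid.one_closed)
  have "(\<Sum>g\<in>supp p. p g * \<phi> g) = (\<Sum>g\<in>insert [] letters. p g * \<phi> g)"
    using p_supp finite_letters by (intro sum.mono_neutral_left) (auto simp: supp_def)
  also have "\<dots> = p [] * \<phi> [] + (\<Sum>g\<in>letters. p g * \<phi> g)"
    using finite_letters by (subst sum.insert) auto
  also have "(\<Sum>g\<in>letters. p g * \<phi> g) = (\<Sum>l\<in>Sigma I (\<lambda>i. punctured (\<Gamma> i)). p [l] * \<phi> [l])"
    by (subst sum.reindex) (auto simp: inj_on_def)
  also have "\<dots> = (\<Sum>i\<in>I. \<Sum>x\<in>punctured (\<Gamma> i). p [(i, x)] * \<phi> [(i, x)])"
    using fin_I fin by (subst sum.Sigma) (auto simp: case_prod_unfold)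
  also have "\<dots> = (\<Sum>i\<in>I. \<Sum>x\<in>punctured (\<Gamma> i). q i x * \<phi> (fp_embed \<Gamma> i x))"
    by (intro sum.cong) (auto simp: p_letter fp_embed_def)
  also have "p [] * \<phi> [] = (\<Sum>i\<in>I. q i \<one>\<^bsub>\<Gamma> i\<^esub> * \<phi> (fp_embed \<Gamma> i \<one>\<^bsub>\<Gamma> i\<^esub>))"
    by (simp add: p_one sum_distrib_right fp_embed_def)
  finally have "(\<Sum>g\<in>supp p. p g * \<phi> g) = (\<Sum>i\<in>I. q i \<one>\<^bsub>\<Gamma> i\<^esub> * \<phi> (fp_embed \<Gamma> i \<one>\<^bsub>\<Gamma> i\<^esub>) +
      (\<Sum>x\<in>punctured (\<Gamma> i). q i x * \<phi> (fp_embed \<Gamma> i x)))"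
    by (simp only: sum.distrib)
  also have "\<dots> = (\<Sum>i\<in>I. \<Sum>x\<in>carrier (\<Gamma> i). q i x * \<phi> (fp_embed \<Gamma> i x))"
    by (intro sum.cong refl sum.remove[symmetric] fin one)
  finally show ?thesis .
qed

lemma inv_embed_mult:
  assumes "i \<in> I" "x \<in> carrier (\<Gamma> i)" "w \<in> W"
  shows "inv\<^bsub>FP\<^esub> (fp_embed \<Gamma> i x) \<otimes>\<^bsub>FP\<^esub> w = letter_mult \<Gamma> (i, inv\<^bsub>\<Gamma> i\<^esub> x) w"
proof (cases "x = \<one>\<^bsub>\<Gamma> i\<^esub>")
  case True
  show ?thesis using True inv_Nil inv_one_iff[OF assms(1,2)] by (simp add: fp_embed_def FP_mult letter_mult_one)
next
  case False
  then show ?thesis using assms by (simp add: fp_embed_def inv_letter FP_mult)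
qed

lemma P_eq:
  assumes "w \<in> W"
  shows "P f w = (\<Sum>i\<in>I. \<Sum>x\<in>carrier (\<Gamma> i). q i x * f (letter_mult \<Gamma> (i, inv\<^bsub>\<Gamma> i\<^esub> x) w))"
proof -
  have "P f w = (\<Sum>g\<in>supp p. p g * f (inv\<^bsub>FP\<^esub> g \<otimes>\<^bsub>FP\<^esub> w))"
    using assms by (simp add: left_regular_def left_translation_def)
  also have "\<dots> = (\<Sum>i\<in>I. \<Sum>x\<in>carrier (\<Gamma> i). q i x * f (inv\<^bsub>FP\<^esub> (fp_embed \<Gamma> i x) \<otimes>\<^bsub>FP\<^esub> w))"
    by (rule sum_p)
  also have "\<dots> = (\<Sum>i\<in>I. \<Sum>x\<in>carrier (\<Gamma> i). q i x * f (letter_mult \<Gamma> (i, inv\<^bsub>\<Gamma> i\<^esub> x) w))"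
    using assms by (intro sum.cong refl) (simp add: inv_embed_mult)
  finally show ?thesis .
qed

definition product_function :: "complex \<Rightarrow> ('i \<Rightarrow> 'a \<Rightarrow> complex) \<Rightarrow> ('i \<times> 'a) list \<Rightarrow> complex" where
  "product_function r F w = (if w \<in> W then r * word_weight F w else 0)"

text \<open>At a word starting in factor j, the part of \<open>P\<close> from factor j only changes
  the first letter and acts as \<zeta>_j. Every other factor prepends a letter and acts as \<zeta>_i
  + 1 / r. The total is z. At the empty word all factors prepend, and the surplus 1 / r times the
  value r is the delta function.\<close>

lemma product_function_eq:
  assumes F1: "\<And>i. i \<in> I \<Longrightarrow> F i \<one>\<^bsub>\<Gamma> i\<^esub> = 1"
    and FP: "\<And>i x. i \<in> I \<Longrightarrow> x \<in> carrier (\<Gamma> i) \<Longrightarrow>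
      (\<Sum>y\<in>carrier (\<Gamma> i). q i y * F i (inv\<^bsub>\<Gamma> i\<^esub> y \<otimes>\<^bsub>\<Gamma> i\<^esub> x)) = \<zeta> i * F i x + (if x = \<one>\<^bsub>\<Gamma> i\<^esub> then 1 / r else 0)"
    and z: "(\<Sum>i\<in>I. \<zeta> i) = z - (of_nat (card I) - 1) / r" and r: "r \<noteq> 0"
  shows "P (product_function r F) w - z * product_function r F w = delta [] w"
proof (cases "w \<in> W")
  case False
  then show ?thesis by (auto simp: product_function_def left_regular_def left_translation_def delta_def indicator_def)
next
  case w: True
  define \<psi> where "\<psi> = product_function r F"
  have new: "(\<Sum>x\<in>carrier (\<Gamma> i). q i x * \<psi> (letter_mult \<Gamma> (i, inv\<^bsub>\<Gamma> i\<^esub> x) w)) = (\<zeta> i + 1 / r) * \<psi> w"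
    if i: "i \<in> I" and hd: "w = [] \<or> fst (hd w) \<noteq> i" for i
  proof -
    interpret G: group "\<Gamma> i" by (rule grp[OF i])
    have "\<psi> (letter_mult \<Gamma> (i, y) w) = F i y * \<psi> w" if y: "y \<in> carrier (\<Gamma> i)" for y
    proof (cases "y = \<one>\<^bsub>\<Gamma> i\<^esub>")
      case True
      then show ?thesis using F1[OF i] by (simp add: letter_mult_one)
    next
      case False
      then have "(i, y) # w \<in> W" using w i y hd by (simp add: reduced_words_Cons)
      then show ?thesis using w by (simp add: letter_mult_reduced[OF \<open>(i, y) # w \<in> W\<close>] \<psi>_def product_function_def)
    qed
    then have "(\<Sum>x\<in>carrier (\<Gamma> i). q i x * \<psi> (letter_mult \<Gamma> (i, inv\<^bsub>\<Gamma> i\<^esub> x) w)) =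
        (\<Sum>x\<in>carrier (\<Gamma> i). q i x * F i (inv\<^bsub>\<Gamma> i\<^esub> x \<otimes>\<^bsub>\<Gamma> i\<^esub> \<one>\<^bsub>\<Gamma> i\<^esub>)) * \<psi> w"
      unfolding sum_distrib_right by (intro sum.cong) auto
    then show ?thesis using FP[OF i, of "\<one>\<^bsub>\<Gamma> i\<^esub>"] F1[OF i] by simp
  qed
  \<comment> \<open>There are \<open>card I\<close> copies of 1 / r against
    \<open>card I - 1\<close> in the relation for the \<zeta>_i, so one is left over.\<close>
  have total: "(\<Sum>i\<in>I. \<zeta> i + 1 / r) = z + 1 / r"
    unfolding sum.distrib z by (simp add: diff_divide_distrib)
  show ?thesis
  proof (cases w)
    case Nil
    have "P \<psi> w = (\<Sum>i\<in>I. (\<zeta> i + 1 / r) * \<psi> w)"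
      unfolding P_eq[OF w] using new Nil by (intro sum.cong) auto
    also have "\<dots> = (z + 1 / r) * \<psi> w" by (simp only: sum_distrib_right[symmetric] total)
    also have "\<psi> w = r" by (simp add: Nil \<psi>_def product_function_def)
    finally show ?thesis using r by (simp add: Nil \<psi>_def[symmetric] delta_def algebra_simps)
      (simp add: Nil \<psi>_def product_function_def)
  next
    case (Cons l w')
    obtain j a where l: "l = (j, a)" by (cases l)
    have wj: "j \<in> I" "a \<in> carrier (\<Gamma> j)" "a \<noteq> \<one>\<^bsub>\<Gamma> j\<^esub>" "w' \<in> W" "w' = [] \<or> fst (hd w') \<noteq> j"
      using w unfolding Cons l by (auto simp: reduced_words_Cons)
    interpret G: group "\<Gamma> j" by (rule grp[OF wj(1)])
    have "\<psi> (letter_mult \<Gamma> (j, y) w) = F j (y \<otimes>\<^bsub>\<Gamma> j\<^esub> a) * \<psi> w'" if y: "y \<in> carrier (\<Gamma> j)" for y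
    proof (cases "y \<otimes>\<^bsub>\<Gamma> j\<^esub> a = \<one>\<^bsub>\<Gamma> j\<^esub>")
      case True
      then have "y \<noteq> \<one>\<^bsub>\<Gamma> j\<^esub>" using wj by auto
      then show ?thesis using True F1[OF wj(1)] by (simp add: Cons l)
    next
      case False
      then have "(j, y \<otimes>\<^bsub>\<Gamma> j\<^esub> a) # w' \<in> W" using wj y by (simp add: reduced_words_Cons)
      moreover have "letter_mult \<Gamma> (j, y) w = (j, y \<otimes>\<^bsub>\<Gamma> j\<^esub> a) # w'" using False wj by (simp add: Cons l)
      ultimately show ?thesis using wj(4) by (simp add: \<psi>_def product_function_def)
    qed
    then have "(\<Sum>x\<in>carrier (\<Gamma> j). q j x * \<psi> (letter_mult \<Gamma> (j, inv\<^bsub>\<Gamma> j\<^esub> x) w)) =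
        (\<Sum>x\<in>carrier (\<Gamma> j). q j x * F j (inv\<^bsub>\<Gamma> j\<^esub> x \<otimes>\<^bsub>\<Gamma> j\<^esub> a)) * \<psi> w'"
      unfolding sum_distrib_right by (intro sum.cong) auto
    also have "\<dots> = \<zeta> j * \<psi> w"
      using FP[OF wj(1,2)] wj(3,4) w by (simp add: Cons l \<psi>_def product_function_def)
    finally have old: "(\<Sum>x\<in>carrier (\<Gamma> j). q j x * \<psi> (letter_mult \<Gamma> (j, inv\<^bsub>\<Gamma> j\<^esub> x) w)) = \<zeta> j * \<psi> w" .
    have "P \<psi> w = \<zeta> j * \<psi> w + (\<Sum>i\<in>I - {j}. (\<zeta> i + 1 / r) * \<psi> w)"
      unfolding P_eq[OF w] sum.remove[OF fin_I wj(1)] old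
      using new by (intro arg_cong2[of _ _ _ _ "(+)"] sum.cong) (auto simp: Cons l)
    also have "\<dots> = (\<zeta> j + (\<Sum>i\<in>I - {j}. \<zeta> i + 1 / r)) * \<psi> w"
      by (simp add: sum_distrib_right distrib_right)
    also have "\<zeta> j + (\<Sum>i\<in>I - {j}. \<zeta> i + 1 / r) = z"
      using total unfolding sum.remove[OF fin_I wj(1)] by simp
    finally show ?thesis by (simp add: \<psi>_def Cons delta_def)
  qed
qed

lemma product_function_l2:
  assumes lt: "(\<Sum>i\<in>I. A i / (1 + A i)) < 1"
    and A: "\<And>i. i \<in> I \<Longrightarrow> (\<Sum>x\<in>punctured (\<Gamma> i). (cmod (F i x))\<^sup>2) \<le> A i"
  shows "product_function r F \<in> l2 W"
proof -
  have "(\<Sum>w\<in>X. (cmod (product_function r F w))\<^sup>2) \<le> (cmod r)\<^sup>2 * (1 / (1 - (\<Sum>i\<in>I. A i / (1 + A i))))"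
    if X: "finite X" "X \<subseteq> W" for X
  proof -
    have "(\<Sum>w\<in>X. (cmod (product_function r F w))\<^sup>2) = (\<Sum>w\<in>X. (cmod r)\<^sup>2 * word_weight (\<lambda>i x. 1 * cmod (F i x) ^ 2) w)"
      unfolding word_weight_cmod_power using X
      by (intro sum.cong) (auto simp: product_function_def norm_mult power_mult_distrib)
    also have "\<dots> \<le> (cmod r)\<^sup>2 * (1 / (1 - (\<Sum>i\<in>I. A i / (1 + A i))))"
      unfolding sum_distrib_left[symmetric]
      using A X fin by (intro mult_left_mono sum_reduced_words_le fin_I lt) auto
    finally show ?thesis .
  qed
  then have "(\<lambda>w. (cmod (product_function r F w))\<^sup>2) summable_on W"
    by (intro nonneg_bdd_above_summable_on) (auto intro!: bdd_aboveI)
  then show ?thesis by (simp add: l2_def product_function_def)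
qed

text \<open>There are finitely many letters, so their lengths with respect to an arbitrary finite
  generating set are bounded, and word length is subadditive. The estimate for inverses serves the
  half of the fourth-power sum that runs over inverse words.\<close>

lemma word_length_le_syllables:
  assumes T: "finite_generating_set FP T"
  obtains L :: real where "L \<ge> 1" "\<And>w. w \<in> W \<Longrightarrow> real (word_length FP T w) \<le> L * real (length w)"
    "\<And>w. w \<in> W \<Longrightarrow> real (word_length FP T (inv\<^bsub>FP\<^esub> w)) \<le> L * real (length w)"
proof -
  define L where "L = Max (insert 1 ((\<lambda>u. max (word_length FP T u) (word_length FP T (inv\<^bsub>FP\<^esub> u))) ` letters))"
  have fS: "finite (insert 1 ((\<lambda>u. max (word_length FP T u) (word_length FP T (inv\<^bsub>FP\<^esub> u))) ` letters))"
    using finite_letters by simp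
  have L1: "1 \<le> L" unfolding L_def by (rule Max_ge[OF fS]) simp
  have L: "word_length FP T u \<le> L" "word_length FP T (inv\<^bsub>FP\<^esub> u) \<le> L" if "u \<in> letters" for u
  proof -
    have "max (word_length FP T u) (word_length FP T (inv\<^bsub>FP\<^esub> u)) \<le> L"
      unfolding L_def by (rule Max_ge[OF fS]) (use that in simp)
    then show "word_length FP T u \<le> L" "word_length FP T (inv\<^bsub>FP\<^esub> u) \<le> L" by auto
  qed
  have "word_length FP T w \<le> L * length w \<and> word_length FP T (inv\<^bsub>FP\<^esub> w) \<le> L * length w" if "w \<in> W" for w
    using that
  proof (induction w)
    case Nil
    show ?case using inv_Nil word_length_one[of T] by simp
  next
    case (Cons l w)
    obtain i x where l: "l = (i, x)" by (cases l)
    have w: "w \<in> W" and lW: "[l] \<in> W" and ll: "[l] \<in> letters"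
      using Cons.prems by (auto simp: l reduced_words_Cons)
    have eq: "l # w = [l] \<otimes>\<^bsub>FP\<^esub> w"
      using letter_mult_reduced[of i x w I \<Gamma>] Cons.prems by (simp add: FP_mult l)
    have inv_eq: "inv\<^bsub>FP\<^esub> (l # w) = inv\<^bsub>FP\<^esub> w \<otimes>\<^bsub>FP\<^esub> inv\<^bsub>FP\<^esub> [l]"
      unfolding eq using w lW by (intro inv_mult_group) auto
    have "word_length FP T (l # w) \<le> word_length FP T [l] + word_length FP T w"
      unfolding eq using w lW by (intro word_length_mult[OF T]) auto
    moreover have "word_length FP T (inv\<^bsub>FP\<^esub> (l # w)) \<le> word_length FP T (inv\<^bsub>FP\<^esub> w) + word_length FP T (inv\<^bsub>FP\<^esub> [l])"
      unfolding inv_eq using w lW by (intro word_length_mult[OF T] inv_closed) auto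
    ultimately show ?case using L[OF ll] Cons.IH[OF w] by simp
  qed
  then have "real (word_length FP T w) \<le> real (L * length w) \<and> real (word_length FP T (inv\<^bsub>FP\<^esub> w)) \<le> real (L * length w)"
    if "w \<in> W" for w using that by (simp only: of_nat_le_iff)
  then show ?thesis using L1 by (intro that[of "real L"]) auto
qed

end

section \<open>The resolvent as a product over syllables\<close>

text \<open>The resolvent of the factor applied to the indicator of the unit, written in spectral
  components.\<close>

definition factor_res :: "real set \<Rightarrow> (real \<Rightarrow> 'x \<Rightarrow> complex) \<Rightarrow> complex \<Rightarrow> 'x \<Rightarrow> complex" where
  "factor_res \<Lambda> v \<zeta> x = (\<Sum>\<kappa>\<in>\<Lambda>. 1 / (of_real \<kappa> - \<zeta>) * v \<kappa> x)"

lemma spectral_resolutionD: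
  assumes "spectral_resolution X a e \<Lambda> v w"
  shows "finite \<Lambda>" "\<And>\<kappa> x. \<kappa> \<in> \<Lambda> \<Longrightarrow> x \<in> X \<Longrightarrow> kernel_op X a (v \<kappa>) x = of_real \<kappa> * v \<kappa> x"
    "\<And>x. x \<in> X \<Longrightarrow> (\<Sum>\<kappa>\<in>\<Lambda>. v \<kappa> x) = of_bool (x = e)"
    "\<And>\<kappa>. \<kappa> \<in> \<Lambda> \<Longrightarrow> v \<kappa> e = of_real (w \<kappa>)" "\<And>\<kappa>. \<kappa> \<in> \<Lambda> \<Longrightarrow> 0 < w \<kappa>"
  using assms by (auto simp: spectral_resolution_def)

lemma factor_res_eq:
  assumes sr: "spectral_resolution X a e \<Lambda> v w" and \<zeta>: "Im \<zeta> \<noteq> 0" and x: "x \<in> X"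
  shows "kernel_op X a (factor_res \<Lambda> v \<zeta>) x = \<zeta> * factor_res \<Lambda> v \<zeta> x + of_bool (x = e)"
proof -
  have "kernel_op X a (factor_res \<Lambda> v \<zeta>) x = (\<Sum>\<kappa>\<in>\<Lambda>. 1 / (of_real \<kappa> - \<zeta>) * kernel_op X a (v \<kappa>) x)"
    unfolding factor_res_def[abs_def] kernel_op_sum kernel_op_scale ..
  also have "\<dots> = (\<Sum>\<kappa>\<in>\<Lambda>. \<zeta> * (1 / (of_real \<kappa> - \<zeta>) * v \<kappa> x) + v \<kappa> x)"
  proof (intro sum.cong refl)
    fix \<kappa> assume \<kappa>: "\<kappa> \<in> \<Lambda>"
    have "of_real \<kappa> - \<zeta> \<noteq> 0" using \<zeta> by (auto simp: complex_eq_iff)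
    then have "1 / (of_real \<kappa> - \<zeta>) * of_real \<kappa> = \<zeta> * (1 / (of_real \<kappa> - \<zeta>)) + 1"
      by (simp add: divide_simps)
    then have "1 / (of_real \<kappa> - \<zeta>) * of_real \<kappa> * v \<kappa> x = (\<zeta> * (1 / (of_real \<kappa> - \<zeta>)) + 1) * v \<kappa> x"
      by (rule arg_cong)
    then show "1 / (of_real \<kappa> - \<zeta>) * kernel_op X a (v \<kappa>) x = \<zeta> * (1 / (of_real \<kappa> - \<zeta>) * v \<kappa> x) + v \<kappa> x"
      unfolding spectral_resolutionD(2)[OF sr \<kappa> x] by (simp only: mult.assoc distrib_right mult_1)
  qed
  finally show ?thesis
    by (simp only: sum.distrib sum_distrib_left[symmetric] spectral_resolutionD(3)[OF sr x] factor_res_def[symmetric])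
qed

lemma factor_res_base:
  assumes sr: "spectral_resolution X a e \<Lambda> v w"
  shows "factor_res \<Lambda> v \<zeta> e = (\<Sum>\<kappa>\<in>\<Lambda>. of_real (w \<kappa>) / (of_real \<kappa> - \<zeta>))"
  unfolding factor_res_def using spectral_resolutionD(4)[OF sr] by (intro sum.cong) auto

text \<open>The Ward identity on a finite factor: pair the resolvent equation with its own solution
  and take imaginary parts; the self-adjoint form drops out.\<close>

lemma factor_res_norm:
  assumes sr: "spectral_resolution X a e \<Lambda> v w" and \<zeta>: "Im \<zeta> \<noteq> 0" and X: "finite X" "e \<in> X"
    and herm: "\<And>x y. x \<in> X \<Longrightarrow> y \<in> X \<Longrightarrow> a y x = cnj (a x y)"
  shows "Im \<zeta> * (\<Sum>x\<in>X. (cmod (factor_res \<Lambda> v \<zeta> x))\<^sup>2) = Im (factor_res \<Lambda> v \<zeta> e)"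
proof -
  define R where "R = factor_res \<Lambda> v \<zeta>"
  define s where "s = (\<Sum>x\<in>X. cnj (R x) * kernel_op X a R x)"
  have "s = (\<Sum>x\<in>X. cnj (kernel_op X a R x) * R x)"
    unfolding s_def by (rule kernel_op_self_adjoint[OF herm])
  also have "\<dots> = cnj s" by (simp add: s_def mult.commute)
  finally have "Im s = 0" by (simp add: complex_eq_iff)
  have "s = (\<Sum>x\<in>X. \<zeta> * (cnj (R x) * R x) + (if x = e then cnj (R x) else 0))"
    unfolding s_def R_def by (intro sum.cong refl) (simp add: factor_res_eq[OF sr \<zeta>] algebra_simps)
  also have "\<dots> = \<zeta> * (\<Sum>x\<in>X. cnj (R x) * R x) + cnj (R e)"
    using X by (simp add: sum.distrib sum_distrib_left)
  finally have "s = \<zeta> * of_real (\<Sum>x\<in>X. (cmod (R x))\<^sup>2) + cnj (R e)" unfolding sum_cnj_mult_self .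
  then have "Im s = Im \<zeta> * (\<Sum>x\<in>X. (cmod (R x))\<^sup>2) - Im (R e)" by simp
  then show ?thesis using \<open>Im s = 0\<close> by (simp add: R_def)
qed

text \<open>A single atom would make the indicator of \<open>e\<close> an eigenvector, which a
  non-zero kernel entry from \<open>e\<close> to another point excludes.\<close>

lemma spectral_resolution_prob_weights:
  assumes sr: "spectral_resolution X a e \<Lambda> v w" and X: "finite X" "e \<in> X"
    and nt: "x \<in> X" "x \<noteq> e" "a x e \<noteq> 0"
  shows "prob_weights \<Lambda> w"
  unfolding prob_weights_def
proof (intro conjI ballI)
  show "finite \<Lambda>" by (rule spectral_resolutionD(1)[OF sr])
  show "0 < w \<kappa>" if "\<kappa> \<in> \<Lambda>" for \<kappa> by (rule spectral_resolutionD(5)[OF sr that])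
  have "of_real (sum w \<Lambda>) = (\<Sum>\<kappa>\<in>\<Lambda>. v \<kappa> e)"
    using spectral_resolutionD(4)[OF sr] by simp
  also have "\<dots> = 1" using spectral_resolutionD(3)[OF sr X(2)] by simp
  finally have "complex_of_real (sum w \<Lambda>) = of_real 1" by simp
  then show s1: "sum w \<Lambda> = 1" by (simp only: of_real_eq_iff)
  show "2 \<le> card \<Lambda>"
  proof (rule ccontr)
    assume "\<not> 2 \<le> card \<Lambda>"
    moreover have "card \<Lambda> \<noteq> 0" using s1 spectral_resolutionD(1)[OF sr] by auto
    ultimately have "card \<Lambda> = 1" by linarith
    then obtain \<kappa> where \<Lambda>: "\<Lambda> = {\<kappa>}" by (auto simp: card_1_singleton_iff)
    have v: "v \<kappa> y = of_bool (y = e)" if "y \<in> X" for y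
      using spectral_resolutionD(3)[OF sr that] by (simp add: \<Lambda>)
    have "kernel_op X a (v \<kappa>) x = (\<Sum>y\<in>X. if y = e then a x e else 0)"
      unfolding kernel_op_def using v by (intro sum.cong) auto
    also have "\<dots> = a x e" using X by simp
    finally show False
      using spectral_resolutionD(2)[OF sr _ nt(1), of \<kappa>] v[OF nt(1)] nt by (simp add: \<Lambda>)
  qed
qed

text \<open>The Ward identity in each factor says 1 / (1 + A_i) = |r|^2 Im(\<zeta>_i) / Im r. It
  remains to sum and to insert the imaginary part of the relation for the \<zeta>_i, using Im(-1 /
  r) = Im r / |r|^2.\<close>

lemma sum_ratio_eq:
  assumes fin: "finite I" and r: "Im r > 0"
    and A: "\<And>i. i \<in> I \<Longrightarrow> Im (\<zeta> i) > 0 \<and> Im (\<zeta> i) * ((cmod r)\<^sup>2 * (1 + A i)) = Im r"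
    and sum: "(\<Sum>i\<in>I. \<zeta> i) = z - (of_nat (card I) - 1) / r"
  shows "(\<Sum>i\<in>I. A i / (1 + A i)) = 1 - (cmod r)\<^sup>2 * Im z / Im r"
proof -
  have r0: "(cmod r)\<^sup>2 > 0" using r by auto
  have "A i / (1 + A i) = 1 - (cmod r)\<^sup>2 * Im (\<zeta> i) / Im r" if "i \<in> I" for i
  proof -
    have e: "Im r = Im (\<zeta> i) * ((cmod r)\<^sup>2 * (1 + A i))" "Im (\<zeta> i) > 0" using A[OF that] by auto
    then have "1 + A i \<noteq> 0" using r by auto
    moreover have "(cmod r)\<^sup>2 * Im (\<zeta> i) / Im r = 1 / (1 + A i)"
      unfolding e(1) using e(2) r0 by (simp add: divide_simps)
    ultimately show ?thesis by (simp add: field_simps)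
  qed
  then have "(\<Sum>i\<in>I. A i / (1 + A i)) = (\<Sum>i\<in>I. 1 - (cmod r)\<^sup>2 * Im (\<zeta> i) / Im r)" by simp
  also have "\<dots> = card I - (cmod r)\<^sup>2 * Im (\<Sum>i\<in>I. \<zeta> i) / Im r"
    by (simp add: sum_subtractf sum_distrib_left sum_divide_distrib)
  also have "Im (\<Sum>i\<in>I. \<zeta> i) = Im z + (real (card I) - 1) * Im r / (cmod r)\<^sup>2"
    unfolding sum by (simp add: Im_divide cmod_power2)
  also have "real (card I) - (cmod r)\<^sup>2 * (Im z + (real (card I) - 1) * Im r / (cmod r)\<^sup>2) / Im r =
      1 - (cmod r)\<^sup>2 * Im z / Im r"
    using r r0 by (simp add: divide_simps) (simp add: algebra_simps)
  finally show ?thesis .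
qed

lemma polynomial_le_geometric:
  fixes t L c :: real
  assumes t: "t > 1" and L: "L \<ge> 1"
  obtains M where "M > 0" "\<And>n. (L * real n) powr c \<le> M * t ^ n"
proof -
  have "(\<lambda>n. (L * real n) powr c / t ^ n) \<longlonglongrightarrow> 0" using t L by real_asymp
  then have "Bseq (\<lambda>n. (L * real n) powr c / t ^ n)" by (intro convergent_imp_Bseq convergentI)
  then obtain M where M: "M > 0" "\<And>n. norm ((L * real n) powr c / t ^ n) \<le> M" by (auto elim: BseqE)
  have "(L * real n) powr c \<le> M * t ^ n" for n
    using M(2)[of n] t by (simp add: divide_le_eq abs_le_iff)
  with M(1) show ?thesis by (rule that)
qed

section \<open>Criteria for (AC) and (R4) in terms of the Green function\<close>

context hermitian_element
begin

text \<open>Only small \<eta> needs information on the spectrum. For \<eta> between \<eta>0 and 1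
  the bounds \<open>Im_green_ge\<close> and 1 / \<eta> are uniform in E, as \<open>K\<close> bounds
  the modulus of the spectral parameter.\<close>

lemma condition_AC_I:
  assumes \<eta>0: "0 < \<eta>0" and c: "0 < c"
    and bd: "\<And>E \<eta>. E \<in> {a..b} \<Longrightarrow> 0 < \<eta> \<Longrightarrow> \<eta> < \<eta>0 \<Longrightarrow>
      c \<le> Im (green (Complex E \<eta>) \<one>) \<and> Im (green (Complex E \<eta>) \<one>) \<le> C"
  shows "condition_AC G P {a..b}"
proof -
  define K where "K = \<bar>a\<bar> + \<bar>b\<bar> + 1"
  define d where "d = \<eta>0 / (2 * op_bound + 2 * K\<^sup>2)"
  have K: "K > 0" by (simp add: K_def)
  then have "K\<^sup>2 > 0" by simp
  then have dd: "2 * op_bound + 2 * K\<^sup>2 > 0" using op_bound_nonneg by linarith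
  then have d: "d > 0" using \<eta>0 by (simp add: d_def)
  define C0 where "C0 = Max {1, C, 1 / \<eta>0, 1 / c, 1 / d}"
  have C0: "1 \<le> C0" "C \<le> C0" "1 / \<eta>0 \<le> C0" "1 / c \<le> C0" "1 / d \<le> C0" by (simp_all add: C0_def)
  have inv: "inverse C0 \<le> c" "inverse C0 \<le> d"
    using C0 c d by (simp_all add: field_simps)
  show ?thesis unfolding condition_AC_def Let_def
  proof (intro exI[of _ C0] conjI C0(1) ballI allI impI)
    fix E \<eta> :: real assume E: "E \<in> {a..b}" and \<eta>: "0 < \<eta> \<and> \<eta> \<le> 1"
    define z where "z = Complex E \<eta>"
    have z: "Im z > 0" using \<eta> by (simp add: z_def)
    define e where "e = op_entry V (op_Im V (Res z)) \<one> \<one>"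
    have e: "e = of_real (Im (green z \<one>))"
      unfolding e_def using op_entry_Im_Res[of z \<one>] z by (simp add: complex_eq_iff)
    have "inverse C0 \<le> Im (green z \<one>) \<and> Im (green z \<one>) \<le> C0"
    proof (cases "\<eta> < \<eta>0")
      case True
      then show ?thesis using bd[OF E] \<eta> inv C0 by (force simp: z_def)
    next
      case False
      have "cmod z \<le> \<bar>E\<bar> + \<bar>\<eta>\<bar>" using cmod_le[of z] by (simp add: z_def)
      also have "\<dots> \<le> K" using E \<eta> by (auto simp: K_def)
      finally have "(cmod z)\<^sup>2 \<le> K\<^sup>2" by (intro power_mono) auto
      moreover have "(cmod z)\<^sup>2 > 0" using z by auto
      then have "2 * op_bound + 2 * (cmod z)\<^sup>2 > 0" using op_bound_nonneg by linarith
      ultimately have "d \<le> Im z / (2 * op_bound + 2 * (cmod z)\<^sup>2)"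
        unfolding d_def using False \<eta>0 by (intro frac_le) (auto simp: z_def)
      also have "\<dots> \<le> Im (green z \<one>)" by (rule Im_green_ge[OF z])
      finally have "d \<le> Im (green z \<one>)" .
      moreover have "Im (green z \<one>) \<le> 1 / \<eta>0"
      proof -
        have "Im (green z \<one>) \<le> 1 / Im z" using abs_Im_le_cmod[of "green z \<one>"] cmod_green_le[OF z] by linarith
        also have "\<dots> \<le> 1 / \<eta>0" using False \<eta>0 by (intro divide_left_mono) (auto simp: z_def)
        finally show ?thesis .
      qed
      ultimately show ?thesis using inv C0 by linarith
    qed
    then show "op_entry V (op_Im V (Res (Complex E \<eta>))) \<one> \<one> \<in> \<real>"
      "inverse C0 \<le> Re (op_entry V (op_Im V (Res (Complex E \<eta>))) \<one> \<one>)"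
      "Re (op_entry V (op_Im V (Res (Complex E \<eta>))) \<one> \<one>) \<le> C0"
      unfolding z_def[symmetric] e_def[symmetric] e by simp_all
  qed
qed

text \<open>Up to a phase the entry is half a difference of two values of the Green function, so its
  modulus is at most their maximum, whose fourth power is one of the two summands.\<close>

lemma op_entry_power4_le:
  assumes z: "Im z \<noteq> 0" and g: "g \<in> V"
  shows "cmod (op_entry V (op_Im V (Res z)) \<one> g) ^ 4 \<le> cmod (green z g) ^ 4 + cmod (green z (inv g)) ^ 4"
proof -
  define m where "m = max (cmod (green z g)) (cmod (green z (inv g)))"
  have "cmod (op_entry V (op_Im V (Res z)) \<one> g) = cmod (green z (inv g) - cnj (green z g)) / 2"
    unfolding op_entry_Im_Res[OF z g] by (simp add: norm_divide norm_mult)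
  also have "\<dots> \<le> (cmod (green z (inv g)) + cmod (green z g)) / 2"
    using norm_triangle_ineq4[of "green z (inv g)" "cnj (green z g)"] by simp
  also have "\<dots> \<le> m" by (simp add: m_def)
  finally have "cmod (op_entry V (op_Im V (Res z)) \<one> g) ^ 4 \<le> m ^ 4" by (intro power_mono) auto
  also have "\<dots> \<le> cmod (green z g) ^ 4 + cmod (green z (inv g)) ^ 4"
    by (cases "cmod (green z g) \<le> cmod (green z (inv g))") (auto simp: m_def max_def)
  finally show ?thesis .
qed

text \<open>With the sums bounded uniformly in E and \<eta>, the prefactor \<eta>^2 produces the
  limit. Finite sets suffice because an infinite sum in \<open>ennreal\<close> is the supremum of
  its finite partial sums.\<close>

lemma condition_R4_I:
  assumes \<eta>0: "0 < \<eta>0" and C1': "C1' > 2 * C1 + 1"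
    and bd: "\<And>E \<eta> X. E \<in> I0 \<Longrightarrow> 0 < \<eta> \<Longrightarrow> \<eta> < \<eta>0 \<Longrightarrow> finite X \<Longrightarrow> X \<subseteq> V \<Longrightarrow>
      (\<Sum>g\<in>X. (cmod (green (Complex E \<eta>) g) ^ 4 + cmod (green (Complex E \<eta>) (inv g)) ^ 4)
        * real (word_length G T g) powr C1') \<le> M"
  shows "condition_R4 G T C1 P I0"
  unfolding condition_R4_def
proof (intro exI[of _ C1'] conjI C1')
  define h where "h E \<eta> g = \<eta>\<^sup>2 * cmod (op_entry V (op_Im V (Res (Complex E \<eta>))) \<one> g) ^ 4 * real (word_length G T g) powr C1'"
    for E \<eta> g
  have h0: "0 \<le> h E \<eta> g" for E \<eta> g by (simp add: h_def)
  have le: "(SUP E\<in>I0. \<Sum>\<^sub>\<infinity>g\<in>V. ennreal (h E \<eta> g)) \<le> ennreal (\<eta>\<^sup>2 * M)" if \<eta>: "0 < \<eta>" "\<eta> < \<eta>0" for \<eta>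
  proof (rule SUP_least, rule infsum_le_finite_sums)
    fix E X assume E: "E \<in> I0" and X: "finite X" "X \<subseteq> V"
    have "(\<Sum>g\<in>X. h E \<eta> g) \<le> (\<Sum>g\<in>X. \<eta>\<^sup>2 * ((cmod (green (Complex E \<eta>) g) ^ 4 + cmod (green (Complex E \<eta>) (inv g)) ^ 4)
        * real (word_length G T g) powr C1'))"
      unfolding h_def mult.assoc using X \<eta>
      by (intro sum_mono mult_left_mono mult_right_mono op_entry_power4_le) auto
    also have "\<dots> \<le> \<eta>\<^sup>2 * M"
      unfolding sum_distrib_left[symmetric] by (intro mult_left_mono bd[OF E \<eta> X]) auto
    finally show "(\<Sum>g\<in>X. ennreal (h E \<eta> g)) \<le> ennreal (\<eta>\<^sup>2 * M)"
      using h0 by (simp add: sum_ennreal ennreal_leI)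
  qed (rule nonneg_summable_on_complete, simp)
  have "((\<lambda>\<eta>. ennreal (\<eta>\<^sup>2 * M)) \<longlongrightarrow> ennreal (0\<^sup>2 * M)) (at_right 0)"
    by (intro tendsto_ennrealI tendsto_intros)
  then have lim: "((\<lambda>\<eta>. ennreal (\<eta>\<^sup>2 * M)) \<longlongrightarrow> 0) (at_right 0)" by simp
  have "\<forall>\<^sub>F \<eta> in at_right 0. (SUP E\<in>I0. \<Sum>\<^sub>\<infinity>g\<in>V. ennreal (h E \<eta> g)) \<le> ennreal (\<eta>\<^sup>2 * M)"
    using le by (intro eventually_at_rightI[OF _ \<eta>0]) auto
  then show "((\<lambda>\<eta>. SUP E\<in>I0. \<Sum>\<^sub>\<infinity>g\<in>V. ennreal (\<eta>\<^sup>2 * cmod (op_entry V (op_Im V (Res (Complex E \<eta>))) \<one> g) ^ 4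
      * real (word_length G T g) powr C1')) \<longlongrightarrow> 0) (at_right 0)"
    unfolding h_def[symmetric] by (intro tendsto_sandwich[OF _ _ tendsto_const lim]) auto
qed

end

section \<open>Solutions of the subordination system and the resulting estimates\<close>

context free_product_operator
begin

text \<open>The right-invariant kernel of left convolution by \<open>q i\<close>; substituting inv y
  times x for the summation variable gives the form met in \<open>left_regular\<close>.\<close>

definition factor_kernel :: "'i \<Rightarrow> 'a \<Rightarrow> 'a \<Rightarrow> complex" where
  "factor_kernel i x y = q i (x \<otimes>\<^bsub>\<Gamma> i\<^esub> inv\<^bsub>\<Gamma> i\<^esub> y)"

lemma factor_kernel_hermitian:
  assumes "i \<in> I" "x \<in> carrier (\<Gamma> i)" "y \<in> carrier (\<Gamma> i)"
  shows "factor_kernel i y x = cnj (factor_kernel i x y)"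
proof -
  interpret G: group "\<Gamma> i" by (rule grp[OF assms(1)])
  have "y \<otimes>\<^bsub>\<Gamma> i\<^esub> inv\<^bsub>\<Gamma> i\<^esub> x = inv\<^bsub>\<Gamma> i\<^esub> (x \<otimes>\<^bsub>\<Gamma> i\<^esub> inv\<^bsub>\<Gamma> i\<^esub> y)"
    using assms by (simp add: G.inv_mult_group)
  then show ?thesis using assms by (simp add: factor_kernel_def q_inv)
qed

lemma factor_kernel_op:
  assumes i: "i \<in> I" and x: "x \<in> carrier (\<Gamma> i)"
  shows "kernel_op (carrier (\<Gamma> i)) (factor_kernel i) u x =
    (\<Sum>y\<in>carrier (\<Gamma> i). q i y * u (inv\<^bsub>\<Gamma> i\<^esub> y \<otimes>\<^bsub>\<Gamma> i\<^esub> x))"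
proof -
  interpret G: group "\<Gamma> i" by (rule grp[OF i])
  have canc: "x \<otimes>\<^bsub>\<Gamma> i\<^esub> (inv\<^bsub>\<Gamma> i\<^esub> x \<otimes>\<^bsub>\<Gamma> i\<^esub> b) = b" if "b \<in> carrier (\<Gamma> i)" for b
    using that x by (simp add: G.m_assoc[symmetric])
  show ?thesis unfolding kernel_op_def factor_kernel_def
    by (rule sum.reindex_bij_witness[of _ "\<lambda>y. inv\<^bsub>\<Gamma> i\<^esub> y \<otimes>\<^bsub>\<Gamma> i\<^esub> x" "\<lambda>y. x \<otimes>\<^bsub>\<Gamma> i\<^esub> inv\<^bsub>\<Gamma> i\<^esub> y"])
      (use x in \<open>auto simp: G.inv_mult_group G.m_assoc canc\<close>)
qed

text \<open>The polynomial weight is traded for a factor \<open>t\<close> per syllable, which is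
  charged to the letters by bounding \<open>t\<close> times their fourth-power sums.\<close>

lemma weighted_power4_sum_le:
  assumes t: "t > 1" and Mt: "\<And>n. (L * real n) powr c \<le> M * t ^ n"
    and B: "\<And>i. i \<in> I \<Longrightarrow> (\<Sum>x\<in>punctured (\<Gamma> i). t * cmod (F i x) ^ 4) \<le> B i"
    and lt: "(\<Sum>i\<in>I. B i / (1 + B i)) < 1" and M: "M > 0" and X: "finite X" "X \<subseteq> W"
  shows "(\<Sum>w\<in>X. cmod (product_function r F w) ^ 4 * (L * real (length w)) powr c) \<le>
    cmod r ^ 4 * M * (1 / (1 - (\<Sum>i\<in>I. B i / (1 + B i))))"
proof -
  have "(\<Sum>w\<in>X. cmod (product_function r F w) ^ 4 * (L * real (length w)) powr c) \<le>
      (\<Sum>w\<in>X. cmod r ^ 4 * M * word_weight (\<lambda>i x. t * cmod (F i x) ^ 4) w)"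
  proof (intro sum_mono)
    fix w assume "w \<in> X"
    then have "cmod (product_function r F w) ^ 4 * (L * real (length w)) powr c \<le>
        (cmod r ^ 4 * cmod (word_weight F w) ^ 4) * (M * t ^ length w)"
      using X Mt by (intro mult_mono) (auto simp: product_function_def norm_mult power_mult_distrib)
    then show "cmod (product_function r F w) ^ 4 * (L * real (length w)) powr c \<le>
        cmod r ^ 4 * M * word_weight (\<lambda>i x. t * cmod (F i x) ^ 4) w"
      by (simp add: word_weight_cmod_power mult_ac)
  qed
  also have "\<dots> \<le> cmod r ^ 4 * M * (1 / (1 - (\<Sum>i\<in>I. B i / (1 + B i))))"
    unfolding sum_distrib_left[symmetric] using B t M X fin
    by (intro mult_left_mono sum_reduced_words_le fin_I lt) auto
  finally show ?thesis .
qed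

definition spectral_data :: "('i \<Rightarrow> real set) \<Rightarrow> ('i \<Rightarrow> real \<Rightarrow> 'a \<Rightarrow> complex) \<Rightarrow> ('i \<Rightarrow> real \<Rightarrow> real) \<Rightarrow> bool" where
  "spectral_data \<Lambda> v w \<longleftrightarrow>
    (\<forall>i\<in>I. spectral_resolution (carrier (\<Gamma> i)) (factor_kernel i) \<one>\<^bsub>\<Gamma> i\<^esub> (\<Lambda> i) (v i) (w i))"

text \<open>Applied to the function F of the overview, k = 2 gives A_i and k = 4 gives B_i.\<close>

definition power_sum :: "nat \<Rightarrow> 'i \<Rightarrow> ('a \<Rightarrow> complex) \<Rightarrow> real" where
  "power_sum k i f = (\<Sum>x\<in>punctured (\<Gamma> i). cmod (f x) ^ k)"

lemma power_sum_nonneg: "0 \<le> power_sum k i f"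
  by (simp add: power_sum_def sum_nonneg)

lemma power_sum_divide: "power_sum k i (\<lambda>x. f x / c) = power_sum k i f / cmod c ^ k"
  by (simp add: power_sum_def norm_divide power_divide sum_divide_distrib)

lemma power_sum_4_le: assumes "i \<in> I" shows "power_sum 4 i f \<le> (power_sum 2 i f)\<^sup>2"
proof -
  have "(\<Sum>x\<in>X. (g x)\<^sup>2) \<le> (\<Sum>x\<in>X. g x)\<^sup>2" if "finite X" "\<And>x. 0 \<le> g x" for X :: "'a set" and g :: "'a \<Rightarrow> real"
    using that(1)
  proof (induction X rule: finite_induct)
    case (insert x X)
    have "0 \<le> g x * sum g X" using that(2) by (intro mult_nonneg_nonneg sum_nonneg)
    then show ?case using insert by (simp add: power2_sum)
  qed simp
  from this[of "punctured (\<Gamma> i)" "\<lambda>x. (cmod (f x))\<^sup>2"] show ?thesis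
    using fin[OF assms] by (simp add: power_sum_def power_mult[symmetric])
qed

lemma one_in: "i \<in> I \<Longrightarrow> \<one>\<^bsub>\<Gamma> i\<^esub> \<in> carrier (\<Gamma> i)"
  using group.is_monoid[OF grp] by (rule monoid.one_closed)

context
  fixes \<Lambda> v w
  assumes sd: "spectral_data \<Lambda> v w"
begin

lemma spectral_dataD:
  "i \<in> I \<Longrightarrow> spectral_resolution (carrier (\<Gamma> i)) (factor_kernel i) \<one>\<^bsub>\<Gamma> i\<^esub> (\<Lambda> i) (v i) (w i)"
  using sd by (simp add: spectral_data_def)

lemma spectral_data_weights: assumes i: "i \<in> I" shows "prob_weights (\<Lambda> i) (w i)"
proof -
  interpret G: group "\<Gamma> i" by (rule grp[OF i])
  obtain x where x: "x \<in> carrier (\<Gamma> i)" "x \<noteq> \<one>\<^bsub>\<Gamma> i\<^esub>" "q i x \<noteq> 0" using q_nontrivial[OF i] by auto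
  then have "factor_kernel i x \<one>\<^bsub>\<Gamma> i\<^esub> \<noteq> 0" by (simp add: factor_kernel_def)
  with spectral_resolution_prob_weights[OF spectral_dataD[OF i] fin[OF i] one_in[OF i] x(1,2)] show ?thesis .
qed

text \<open>Real \<open>z\<close> is permitted, so that the boundary point E is a solution in the
  same sense. Positivity of Im(\<zeta>_i) is then a consequence (\<open>solves_Im\<close>).\<close>

definition solves :: "complex \<Rightarrow> complex \<Rightarrow> ('i \<Rightarrow> complex) \<Rightarrow> bool" where
  "solves z r \<zeta> \<longleftrightarrow> Im r > 0 \<and> (\<forall>i\<in>I. r = (\<Sum>\<kappa>\<in>\<Lambda> i. of_real (w i \<kappa>) / (of_real \<kappa> - \<zeta> i))) \<and>
     (\<Sum>i\<in>I. \<zeta> i) = z - (of_nat (card I) - 1) / r"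

definition passage :: "complex \<Rightarrow> ('i \<Rightarrow> complex) \<Rightarrow> 'i \<Rightarrow> 'a \<Rightarrow> complex" where
  "passage r \<zeta> i x = factor_res (\<Lambda> i) (v i) (\<zeta> i) x / r"

lemma solves_eq:
  "solves z r \<zeta> \<Longrightarrow> i \<in> I \<Longrightarrow> r = (\<Sum>\<kappa>\<in>\<Lambda> i. of_real (w i \<kappa>) / (of_real \<kappa> - \<zeta> i))"
  unfolding solves_def by blast

lemma solves_Im: assumes s: "solves z r \<zeta>" and i: "i \<in> I" shows "Im (\<zeta> i) > 0"
proof -
  have "res_mom 1 (\<Lambda> i) (w i) (\<zeta> i) = - (\<Sum>\<kappa>\<in>\<Lambda> i. of_real (w i \<kappa>) / (of_real \<kappa> - \<zeta> i))"
    unfolding res_mom_def sum_negf[symmetric] by (intro sum.cong refl) (simp add: minus_divide_right)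
  also have "\<dots> = - r" unfolding solves_eq[OF s i, symmetric] ..
  finally have "Im (res_mom 1 (\<Lambda> i) (w i) (\<zeta> i)) < 0" using s by (simp add: solves_def)
  then show ?thesis by (rule Im_pos_of_Im_res_mom_1_neg[OF spectral_data_weights[OF i]])
qed

lemma solves_base:
  assumes "solves z r \<zeta>" "i \<in> I" shows "factor_res (\<Lambda> i) (v i) (\<zeta> i) \<one>\<^bsub>\<Gamma> i\<^esub> = r"
  unfolding factor_res_base[OF spectral_dataD[OF assms(2)]] by (rule solves_eq[OF assms, symmetric])

lemma solves_ratio_sum:
  assumes s: "solves z r \<zeta>"
  shows "(\<Sum>i\<in>I. power_sum 2 i (passage r \<zeta> i) / (1 + power_sum 2 i (passage r \<zeta> i))) = 1 - (cmod r)\<^sup>2 * Im z / Im r"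
proof (rule sum_ratio_eq[OF fin_I])
  show r: "Im r > 0" and "(\<Sum>i\<in>I. \<zeta> i) = z - (of_nat (card I) - 1) / r" using s by (auto simp: solves_def)
  fix i assume i: "i \<in> I"
  let ?R = "factor_res (\<Lambda> i) (v i) (\<zeta> i)"
  have Im: "Im (\<zeta> i) > 0" by (rule solves_Im[OF s i])
  have "Im (\<zeta> i) * (\<Sum>x\<in>carrier (\<Gamma> i). (cmod (?R x))\<^sup>2) = Im r"
    using factor_res_norm[OF spectral_dataD[OF i] _ fin[OF i] one_in[OF i] factor_kernel_hermitian[OF i], of "\<zeta> i"]
      Im solves_base[OF s i] by simp
  also have "(\<Sum>x\<in>carrier (\<Gamma> i). (cmod (?R x))\<^sup>2) = (cmod r)\<^sup>2 + power_sum 2 i ?R"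
    unfolding power_sum_def sum.remove[OF fin[OF i] one_in[OF i]] solves_base[OF s i] ..
  also have "\<dots> = (cmod r)\<^sup>2 * (1 + power_sum 2 i (passage r \<zeta> i))"
    unfolding passage_def power_sum_divide using r by (auto simp: field_simps)
  finally show "Im (\<zeta> i) > 0 \<and> Im (\<zeta> i) * ((cmod r)\<^sup>2 * (1 + power_sum 2 i (passage r \<zeta> i))) = Im r"
    using Im by simp
qed

text \<open>If A_i were zero, the resolvent column would be a multiple of the indicator of the unit,
  and the resolvent equation at a point where \<open>q i\<close> is non-zero would fail. Positivity
  enters the strict inequality for three or more factors.\<close>

lemma passage_pos: assumes s: "solves z r \<zeta>" and i: "i \<in> I" shows "power_sum 2 i (passage r \<zeta> i) > 0"
proof (rule ccontr)
  interpret G: group "\<Gamma> i" by (rule grp[OF i])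
  let ?R = "factor_res (\<Lambda> i) (v i) (\<zeta> i)"
  assume "\<not> power_sum 2 i (passage r \<zeta> i) > 0"
  then have "power_sum 2 i (passage r \<zeta> i) = 0" using power_sum_nonneg[of 2 i "passage r \<zeta> i"] by linarith
  moreover have r: "r \<noteq> 0" using s by (auto simp: solves_def)
  ultimately have R0: "?R x = 0" if "x \<in> carrier (\<Gamma> i)" "x \<noteq> \<one>\<^bsub>\<Gamma> i\<^esub>" for x
    using that fin[OF i] by (auto simp: power_sum_def passage_def sum_nonneg_eq_0_iff)
  obtain x where x: "x \<in> carrier (\<Gamma> i)" "x \<noteq> \<one>\<^bsub>\<Gamma> i\<^esub>" "q i x \<noteq> 0" using q_nontrivial[OF i] by auto
  have "kernel_op (carrier (\<Gamma> i)) (factor_kernel i) ?R x = (\<Sum>y\<in>carrier (\<Gamma> i). if y = \<one>\<^bsub>\<Gamma> i\<^esub> then q i x * r else 0)"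
    unfolding kernel_op_def using R0 x solves_base[OF s i] by (intro sum.cong) (auto simp: factor_kernel_def)
  also have "\<dots> = q i x * r" using fin[OF i] by simp
  also have "kernel_op (carrier (\<Gamma> i)) (factor_kernel i) ?R x = 0"
    using factor_res_eq[OF spectral_dataD[OF i] _ x(1), of "\<zeta> i"] solves_Im[OF s i] R0[OF x(1,2)] x(2) by simp
  finally show False using x(3) r by simp
qed

lemma green_eq_product:
  assumes s: "solves z r \<zeta>" and z: "Im z > 0"
  shows "green z = product_function r (passage r \<zeta>)"
proof -
  have r: "r \<noteq> 0" using s by (auto simp: solves_def)
  have z0: "Im z \<noteq> 0" using z by simp
  have "product_function r (passage r \<zeta>) \<in> l2 W"
  proof (rule product_function_l2)
    have "(cmod r)\<^sup>2 * Im z / Im r > 0" using r z s by (simp add: solves_def)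
    then show "(\<Sum>i\<in>I. power_sum 2 i (passage r \<zeta> i) / (1 + power_sum 2 i (passage r \<zeta> i))) < 1"
      unfolding solves_ratio_sum[OF s] by simp
  qed (simp add: power_sum_def)
  moreover have "P (product_function r (passage r \<zeta>)) x - z * product_function r (passage r \<zeta>) x = delta [] x" for x
  proof (rule product_function_eq)
    show "passage r \<zeta> i \<one>\<^bsub>\<Gamma> i\<^esub> = 1" if "i \<in> I" for i
      using solves_base[OF s that] r by (simp add: passage_def)
    show "(\<Sum>i\<in>I. \<zeta> i) = z - (of_nat (card I) - 1) / r" using s by (simp add: solves_def)
    show "r \<noteq> 0" by (rule r)
    show "(\<Sum>y\<in>carrier (\<Gamma> i). q i y * passage r \<zeta> i (inv\<^bsub>\<Gamma> i\<^esub> y \<otimes>\<^bsub>\<Gamma> i\<^esub> x)) =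
        \<zeta> i * passage r \<zeta> i x + (if x = \<one>\<^bsub>\<Gamma> i\<^esub> then 1 / r else 0)"
      if i: "i \<in> I" and x: "x \<in> carrier (\<Gamma> i)" for i x
    proof -
      have "(\<Sum>y\<in>carrier (\<Gamma> i). q i y * passage r \<zeta> i (inv\<^bsub>\<Gamma> i\<^esub> y \<otimes>\<^bsub>\<Gamma> i\<^esub> x)) =
          kernel_op (carrier (\<Gamma> i)) (factor_kernel i) (factor_res (\<Lambda> i) (v i) (\<zeta> i)) x / r"
        unfolding factor_kernel_op[OF i x] by (simp add: passage_def sum_divide_distrib)
      also have "\<dots> = \<zeta> i * passage r \<zeta> i x + (if x = \<one>\<^bsub>\<Gamma> i\<^esub> then 1 / r else 0)"
        using solves_Im[OF s i]
        by (subst factor_res_eq[OF spectral_dataD[OF i] _ x]) (auto simp: passage_def add_divide_distrib)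
      finally show ?thesis .
    qed
  qed
  ultimately show ?thesis
    using green[OF z0] by (intro shifted_inj[OF z0]) auto
qed

text \<open>The second alternative is phrased for the unnormalised resolvent column and all \<zeta>:
  both sides are homogeneous of degree 4, so dividing by r preserves the inequality.\<close>

definition strictly_contracting :: bool where
  "strictly_contracting \<longleftrightarrow> 3 \<le> card I \<or> (\<exists>i j. i \<noteq> j \<and> I = {i, j} \<and>
     (\<forall>\<zeta>. power_sum 4 i (factor_res (\<Lambda> i) (v i) \<zeta>) \<le> (power_sum 2 i (factor_res (\<Lambda> i) (v i) \<zeta>))\<^sup>2 / 2))"

text \<open>The case Im z = 0 is included on purpose: the inequality is applied at the real point E,
  where the ratios of the A_i add up to exactly 1, and is then carried to a neighbourhood by
  continuity.\<close>

lemma solves_strict: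
  assumes s: "solves z r \<zeta>" and z: "Im z \<ge> 0" and sc: strictly_contracting
  shows "(\<Sum>i\<in>I. power_sum 4 i (passage r \<zeta> i) / (1 + power_sum 4 i (passage r \<zeta> i))) < 1"
proof -
  define A B where "A i = power_sum 2 i (passage r \<zeta> i)" and "B i = power_sum 4 i (passage r \<zeta> i)" for i
  have "(cmod r)\<^sup>2 * Im z / Im r \<ge> 0" using s z by (simp add: solves_def)
  then have le: "(\<Sum>i\<in>I. A i / (1 + A i)) \<le> 1" unfolding A_def solves_ratio_sum[OF s] by simp
  have A: "0 < A i" if "i \<in> I" for i unfolding A_def by (rule passage_pos[OF s that])
  have B: "0 \<le> B i \<and> B i \<le> (A i)\<^sup>2" if "i \<in> I" for i
    unfolding A_def B_def using power_sum_4_le[OF that] power_sum_nonneg by blast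
  have "(\<Sum>i\<in>I. B i / (1 + B i)) < 1"
  proof (cases "3 \<le> card I")
    case True
    show ?thesis by (rule sum_square_ratio_less_one[OF fin_I True A B le])
  next
    case False
    then obtain i j where ij: "i \<noteq> j" "I = {i, j}"
      "\<And>\<zeta>. power_sum 4 i (factor_res (\<Lambda> i) (v i) \<zeta>) \<le> (power_sum 2 i (factor_res (\<Lambda> i) (v i) \<zeta>))\<^sup>2 / 2"
      using sc unfolding strictly_contracting_def by blast
    have "B i \<le> (A i)\<^sup>2 / 2"
    proof -
      have "B i \<le> (power_sum 2 i (factor_res (\<Lambda> i) (v i) (\<zeta> i)))\<^sup>2 / 2 / cmod r ^ 4"
        unfolding B_def passage_def power_sum_divide by (intro divide_right_mono ij(3)) simp
      then show ?thesis unfolding A_def passage_def power_sum_divide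
        by (simp add: power_divide power_mult[symmetric])
    qed
    then have "B i / (1 + B i) + B j / (1 + B j) < 1"
      using le A[of i] A[of j] B[of i] B[of j] ij(1,2)
      by (intro sum_square_ratio_less_one_pair[of "A i" "A j"]) auto
    then show ?thesis using ij(1,2) by simp
  qed
  then show ?thesis by (simp add: B_def)
qed

theorem AC_and_R4:
  assumes lt: "(\<Sum>i\<in>I. w i (Max (\<Lambda> i))) < real (card I) - 1 \<or> (\<Sum>i\<in>I. w i (Min (\<Lambda> i))) < real (card I) - 1"
    and sc: strictly_contracting and T: "finite_generating_set FP T"
  shows "\<exists>a b. a < b \<and> condition_AC FP P {a..b} \<and> condition_R4 FP T C1 P {a..b}"
proof -
  obtain E0 :: real and D r \<zeta> where D: "open D" "of_real E0 \<in> D" "continuous_on D r"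
    "\<And>i. i \<in> I \<Longrightarrow> continuous_on D (\<zeta> i)" "Im (r (of_real E0)) > 0"
    "\<And>z i. z \<in> D \<Longrightarrow> i \<in> I \<Longrightarrow> r z = (\<Sum>\<kappa>\<in>\<Lambda> i. of_real (w i \<kappa>) / (of_real \<kappa> - \<zeta> i z))"
    "\<And>z. z \<in> D \<Longrightarrow> (\<Sum>i\<in>I. \<zeta> i z) = z - (of_nat (card I) - 1) / r z"
    by (rule local_subordination[OF fin_I spectral_data_weights lt]; blast intro: that)
  define z0 where "z0 = complex_of_real E0"
  have solves: "solves z (r z) (\<lambda>i. \<zeta> i z)" if "z \<in> D" "Im (r z) > 0" for z
    using that D(6,7) unfolding solves_def by blast
  have s0: "solves z0 (r z0) (\<lambda>i. \<zeta> i z0)" using solves D(2,5) by (simp add: z0_def)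
  define B where "B i z = power_sum 4 i (passage (r z) (\<lambda>i. \<zeta> i z) i)" for i z
  have B0: "0 \<le> B i z" for i z by (simp add: B_def power_sum_nonneg)
  have lim_r: "(r \<longlongrightarrow> r z0) (nhds z0)"
    using D(1,2,3) continuous_on_eq_continuous_at[of D r] by (simp add: z0_def isCont_def tendsto_at_iff_tendsto_nhds)
  have lim_\<zeta>: "(\<zeta> i \<longlongrightarrow> \<zeta> i z0) (nhds z0)" if "i \<in> I" for i
    using D(1,2) D(4)[OF that] continuous_on_eq_continuous_at[of D "\<zeta> i"]
    by (simp add: z0_def isCont_def tendsto_at_iff_tendsto_nhds)
  have lim_B: "(B i \<longlongrightarrow> B i z0) (nhds z0)" if i: "i \<in> I" for i
  proof -
    have "of_real \<kappa> - \<zeta> i z0 \<noteq> 0" for \<kappa> using solves_Im[OF s0 i] by (auto simp: complex_eq_iff)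
    moreover have "r z0 \<noteq> 0" using D(5) by (auto simp: z0_def)
    ultimately show ?thesis unfolding B_def power_sum_def passage_def factor_res_def
      by (intro tendsto_intros lim_r lim_\<zeta> i) auto
  qed
  have strict: "(\<Sum>i\<in>I. B i z0 / (1 + B i z0)) < 1"
    unfolding B_def by (rule solves_strict[OF s0 _ sc]) (simp add: z0_def)
  \<comment> \<open>The slack \<open>u\<close> has two purposes: B_i + u dominates B_i near E, and 1
    + u is the additional factor per syllable. At u = 0 the sum is below 1, so a small positive
    \<open>u\<close> is admissible.\<close>
  define g where "g u = (\<Sum>i\<in>I. (1 + u) * (B i z0 + u) / (1 + (1 + u) * (B i z0 + u)))" for u
  have "(g \<longlongrightarrow> (\<Sum>i\<in>I. (1 + 0) * (B i z0 + 0) / (1 + (1 + 0) * (B i z0 + 0)))) (at_right 0)"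
    unfolding g_def using B0[of _ z0] by (intro tendsto_intros) (auto simp: add_nonneg_eq_0_iff)
  then have "\<forall>\<^sub>F u in at_right 0. g u < 1" using strict by (intro order_tendstoD(2)) auto
  then obtain u where u: "g u < 1" "0 < u"
    using eventually_happens'[OF trivial_limit_at_right_real eventually_conj[OF _ eventually_at_right_less]] by blast
  define \<beta> where "\<beta> i = (1 + u) * (B i z0 + u)" for i
  have \<beta>: "(\<Sum>i\<in>I. \<beta> i / (1 + \<beta> i)) < 1" using u(1) by (simp add: g_def \<beta>_def)
  \<comment> \<open>Half the limiting value, so that a lower bound for Im r survives near E.\<close>
  define c where "c = Im (r z0) / 2"
  define K where "K = cmod (r z0) + 1"
  have c: "0 < c" "c < Im (r z0)" using D(5) by (simp_all add: c_def z0_def)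
  have "\<forall>\<^sub>F z in nhds z0. z \<in> D \<and> c < Im (r z) \<and> cmod (r z) < K \<and> (\<forall>i\<in>I. B i z < B i z0 + u)"
  proof (intro eventually_conj eventually_ball_finite fin_I ballI)
    show "\<forall>\<^sub>F z in nhds z0. z \<in> D" using D(1,2) by (intro eventually_nhds_in_open) (auto simp: z0_def)
    show "\<forall>\<^sub>F z in nhds z0. c < Im (r z)"
      by (rule order_tendstoD(1)[OF tendsto_Im[OF lim_r] c(2)])
    show "\<forall>\<^sub>F z in nhds z0. cmod (r z) < K"
      by (rule order_tendstoD(2)[OF tendsto_norm[OF lim_r]]) (simp add: K_def)
    show "\<forall>\<^sub>F z in nhds z0. B i z < B i z0 + u" if "i \<in> I" for i
      by (rule order_tendstoD(2)[OF lim_B[OF that]]) (use u in simp)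
  qed
  then obtain \<delta> where \<delta>: "\<delta> > 0" and near: "\<And>z. dist z z0 < \<delta> \<Longrightarrow>
      z \<in> D \<and> c < Im (r z) \<and> cmod (r z) < K \<and> (\<forall>i\<in>I. B i z < B i z0 + u)"
    unfolding eventually_nhds_metric by blast
  \<comment> \<open>Half width and height \<delta> / 2 keep every point of the box within distance
    \<delta> of E.\<close>
  define a b where "a = E0 - \<delta> / 2" and "b = E0 + \<delta> / 2"
  have box: "dist (Complex E \<eta>) z0 < \<delta>" if "E \<in> {a..b}" "0 < \<eta>" "\<eta> < \<delta> / 2" for E \<eta>
  proof -
    have "dist (Complex E \<eta>) z0 \<le> \<bar>E - E0\<bar> + \<bar>\<eta>\<bar>"
      using cmod_le[of "Complex E \<eta> - z0"] by (simp add: dist_norm z0_def)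
    also have "\<dots> < \<delta>" using that unfolding a_def b_def by auto
    finally show ?thesis .
  qed
  have green: "green z = product_function (r z) (passage (r z) (\<lambda>i. \<zeta> i z))" if "dist z z0 < \<delta>" "Im z > 0" for z
    using near[OF that(1)] c that by (intro green_eq_product solves) auto
  have AC: "condition_AC FP P {a..b}"
  proof (rule condition_AC_I[of "\<delta> / 2" c])
    fix E \<eta> assume E: "E \<in> {a..b}" and \<eta>: "0 < \<eta>" "\<eta> < \<delta> / 2"
    have "green (Complex E \<eta>) [] = r (Complex E \<eta>)"
      unfolding green[OF box[OF E \<eta>]] using \<eta> green[OF box[OF E \<eta>]] by (simp add: product_function_def)
    then show "c \<le> Im (green (Complex E \<eta>) \<one>\<^bsub>FP\<^esub>) \<and> Im (green (Complex E \<eta>) \<one>\<^bsub>FP\<^esub>) \<le> K"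
      using near[OF box[OF E \<eta>]] abs_Im_le_cmod[of "r (Complex E \<eta>)"] by auto
  qed (use \<delta> c in auto)
  \<comment> \<open>Above 2 C1 + 1, as (R4) demands, and non-negative, so that a power with this
    exponent is monotone in the word length.\<close>
  define C where "C = max (2 * C1 + 2) 0"
  obtain L where L: "L \<ge> 1" "\<And>w. w \<in> W \<Longrightarrow> real (word_length FP T w) \<le> L * real (length w)"
    "\<And>w. w \<in> W \<Longrightarrow> real (word_length FP T (inv\<^bsub>FP\<^esub> w)) \<le> L * real (length w)"
    by (rule word_length_le_syllables[OF T]) blast
  obtain M where M: "M > 0" "\<And>n. (L * real n) powr C \<le> M * (1 + u) ^ n"
    by (rule polynomial_le_geometric[of "1 + u" L C]) (use u L in auto)
  define N where "N = K ^ 4 * M * (1 / (1 - (\<Sum>i\<in>I. \<beta> i / (1 + \<beta> i))))"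
  have R4: "condition_R4 FP T C1 P {a..b}"
  proof (rule condition_R4_I[of "\<delta> / 2" C1 C _ _ "2 * N"])
    fix E \<eta> X assume E: "E \<in> {a..b}" and \<eta>: "0 < \<eta>" "\<eta> < \<delta> / 2" and X: "finite X" "X \<subseteq> carrier FP"
    define z where "z = Complex E \<eta>"
    have z: "dist z z0 < \<delta>" "Im z > 0" using box[OF E \<eta>] \<eta> by (auto simp: z_def)
    have bound: "(\<Sum>w\<in>Y. cmod (green z w) ^ 4 * (L * real (length w)) powr C) \<le> N"
      if Y: "finite Y" "Y \<subseteq> W" for Y
    proof -
      have B: "(\<Sum>x\<in>punctured (\<Gamma> i). (1 + u) * cmod (passage (r z) (\<lambda>i. \<zeta> i z) i x) ^ 4) \<le> \<beta> i"
        if "i \<in> I" for i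
      proof -
        have "B i z \<le> B i z0 + u" using near[OF z(1)] that by (auto intro: less_imp_le)
        then have "(1 + u) * B i z \<le> \<beta> i" unfolding \<beta>_def using u by (intro mult_left_mono) auto
        then show ?thesis by (simp add: B_def power_sum_def sum_distrib_left)
      qed
      have "(\<Sum>w\<in>Y. cmod (green z w) ^ 4 * (L * real (length w)) powr C) \<le>
          cmod (r z) ^ 4 * M * (1 / (1 - (\<Sum>i\<in>I. \<beta> i / (1 + \<beta> i))))"
        unfolding green[OF z] using u by (intro weighted_power4_sum_le[OF _ M(2) B \<beta> M(1) Y]) auto
      also have "\<dots> \<le> N" unfolding N_def using near[OF z(1)] M \<beta>
        by (intro mult_right_mono power_mono) (auto intro: less_imp_le)
      finally show ?thesis .
    qed
    have inj: "inj_on (m_inv FP) X" by (rule inj_onI) (use X in \<open>metis inv_inv subsetD\<close>)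
    have XW: "X \<subseteq> W" using X by simp
    have "(\<Sum>g\<in>X. cmod (green z g) ^ 4 * real (word_length FP T g) powr C) \<le> N"
      using XW L by (intro order_trans[OF _ bound[OF X(1) XW]] sum_mono mult_left_mono powr_mono2) (auto simp: C_def)
    moreover have "(\<Sum>g\<in>X. cmod (green z (inv\<^bsub>FP\<^esub> g)) ^ 4 * real (word_length FP T g) powr C) \<le> N"
    proof -
      have iW: "m_inv FP ` X \<subseteq> W" using XW inv_closed by auto
      have "(\<Sum>g\<in>X. cmod (green z (inv\<^bsub>FP\<^esub> g)) ^ 4 * real (word_length FP T g) powr C) =
          (\<Sum>h\<in>m_inv FP ` X. cmod (green z h) ^ 4 * real (word_length FP T (inv\<^bsub>FP\<^esub> h)) powr C)"
        using X inv_inv by (subst sum.reindex[OF inj]) (auto intro!: sum.cong simp: subset_iff)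
      also have "\<dots> \<le> N"
        using iW L X(1) by (intro order_trans[OF _ bound[OF _ iW]] sum_mono mult_left_mono powr_mono2) (auto simp: C_def)
      finally show ?thesis .
    qed
    ultimately show "(\<Sum>g\<in>X. (cmod (green (Complex E \<eta>) g) ^ 4 + cmod (green (Complex E \<eta>) (inv\<^bsub>FP\<^esub> g)) ^ 4)
        * real (word_length FP T g) powr C) \<le> 2 * N"
      unfolding z_def[symmetric] distrib_right sum.distrib by simp
  qed (use \<delta> in \<open>auto simp: C_def\<close>)
  show ?thesis using AC R4 \<delta> by (intro exI[of _ a] exI[of _ b]) (auto simp: a_def b_def)
qed

end

end

section \<open>Spectral data of the factors\<close>

text \<open>The operator is c (J - 1) with J the all-ones matrix: constants have eigenvalue c (n -
  1), functions of mean zero have -c. The indicator of \<open>e\<close> splits into its mean 1 / n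
  and the rest.\<close>

lemma complete_graph_spectral_resolution:
  fixes c :: real
  assumes X: "finite X" "2 \<le> card X" "e \<in> X" and c: "0 < c"
    and a: "\<And>x y. x \<in> X \<Longrightarrow> y \<in> X \<Longrightarrow> a x y = (if x = y then 0 else of_real c)"
  defines "n \<equiv> real (card X)"
  shows "spectral_resolution X a e {- c, c * (n - 1)}
    (\<lambda>\<kappa> x. if \<kappa> = - c then of_bool (x = e) - of_real (1 / n) else of_real (1 / n))
    (\<lambda>\<kappa>. if \<kappa> = - c then 1 - 1 / n else 1 / n)"
proof -
  have n: "n \<ge> 2" using X by (simp add: n_def)
  have ne: "c * (n - 1) \<noteq> - c" using c n by (simp add: algebra_simps)
  have op: "kernel_op X a u x = of_real c * ((\<Sum>y\<in>X. u y) - u x)" if x: "x \<in> X" for u x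
  proof -
    have "kernel_op X a u x = (\<Sum>y\<in>X. of_real c * u y - (if y = x then of_real c * u x else 0))"
      unfolding kernel_op_def using a[OF x] by (intro sum.cong) auto
    also have "\<dots> = of_real c * (\<Sum>y\<in>X. u y) - of_real c * u x"
      using X x by (simp add: sum_subtractf sum_distrib_left)
    finally show ?thesis by (simp add: right_diff_distrib)
  qed
  have s1: "(\<Sum>y\<in>X. of_bool (y = e) - complex_of_real (1 / n)) = 0"
    using X(1,3) n by (auto simp: sum_subtractf of_bool_def n_def)
  have s2: "(\<Sum>y\<in>X. complex_of_real (1 / n)) = 1" using n by (simp add: n_def)
  show ?thesis unfolding spectral_resolution_def
  proof (intro conjI ballI)
    fix \<kappa> x assume \<kappa>: "\<kappa> \<in> {- c, c * (n - 1)}" and x: "x \<in> X"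
    let ?v = "\<lambda>\<kappa> x. if \<kappa> = - c then of_bool (x = e) - complex_of_real (1 / n) else of_real (1 / n)"
    show "kernel_op X a (?v \<kappa>) x = of_real \<kappa> * ?v \<kappa> x"
    proof (cases "\<kappa> = - c")
      case True
      have "?v \<kappa> = (\<lambda>x. of_bool (x = e) - complex_of_real (1 / n))" using True by auto
      then show ?thesis unfolding op[OF x] by (simp only: s1) (simp add: True algebra_simps)
    next
      case False
      then have "\<kappa> = c * (n - 1)" using \<kappa> by simp
      moreover have "?v \<kappa> = (\<lambda>x. complex_of_real (1 / n))" using False by auto
      ultimately show ?thesis unfolding op[OF x] using n by (simp only: s2) (simp add: field_simps)
    qed
  next
    fix x
    show "(\<Sum>\<kappa>\<in>{- c, c * (n - 1)}. if \<kappa> = - c then of_bool (x = e) - complex_of_real (1 / n) else of_real (1 / n)) = of_bool (x = e)"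
      using ne by (subst sum.insert) auto
  qed (use n X in \<open>auto simp: field_simps\<close>)
qed

lemma (in free_product_operator) spectral_data_exists:
  obtains \<Lambda> v w where "spectral_data \<Lambda> v w"
proof -
  have "\<forall>i\<in>I. \<exists>\<Lambda> v w. spectral_resolution (carrier (\<Gamma> i)) (factor_kernel i) \<one>\<^bsub>\<Gamma> i\<^esub> \<Lambda> v w"
  proof
    fix i assume i: "i \<in> I"
    show "\<exists>\<Lambda> v w. spectral_resolution (carrier (\<Gamma> i)) (factor_kernel i) \<one>\<^bsub>\<Gamma> i\<^esub> \<Lambda> v w"
      by (rule spectral_resolution_exists[OF fin[OF i] one_in[OF i] factor_kernel_hermitian[OF i]]) blast+
  qed
  then obtain \<Lambda> where "\<forall>i\<in>I. \<exists>v w. spectral_resolution (carrier (\<Gamma> i)) (factor_kernel i) \<one>\<^bsub>\<Gamma> i\<^esub> (\<Lambda> i) v w"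
    unfolding bchoice_iff by blast
  then obtain v where "\<forall>i\<in>I. \<exists>w. spectral_resolution (carrier (\<Gamma> i)) (factor_kernel i) \<one>\<^bsub>\<Gamma> i\<^esub> (\<Lambda> i) (v i) w"
    unfolding bchoice_iff by blast
  then obtain w where "\<forall>i\<in>I. spectral_resolution (carrier (\<Gamma> i)) (factor_kernel i) \<one>\<^bsub>\<Gamma> i\<^esub> (\<Lambda> i) (v i) (w i)"
    unfolding bchoice_iff by blast
  then show ?thesis using that unfolding spectral_data_def by blast
qed

text \<open>An atom of the free convolution at the top (bottom) of the spectrum requires top (bottom)
  weights adding up to more than \<open>m - 1\<close>; since these weights add up to at most one in every factor,
  this cannot happen at both ends.\<close>

lemma extreme_weights:
  fixes \<Lambda> :: "'i \<Rightarrow> real set"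
  assumes card: "3 \<le> card I" and pw: "\<And>i. i \<in> I \<Longrightarrow> prob_weights (\<Lambda> i) (w i)"
  shows "(\<Sum>i\<in>I. w i (Max (\<Lambda> i))) < real (card I) - 1 \<or> (\<Sum>i\<in>I. w i (Min (\<Lambda> i))) < real (card I) - 1"
proof -
  have "w i (Max (\<Lambda> i)) + w i (Min (\<Lambda> i)) \<le> 1" if i: "i \<in> I" for i
  proof -
    note P = prob_weightsD[OF pw[OF i]]
    have in': "Max (\<Lambda> i) \<in> \<Lambda> i" "Min (\<Lambda> i) \<in> \<Lambda> i" by (rule Max_in[OF P(1,2)], rule Min_in[OF P(1,2)])
    have "Max (\<Lambda> i) \<noteq> Min (\<Lambda> i)"
    proof
      assume eq: "Max (\<Lambda> i) = Min (\<Lambda> i)"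
      have "\<kappa> = Min (\<Lambda> i)" if "\<kappa> \<in> \<Lambda> i" for \<kappa>
        using Max_ge[OF P(1) that] Min_le[OF P(1) that] unfolding eq by linarith
      then have "\<Lambda> i \<subseteq> {Min (\<Lambda> i)}" by blast
      from card_mono[OF _ this] have "card (\<Lambda> i) \<le> 1" by simp
      moreover have "2 \<le> card (\<Lambda> i)" using pw[OF i] unfolding prob_weights_def by blast
      ultimately show False by linarith
    qed
    then have "w i (Max (\<Lambda> i)) + w i (Min (\<Lambda> i)) = sum (w i) {Max (\<Lambda> i), Min (\<Lambda> i)}" by simp
    also have "\<dots> \<le> sum (w i) (\<Lambda> i)"
      using in' P(3) by (intro sum_mono2 P(1)) (auto intro: less_imp_le)
    finally show ?thesis using P(4) by simp
  qed
  then have "(\<Sum>i\<in>I. w i (Max (\<Lambda> i)) + w i (Min (\<Lambda> i))) \<le> (\<Sum>i\<in>I. 1)" by (rule sum_mono)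
  \<comment> \<open>If both inequalities failed, adding them would give 2 (m - 1) at most m,
    impossible for m at least 3.\<close>
  then show ?thesis using card unfolding sum.distrib by simp linarith
qed

text \<open>Ensures that every factor contributes a non-zero coefficient off its unit, hence a
  spectral measure with at least two atoms.\<close>

lemma symmetric_generators_nontrivial:
  assumes "group G" "symmetric_generators G S" "carrier G \<noteq> {\<one>\<^bsub>G\<^esub>}"
  shows "\<exists>s\<in>S. s \<noteq> \<one>\<^bsub>G\<^esub>"
proof (rule ccontr)
  interpret group G by fact
  assume "\<not> (\<exists>s\<in>S. s \<noteq> \<one>\<^bsub>G\<^esub>)"
  then have "S \<subseteq> {\<one>\<^bsub>G\<^esub>}" by blast
  then have "generate G S \<subseteq> {\<one>\<^bsub>G\<^esub>}" using mono_generate[of S "{\<one>\<^bsub>G\<^esub>}"] generate_one by simp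
  then show False using assms(2,3) one_closed unfolding symmetric_generators_def by blast
qed

theorem proposition6p1:
  fixes \<Gamma> :: "nat \<Rightarrow> ('a, 'b) monoid_scheme"
  shows
    "(\<forall>(m::nat) (S :: nat \<Rightarrow> 'a set) (p :: (nat \<times> 'a) list \<Rightarrow> complex)
        (T :: (nat \<times> 'a) list set) (C1::real).
        m \<ge> 3
        \<and> (\<forall>i\<in>{1..m}. group (\<Gamma> i) \<and> finite (carrier (\<Gamma> i)) \<and> carrier (\<Gamma> i) \<noteq> {\<one>\<^bsub>\<Gamma> i\<^esub>}
              \<and> symmetric_generators (\<Gamma> i) (S i))
        \<and> p \<in> group_algebra (free_product {1..m} \<Gamma>)
        \<and> supp p = (\<Union>i\<in>{1..m}. fp_embed \<Gamma> i ` S i)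
        \<and> p = galg_star (free_product {1..m} \<Gamma>) p
        \<and> finite_generating_set (free_product {1..m} \<Gamma>) T
        \<and> rapid_decay_exponent (free_product {1..m} \<Gamma>) C1
        \<longrightarrow> (\<exists>a b::real. a < b
              \<and> condition_AC (free_product {1..m} \<Gamma>) (left_regular (free_product {1..m} \<Gamma>) p) {a..b}
              \<and> condition_R4 (free_product {1..m} \<Gamma>) T C1
                  (left_regular (free_product {1..m} \<Gamma>) p) {a..b}))
     \<and>
     (\<forall>(p :: (nat \<times> 'a) list \<Rightarrow> complex) (p1::real) (p2::real)
        (T :: (nat \<times> 'a) list set) (C1::real).
        group (\<Gamma> 1) \<and> finite (carrier (\<Gamma> 1)) \<and> card (carrier (\<Gamma> 1)) \<ge> 3
        \<and> group (\<Gamma> 2) \<and> finite (carrier (\<Gamma> 2)) \<and> card (carrier (\<Gamma> 2)) \<ge> 2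
        \<and> p1 > 0 \<and> p2 > 0
        \<and> p = (\<lambda>g. of_real p1 * indicator (fp_embed \<Gamma> 1 ` (carrier (\<Gamma> 1) - {\<one>\<^bsub>\<Gamma> 1\<^esub>})) g
                  + of_real p2 * indicator (fp_embed \<Gamma> 2 ` (carrier (\<Gamma> 2) - {\<one>\<^bsub>\<Gamma> 2\<^esub>})) g)
        \<and> finite_generating_set (free_product {1..2} \<Gamma>) T
        \<and> rapid_decay_exponent (free_product {1..2} \<Gamma>) C1
        \<longrightarrow> (\<exists>a b::real. a < b
              \<and> condition_AC (free_product {1..2} \<Gamma>) (left_regular (free_product {1..2} \<Gamma>) p) {a..b}
              \<and> condition_R4 (free_product {1..2} \<Gamma>) T C1
                  (left_regular (free_product {1..2} \<Gamma>) p) {a..b}))"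
proof (intro conjI allI impI; elim conjE)
  fix m :: nat and S :: "nat \<Rightarrow> 'a set" and p :: "(nat \<times> 'a) list \<Rightarrow> complex"
    and T :: "(nat \<times> 'a) list set" and C1 :: real
  assume m: "3 \<le> m"
    and factors: "\<forall>i\<in>{1..m}. group (\<Gamma> i) \<and> finite (carrier (\<Gamma> i)) \<and> carrier (\<Gamma> i) \<noteq> {\<one>\<^bsub>\<Gamma> i\<^esub>}
      \<and> symmetric_generators (\<Gamma> i) (S i)"
    and supp: "supp p = (\<Union>i\<in>{1..m}. fp_embed \<Gamma> i ` S i)"
    and star: "p = galg_star (free_product {1..m} \<Gamma>) p"
    and T: "finite_generating_set (free_product {1..m} \<Gamma>) T"
  have grp: "group (\<Gamma> i)" and fin: "finite (carrier (\<Gamma> i))" and nt: "carrier (\<Gamma> i) \<noteq> {\<one>\<^bsub>\<Gamma> i\<^esub>}"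
    and S: "symmetric_generators (\<Gamma> i) (S i)" if "i \<in> {1..m}" for i
    using factors that by blast+
  have p_inv: "p (inv\<^bsub>free_product {1..m} \<Gamma>\<^esub> g) = cnj (p g)" if "g \<in> reduced_words {1..m} \<Gamma>" for g
  proof -
    have "cnj (p g) = cnj (galg_star (free_product {1..m} \<Gamma>) p g)" by (subst star) (rule refl)
    then show ?thesis using that by (simp add: galg_star_def free_product_def)
  qed
  \<comment> \<open>A set of generators may contain the unit, so \<open>p []\<close> may be
    non-zero; this coefficient is assigned entirely to the first factor.\<close>
  define q where "q i x = (if x = \<one>\<^bsub>\<Gamma> i\<^esub> then if i = 1 then p [] else 0 else p [(i, x)])" for i x
  interpret free_product_operator "{1..m}" \<Gamma> p q
  proof (rule free_product_operator.intro)
    show "finite {1..m}" by simp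
    fix i assume i: "i \<in> {1..m}"
    interpret G: group "\<Gamma> i" by (rule grp[OF i])
    show "group (\<Gamma> i)" "finite (carrier (\<Gamma> i))" by (rule grp[OF i], rule fin[OF i])
    show "q i (inv\<^bsub>\<Gamma> i\<^esub> x) = cnj (q i x)" if x: "x \<in> carrier (\<Gamma> i)" for x
    proof (cases "x = \<one>\<^bsub>\<Gamma> i\<^esub>")
      case True
      have "inv\<^bsub>free_product {1..m} \<Gamma>\<^esub> [] = []" by (rule free_product_inv_Nil) (rule grp)
      then have "p [] = cnj (p [])" using p_inv[OF reduced_words_Nil] by simp
      then show ?thesis using True by (simp add: q_def)
    next
      case False
      then have "p (inv\<^bsub>free_product {1..m} \<Gamma>\<^esub> [(i, x)]) = cnj (p [(i, x)])"
        using i x by (intro p_inv) (simp add: reduced_words_Cons)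
      moreover have "inv\<^bsub>free_product {1..m} \<Gamma>\<^esub> [(i, x)] = [(i, inv\<^bsub>\<Gamma> i\<^esub> x)]"
        by (intro free_product_inv_letter[where G = \<Gamma>] grp i x False)
      ultimately have "p [(i, inv\<^bsub>\<Gamma> i\<^esub> x)] = cnj (p [(i, x)])" by (simp only:)
      then show ?thesis using False inv_eq_one_iff[OF grp[OF i] x] by (simp add: q_def)
    qed
    obtain s where s: "s \<in> S i" "s \<noteq> \<one>\<^bsub>\<Gamma> i\<^esub>" using symmetric_generators_nontrivial[OF grp[OF i] S[OF i] nt[OF i]] by blast
    have "fp_embed \<Gamma> i s \<in> supp p" unfolding supp using i s(1) by blast
    then have "q i s \<noteq> 0" using s(2) by (simp add: q_def fp_embed_def supp_def)
    moreover have "s \<in> carrier (\<Gamma> i)" using S[OF i] s(1) by (auto simp: symmetric_generators_def)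
    ultimately show "\<exists>x\<in>punctured (\<Gamma> i). q i x \<noteq> 0" using s(2) by blast
    show "p [(i, x)] = q i x" if "x \<noteq> \<one>\<^bsub>\<Gamma> i\<^esub>" for x using that by (simp add: q_def)
  next
    show "p [] = (\<Sum>i\<in>{1..m}. q i \<one>\<^bsub>\<Gamma> i\<^esub>)" using m by (simp add: q_def)
    show "supp p \<subseteq> insert [] ((\<lambda>l. [l]) ` Sigma {1..m} (\<lambda>i. punctured (\<Gamma> i)))"
    proof
      fix g assume "g \<in> supp p"
      then obtain i s where i: "i \<in> {1..m}" "s \<in> S i" "g = fp_embed \<Gamma> i s" unfolding supp by blast
      have "s \<in> carrier (\<Gamma> i)" using S[OF i(1)] i(2) by (auto simp: symmetric_generators_def)
      then show "g \<in> insert [] ((\<lambda>l. [l]) ` Sigma {1..m} (\<lambda>i. punctured (\<Gamma> i)))"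
        using i by (cases "s = \<one>\<^bsub>\<Gamma> i\<^esub>") (auto simp: fp_embed_def)
    qed
  qed
  obtain \<Lambda> v w where sd: "spectral_data \<Lambda> v w" by (rule spectral_data_exists)
  have card: "3 \<le> card {1..m}" using m by simp
  show "\<exists>a b. a < b \<and> condition_AC (free_product {1..m} \<Gamma>) (left_regular (free_product {1..m} \<Gamma>) p) {a..b} \<and>
      condition_R4 (free_product {1..m} \<Gamma>) T C1 (left_regular (free_product {1..m} \<Gamma>) p) {a..b}"
    by (rule AC_and_R4[OF sd extreme_weights[OF card spectral_data_weights[OF sd]] _ T])
      (simp_all only: strictly_contracting_def[OF sd] card simp_thms)
next
  fix p :: "(nat \<times> 'a) list \<Rightarrow> complex" and p1 p2 :: real
    and T :: "(nat \<times> 'a) list set" and C1 :: real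
  assume G1: "group (\<Gamma> 1)" "finite (carrier (\<Gamma> 1))" "3 \<le> card (carrier (\<Gamma> 1))"
    and G2: "group (\<Gamma> 2)" "finite (carrier (\<Gamma> 2))" "2 \<le> card (carrier (\<Gamma> 2))"
    and pos: "0 < p1" "0 < p2"
    and p: "p = (\<lambda>g. of_real p1 * indicator (fp_embed \<Gamma> 1 ` (punctured (\<Gamma> 1))) g
                  + of_real p2 * indicator (fp_embed \<Gamma> 2 ` (carrier (\<Gamma> 2) - {\<one>\<^bsub>\<Gamma> 2\<^esub>})) g)"
    and T: "finite_generating_set (free_product {1..2} \<Gamma>) T"
  have I: "{1..2} = {1, 2::nat}" by auto
  define c where "c i = (if i = 1 then p1 else p2)" for i :: nat
  define n where "n i = real (card (carrier (\<Gamma> i)))" for i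
  define q where "q i x = (if x = \<one>\<^bsub>\<Gamma> i\<^esub> then 0 else complex_of_real (c i))" for i x
  have grp: "group (\<Gamma> i)" and fin: "finite (carrier (\<Gamma> i))" and card2: "2 \<le> card (carrier (\<Gamma> i))"
    and c: "0 < c i" if "i \<in> {1..2}" for i
    using that G1 G2 pos unfolding I by (auto simp: c_def)
  interpret free_product_operator "{1..2}" \<Gamma> p q
  proof (rule free_product_operator.intro)
    show "finite {1..2::nat}" by simp
    fix i :: nat assume i: "i \<in> {1..2}"
    interpret G: group "\<Gamma> i" by (rule grp[OF i])
    show "group (\<Gamma> i)" "finite (carrier (\<Gamma> i))" by (rule grp[OF i], rule fin[OF i])
    show "q i (inv\<^bsub>\<Gamma> i\<^esub> x) = cnj (q i x)" if x: "x \<in> carrier (\<Gamma> i)" for x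
      using inv_eq_one_iff[OF grp[OF i] x] by (simp add: q_def)
    have "punctured (\<Gamma> i) \<noteq> {}"
    proof
      assume "punctured (\<Gamma> i) = {}"
      then have "carrier (\<Gamma> i) \<subseteq> {\<one>\<^bsub>\<Gamma> i\<^esub>}" by blast
      from card_mono[OF _ this] show False using card2[OF i] by simp
    qed
    then show "\<exists>x\<in>punctured (\<Gamma> i). q i x \<noteq> 0" using c[OF i] by (auto simp: q_def)
    show "p [(i, x)] = q i x" if "x \<in> carrier (\<Gamma> i)" "x \<noteq> \<one>\<^bsub>\<Gamma> i\<^esub>" for x
      using that i unfolding I p by (auto simp: q_def c_def fp_embed_def indicator_def image_iff)
  next
    show "p [] = (\<Sum>i\<in>{1..2}. q i \<one>\<^bsub>\<Gamma> i\<^esub>)"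
      unfolding I p by (auto simp: q_def fp_embed_def indicator_def)
    show "supp p \<subseteq> insert [] ((\<lambda>l. [l]) ` Sigma {1..2} (\<lambda>i. punctured (\<Gamma> i)))"
      unfolding I p by (auto simp: supp_def fp_embed_def indicator_def split: if_splits)
  qed
  define \<Lambda> where "\<Lambda> i = {- c i, c i * (n i - 1)}" for i
  define v where "v i \<kappa> x = (if \<kappa> = - c i then of_bool (x = \<one>\<^bsub>\<Gamma> i\<^esub>) - complex_of_real (1 / n i) else of_real (1 / n i))"
    for i \<kappa> and x :: 'a
  define w where "w i \<kappa> = (if \<kappa> = - c i then 1 - 1 / n i else 1 / n i)" for i \<kappa>
  have sd: "spectral_data \<Lambda> v w" unfolding spectral_data_def
  proof
    fix i :: nat assume i: "i \<in> {1..2}"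
    interpret G: group "\<Gamma> i" by (rule grp[OF i])
    show "spectral_resolution (carrier (\<Gamma> i)) (factor_kernel i) \<one>\<^bsub>\<Gamma> i\<^esub> (\<Lambda> i) (v i) (w i)"
      unfolding \<Lambda>_def v_def[abs_def] w_def[abs_def] n_def
    proof (rule complete_graph_spectral_resolution[OF fin[OF i] card2[OF i] one_in[OF i] c[OF i]])
      fix x y assume xy: "x \<in> carrier (\<Gamma> i)" "y \<in> carrier (\<Gamma> i)"
      have "x \<otimes>\<^bsub>\<Gamma> i\<^esub> inv\<^bsub>\<Gamma> i\<^esub> y = \<one>\<^bsub>\<Gamma> i\<^esub> \<longleftrightarrow> x = y"
        using xy by (metis G.inv_closed G.inv_equality G.inv_inv G.r_inv)
      then show "factor_kernel i x y = (if x = y then 0 else of_real (c i))"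
        by (simp add: factor_kernel_def q_def)
    qed
  qed
  have n: "n 1 \<ge> 3" "n 2 \<ge> 2" using G1 G2 by (simp_all add: n_def)
  \<comment> \<open>As \<open>c i\<close> is positive, the top eigenvalue is the one of the constant
    function, with weight 1 / n; it is not the branch value -c in the definition of
    \<open>w\<close>.\<close>
  have top: "w i (Max (\<Lambda> i)) = 1 / n i" if i: "i \<in> {1..2}" for i
  proof -
    have "n i \<ge> 2" using card2[OF i] by (simp add: n_def)
    then have "0 < c i * n i" using c[OF i] by simp
    then have "- c i < c i * (n i - 1)" by (simp add: algebra_simps)
    then have "Max (\<Lambda> i) = c i * (n i - 1)" "c i * (n i - 1) \<noteq> - c i" by (simp_all add: \<Lambda>_def)
    then show ?thesis by (simp add: w_def)
  qed
  have bounds: "1 / n 1 \<le> 1 / 3" "1 / n 2 \<le> 1 / 2" using n by (simp_all add: field_simps)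
  \<comment> \<open>The bound 1/3 + 1/2 < 1 uses that the first group has at least three elements;
    two groups of order two would give exactly 1.\<close>
  have lt: "(\<Sum>i\<in>{1..2}. w i (Max (\<Lambda> i))) < real (card {1..2::nat}) - 1"
  proof -
    have "w 1 (Max (\<Lambda> 1)) = 1 / n 1" "w 2 (Max (\<Lambda> 2)) = 1 / n 2" by (rule top, simp)+
    then have "(\<Sum>i\<in>{1, 2}. w i (Max (\<Lambda> i))) = 1 / n 1 + 1 / n 2" by (simp del: One_nat_def)
    also have "\<dots> < 1" using bounds by linarith
    finally show ?thesis unfolding I by simp
  qed
  \<comment> \<open>By symmetry of the complete graph the resolvent column takes one value
    \<open>k\<close> at all N points off the unit, so the ratio of the two sides before halving is 1
    / N, and N is at least 2.\<close>
  have power: "power_sum 4 1 (factor_res (\<Lambda> 1) (v 1) \<zeta>) \<le> (power_sum 2 1 (factor_res (\<Lambda> 1) (v 1) \<zeta>))\<^sup>2 / 2" for \<zeta>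
  proof -
    define k where "k = (\<Sum>\<kappa>\<in>\<Lambda> 1. 1 / (of_real \<kappa> - \<zeta>) *
      (if \<kappa> = - c 1 then - complex_of_real (1 / n 1) else of_real (1 / n 1)))"
    have k: "factor_res (\<Lambda> 1) (v 1) \<zeta> x = k" if "x \<noteq> \<one>\<^bsub>\<Gamma> 1\<^esub>" for x
      unfolding factor_res_def k_def v_def using that by (intro sum.cong refl) (simp only: of_bool_eq simp_thms if_False diff_0)
    define N where "N = card (punctured (\<Gamma> 1))"
    have "\<one>\<^bsub>\<Gamma> 1\<^esub> \<in> carrier (\<Gamma> 1)" by (rule one_in) simp
    then have "N = card (carrier (\<Gamma> 1)) - 1" using G1(2) by (simp add: N_def)
    then have N: "real N \<ge> 2" using G1(3) by simp
    have ps: "power_sum j 1 (factor_res (\<Lambda> 1) (v 1) \<zeta>) = real N * cmod k ^ j" for j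
    proof -
      have "power_sum j 1 (factor_res (\<Lambda> 1) (v 1) \<zeta>) = (\<Sum>x\<in>punctured (\<Gamma> 1). cmod k ^ j)"
        unfolding power_sum_def using k by (intro sum.cong refl) (simp del: One_nat_def)
      then show ?thesis by (simp add: N_def)
    qed
    have "real N * 2 \<le> real N * real N" using N by (intro mult_left_mono) auto
    then have "real N * 2 * cmod k ^ 4 \<le> real N * real N * cmod k ^ 4" by (intro mult_right_mono) auto
    moreover have k4: "(cmod k ^ 2)\<^sup>2 = cmod k ^ 4" by (simp add: power_mult[symmetric])
    ultimately show ?thesis unfolding ps power_mult_distrib k4 power2_eq_square[of "real N"] by linarith
  qed
  have sc: "strictly_contracting \<Lambda> v"
    unfolding strictly_contracting_def[OF sd]
    by (intro disjI2 exI[of _ 1] exI[of _ 2] conjI allI power I) simp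
  show "\<exists>a b. a < b \<and> condition_AC (free_product {1..2} \<Gamma>) (left_regular (free_product {1..2} \<Gamma>) p) {a..b} \<and>
      condition_R4 (free_product {1..2} \<Gamma>) T C1 (left_regular (free_product {1..2} \<Gamma>) p) {a..b}"
    by (rule AC_and_R4[OF sd disjI1[OF lt] sc T])
qed

end
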